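(* Let $\mathbb{K}$ be an algebraically closed field and let $n$ be a positive integer. Let $U_1,\ldots,U_s$ be a finite collection of triangular $\mathbb{G}_a$-subgroups of $\mathrm{Aut}(\mathbb{A}^n)$. Then the subgroup of $\mathrm{Aut}(\mathbb{A}^n)$ generated by $U_1,\ldots,U_s$ is a unipotent algebraic subgroup of $\mathrm{Aut}(\mathbb{A}^n)$.
   Context: $\mathbb{A}^n$ is the affine space over $\mathbb{K}$, and $\mathrm{Aut}(\mathbb{A}^n)$ is its group of polynomial automorphisms, identified with the group of $\mathbb{K}$-algebra automorphisms of $\mathbb{K}[x_1,\ldots,x_n]$. An automorphism $\varphi$ is represented by the tuple $(f_1,\ldots,f_n)$ with $f_i=\varphi(x_i)$. An automorphism is triangular if its tuple satisfies $f_i=\lambda_i x_i+h_i$ for all $i$, where the $\lambda_i\in\mathbb{K}$ are nonzero scalars, $h_i\in\mathbb{K}[x_1,\ldots,x_{i-1}]$ for $i=2,\ldots,n$, and $h_1\in\mathbb{K}$. A subgroup of $\mathrm{Aut}(\mathbb{A}^n)$ is triangular if it consists of triangular automorphisms. A subgroup $G$ of $\mathrm{Aut}(\mathbb{A}^n)$ is algebraic if $G$ has a structure of an algebraic group over $\mathbb{K}$ such that the action $G\times\mathbb{A}^n\to\mathbb{A}^n$ is a morphism of algebraic varieties. $\mathbb{G}_a$ is the additive group of $\mathbb{K}$, regarded as a one-dimensional (unipotent) algebraic group. A $\mathbb{G}_a$-subgroup of $\mathrm{Aut}(\mathbb{A}^n)$ is an algebraic subgroup isomorphic to $\mathbb{G}_a$.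 An algebraic group is unipotent if all its elements are unipotent. *)

theory Defs
  imports
    "HOL-Algebra.Bij"
    "HOL-Algebra.Generated_Groups"
    "HOL-Library.Poly_Mapping"
    "HOL-Computational_Algebra.Fundamental_Theorem_Algebra"
begin

section \<open>Multivariate polynomials\<close>

text \<open>
  A polynomial with variables named by \<open>'v\<close> is a finitely supported function from monomials
  \<open>'v \<Rightarrow>\<^sub>0 nat\<close> to coefficients; \<open>Poly_Mapping\<close> makes this type a commutative ring.
\<close>

type_synonym ('v, 'a) mpolynomial = "('v \<Rightarrow>\<^sub>0 nat) \<Rightarrow>\<^sub>0 'a"

definition polynomials_in :: "'v set \<Rightarrow> ('v, 'a::zero) mpolynomial set" where
  "polynomials_in I = {p. \<forall>m\<in>Poly_Mapping.keys p. Poly_Mapping.keys m \<subseteq> I}"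

definition mpoly_eval :: "('v \<Rightarrow> 'a) \<Rightarrow> ('v, 'a::comm_semiring_1) mpolynomial \<Rightarrow> 'a" where
  "mpoly_eval x p =
     (\<Sum>m\<in>Poly_Mapping.keys p. Poly_Mapping.lookup p m *
        (\<Prod>v\<in>Poly_Mapping.keys m. x v ^ Poly_Mapping.lookup m v))"


section \<open>Affine varieties and their morphisms\<close>

text \<open>
  Affine varieties are taken in the classical sense, as Zariski closed sets of points with
  coordinates in the field. Coordinates are indexed by a set \<open>I\<close>, so that the product of varieties
  with coordinates indexed by \<open>I\<close> and \<open>J\<close> lives in the affine space with coordinates indexed by
  the disjoint union \<open>I <+> J\<close>. Points are undefined outside the index set.
\<close>

definition affine_space :: "'v set \<Rightarrow> ('v \<Rightarrow> 'a) set" where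
  "affine_space I = I \<rightarrow>\<^sub>E UNIV"

definition zariski_closed :: "'v set \<Rightarrow> ('v \<Rightarrow> 'a::comm_semiring_1) set \<Rightarrow> bool" where
  "zariski_closed I V \<longleftrightarrow>
     (\<exists>S \<subseteq> polynomials_in I. V = {x \<in> affine_space I. \<forall>p\<in>S. mpoly_eval x p = 0})"

definition regular_function ::
    "'v set \<Rightarrow> ('v \<Rightarrow> 'a::comm_semiring_1) set \<Rightarrow> (('v \<Rightarrow> 'a) \<Rightarrow> 'a) \<Rightarrow> bool" where
  "regular_function I V f \<longleftrightarrow> (\<exists>p \<in> polynomials_in I. \<forall>x\<in>V. f x = mpoly_eval x p)"

definition coordinate_ring ::
    "'v set \<Rightarrow> ('v \<Rightarrow> 'a::comm_semiring_1) set \<Rightarrow> (('v \<Rightarrow> 'a) \<Rightarrow> 'a) set" where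
  "coordinate_ring I V = {f \<in> extensional V. regular_function I V f}"

definition variety_morphism ::
    "'v set \<Rightarrow> ('v \<Rightarrow> 'a::comm_semiring_1) set \<Rightarrow> 'w set \<Rightarrow> ('w \<Rightarrow> 'a) set \<Rightarrow>
       (('v \<Rightarrow> 'a) \<Rightarrow> ('w \<Rightarrow> 'a)) \<Rightarrow> bool" where
  "variety_morphism I V J W f \<longleftrightarrow>
     f \<in> V \<rightarrow> W \<and> (\<forall>j\<in>J. regular_function I V (\<lambda>x. f x j))"

text \<open>
  A point \<open>z\<close> of the product has the components \<open>z \<circ> Inl\<close> and \<open>z \<circ> Inr\<close>.
\<close>

definition variety_product ::
    "('v \<Rightarrow> 'a) set \<Rightarrow> ('w \<Rightarrow> 'a) set \<Rightarrow> ('v + 'w \<Rightarrow> 'a) set" where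
  "variety_product V W = (\<lambda>(x, y). case_sum x y) ` (V \<times> W)"


section \<open>Affine algebraic groups\<close>

text \<open>
  An affine algebraic group is a group whose carrier is a Zariski closed subset of the affine
  \<open>m\<close>-space and whose multiplication and inversion are morphisms of varieties. Every affine
  algebraic group over an algebraically closed field is isomorphic to one of this form.
\<close>

definition affine_algebraic_group :: "nat \<Rightarrow> (nat \<Rightarrow> 'a::field) monoid \<Rightarrow> bool" where
  "affine_algebraic_group m G \<longleftrightarrow>
     group G \<and>
     zariski_closed {1..m} (carrier G) \<and>
     variety_morphism ({1..m} <+> {1..m}) (variety_product (carrier G) (carrier G))
       {1..m} (carrier G) (\<lambda>z. (z \<circ> Inl) \<otimes>\<^bsub>G\<^esub> (z \<circ> Inr)) \<and>
     variety_morphism {1..m} (carrier G) {1..m} (carrier G) (\<lambda>x. inv\<^bsub>G\<^esub> x)"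

definition algebraic_group_iso ::
    "nat \<Rightarrow> (nat \<Rightarrow> 'a::field) monoid \<Rightarrow> nat \<Rightarrow> (nat \<Rightarrow> 'a) monoid \<Rightarrow>
       ((nat \<Rightarrow> 'a) \<Rightarrow> (nat \<Rightarrow> 'a)) \<Rightarrow> bool" where
  "algebraic_group_iso m G k H f \<longleftrightarrow>
     f \<in> iso G H \<and>
     variety_morphism {1..m} (carrier G) {1..k} (carrier H) f \<and>
     variety_morphism {1..k} (carrier H) {1..m} (carrier G) (inv_into (carrier G) f)"

definition additive_group :: "(nat \<Rightarrow> 'a::field) monoid" where
  "additive_group =
     \<lparr>carrier = affine_space {1..1},
      monoid.mult = (\<lambda>x y. \<lambda>i\<in>{1..1}. x i + y i),
      monoid.one = (\<lambda>i\<in>{1..1}. 0)\<rparr>"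

text \<open>
  An element \<open>g\<close> is unipotent if right translation by \<open>g\<close> is a unipotent operator on the
  coordinate ring. Right translations act locally finitely, so this means that the translation
  minus the identity is locally nilpotent.
\<close>

definition right_translation ::
    "((nat \<Rightarrow> 'a) monoid) \<Rightarrow> (nat \<Rightarrow> 'a) \<Rightarrow> ((nat \<Rightarrow> 'a) \<Rightarrow> 'a) \<Rightarrow> ((nat \<Rightarrow> 'a) \<Rightarrow> 'a)" where
  "right_translation G g f = (\<lambda>x\<in>carrier G. f (x \<otimes>\<^bsub>G\<^esub> g))"

definition unipotent_element ::
    "nat \<Rightarrow> (nat \<Rightarrow> 'a::field) monoid \<Rightarrow> (nat \<Rightarrow> 'a) \<Rightarrow> bool" where
  "unipotent_element m G g \<longleftrightarrow>
     (\<forall>f \<in> coordinate_ring {1..m} (carrier G). \<exists>k.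
        ((\<lambda>h. \<lambda>x\<in>carrier G. right_translation G g h x - h x) ^^ k) f = (\<lambda>x\<in>carrier G. 0))"

definition unipotent_algebraic_group :: "nat \<Rightarrow> (nat \<Rightarrow> 'a::field) monoid \<Rightarrow> bool" where
  "unipotent_algebraic_group m G \<longleftrightarrow>
     affine_algebraic_group m G \<and> (\<forall>g\<in>carrier G. unipotent_element m G g)"


section \<open>Automorphisms of affine space\<close>

abbreviation affine_nspace :: "nat \<Rightarrow> (nat \<Rightarrow> 'a) set" where
  "affine_nspace n \<equiv> affine_space {1..n}"

text \<open>
  The tuple \<open>(f\<^sub>1, \<dots>, f\<^sub>n)\<close> of an automorphism \<open>\<phi>\<close> consists of its coordinate functions
  \<open>\<lambda>x. \<phi> x i\<close>. An algebraically closed field is infinite, so these functions determine the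
  polynomials representing them. Composition is composition of maps of points; the group of
  algebra automorphisms of the polynomial ring is the opposite group, with the same subgroups
  and the same generated subgroups.
\<close>

definition Aut_affine :: "nat \<Rightarrow> ((nat \<Rightarrow> 'a::field) \<Rightarrow> (nat \<Rightarrow> 'a)) monoid" where
  "Aut_affine n = BijGroup (affine_nspace n)
     \<lparr>carrier := {\<phi> \<in> Bij (affine_nspace n).
        variety_morphism {1..n} (affine_nspace n) {1..n} (affine_nspace n) \<phi> \<and>
        variety_morphism {1..n} (affine_nspace n) {1..n} (affine_nspace n)
          (inv_into (affine_nspace n) \<phi>)}\<rparr>"

definition triangular_automorphism ::
    "nat \<Rightarrow> ((nat \<Rightarrow> 'a::field) \<Rightarrow> (nat \<Rightarrow> 'a)) \<Rightarrow> bool" where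
  "triangular_automorphism n \<phi> \<longleftrightarrow>
     \<phi> \<in> carrier (Aut_affine n) \<and>
     (\<forall>i\<in>{1..n}. \<exists>c h. c \<noteq> 0 \<and> h \<in> polynomials_in {1..<i} \<and>
        (\<forall>x\<in>affine_nspace n. \<phi> x i = c * x i + mpoly_eval x h))"

definition triangular_subgroup ::
    "nat \<Rightarrow> ((nat \<Rightarrow> 'a::field) \<Rightarrow> (nat \<Rightarrow> 'a)) set \<Rightarrow> bool" where
  "triangular_subgroup n U \<longleftrightarrow>
     subgroup U (Aut_affine n) \<and> (\<forall>\<phi>\<in>U. triangular_automorphism n \<phi>)"

text \<open>
  The structure of an affine algebraic group on the subgroup \<open>U\<close> is given by an affine algebraic
  group \<open>G\<close> and a group isomorphism \<open>\<rho>\<close> from \<open>G\<close> onto \<open>U\<close>, along which the structure is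
  transported; the action of \<open>U\<close> on the affine space has to be a morphism for this structure.
\<close>

definition algebraic_structure ::
    "nat \<Rightarrow> ((nat \<Rightarrow> 'a::field) \<Rightarrow> (nat \<Rightarrow> 'a)) set \<Rightarrow> nat \<Rightarrow> (nat \<Rightarrow> 'a) monoid \<Rightarrow>
       ((nat \<Rightarrow> 'a) \<Rightarrow> ((nat \<Rightarrow> 'a) \<Rightarrow> (nat \<Rightarrow> 'a))) \<Rightarrow> bool" where
  "algebraic_structure n U m G \<rho> \<longleftrightarrow>
     subgroup U (Aut_affine n) \<and>
     affine_algebraic_group m G \<and>
     \<rho> \<in> iso G (Aut_affine n\<lparr>carrier := U\<rparr>) \<and>
     variety_morphism ({1..m} <+> {1..n}) (variety_product (carrier G) (affine_nspace n))
       {1..n} (affine_nspace n) (\<lambda>z. \<rho> (z \<circ> Inl) (z \<circ> Inr))"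

definition Ga_subgroup ::
    "nat \<Rightarrow> ((nat \<Rightarrow> 'a::field) \<Rightarrow> (nat \<Rightarrow> 'a)) set \<Rightarrow> bool" where
  "Ga_subgroup n U \<longleftrightarrow>
     (\<exists>m G \<rho>. algebraic_structure n U m G \<rho> \<and> (\<exists>f. algebraic_group_iso m G 1 additive_group f))"

definition unipotent_algebraic_subgroup ::
    "nat \<Rightarrow> ((nat \<Rightarrow> 'a::field) \<Rightarrow> (nat \<Rightarrow> 'a)) set \<Rightarrow> bool" where
  "unipotent_algebraic_subgroup n U \<longleftrightarrow>
     (\<exists>m G \<rho>. algebraic_structure n U m G \<rho> \<and> unipotent_algebraic_group m G)"

end

theory Submission
  imports Defs
begin

text \<open>
  The diagonal entries of a triangular action of the additive group are nowhere vanishing polynomials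
  in the parameter, so they equal 1. For weights of the coordinates that grow fast enough, all
  generators preserve the weight filtration of the polynomial ring. Hence the degrees of the elements
  of the generated group \<open>H\<close> are bounded, and an element of \<open>H\<close> is determined by its values at
  finitely many points. In these coordinates composition and inversion are polynomial.

  The group \<open>H\<close> is the directed union of the images of the polynomial maps
  \<open>(t\<^sub>1, \<dots>, t\<^sub>r) \<mapsto> \<theta>\<^sub>1(t\<^sub>1) \<circ> \<dots> \<circ> \<theta>\<^sub>r(t\<^sub>r)\<close>. An image of largest transcendence degree is dense in
  the closure of \<open>H\<close>, and by elimination it contains a nonempty open subset of this closure. Any
  element of the closure is then a quotient of two elements of \<open>H\<close>, so \<open>H\<close> is closed. It is
  unipotent because \<open>f \<mapsto> f \<circ> \<gamma> - f\<close> is locally nilpotent on polynomials for unitriangular \<open>\<gamma>\<close>.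
\<close>

section \<open>Polynomial functions\<close>

text \<open>The obstacle is that \<open>Aut_affine n\<close> is not a finite-dimensional algebraic
  group, so the classical theorem on groups generated by irreducible subvarieties through the
  identity has no ambient group to work in. The substitute is one finite-dimensional space of
  functions that contains all components of all elements of the generated group. Weights that are
  powers of one large constant provide it: a polynomial of degree at most \<open>N\<close> in the
  coordinates before \<open>x_i\<close> has weight at most
  \<open>N * M ^ (i - 1) \<le> M ^ i\<close>, so \<open>x_i\<close> and its image obey the same
  bound, and products of any length stay within it. The number of factors in a product is not
  bounded beforehand either; the word to work with is selected by a maximal number of algebraically
  independent coordinates. Polynomials are treated as functions; the field is infinite, so this
  loses nothing.\<close>

inductive_set polyfuns :: "'v set \<Rightarrow> (('v \<Rightarrow> 'a::comm_semiring_1) \<Rightarrow> 'a) set" for I where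
  const: "(\<lambda>_. c) \<in> polyfuns I"
| var: "i \<in> I \<Longrightarrow> (\<lambda>x. x i) \<in> polyfuns I"
| add: "f \<in> polyfuns I \<Longrightarrow> g \<in> polyfuns I \<Longrightarrow> (\<lambda>x. f x + g x) \<in> polyfuns I"
| mult: "f \<in> polyfuns I \<Longrightarrow> g \<in> polyfuns I \<Longrightarrow> (\<lambda>x. f x * g x) \<in> polyfuns I"

lemma polyfuns_mono:
  assumes "f \<in> polyfuns I" "I \<subseteq> J"
  shows "f \<in> polyfuns J"
  using assms(1) by induction (use assms(2) in \<open>auto intro: polyfuns.intros\<close>)

lemma polyfuns_sum:
  assumes "\<And>k. k \<in> A \<Longrightarrow> f k \<in> polyfuns I"
  shows "(\<lambda>x. \<Sum>k\<in>A. f k x) \<in> polyfuns I"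
  using assms by (induction A rule: infinite_finite_induct) (auto intro: polyfuns.intros)

lemma polyfuns_prod:
  assumes "\<And>k. k \<in> A \<Longrightarrow> f k \<in> polyfuns I"
  shows "(\<lambda>x. \<Prod>k\<in>A. f k x) \<in> polyfuns I"
  using assms by (induction A rule: infinite_finite_induct) (auto intro: polyfuns.intros)

lemma polyfuns_power:
  assumes "f \<in> polyfuns I"
  shows "(\<lambda>x. f x ^ k) \<in> polyfuns I"
  by (induction k) (use assms in \<open>auto intro: polyfuns.intros\<close>)

lemma polyfuns_diff:
  fixes f g :: "('v \<Rightarrow> 'a::comm_ring_1) \<Rightarrow> 'a"
  assumes "f \<in> polyfuns I" "g \<in> polyfuns I"
  shows "(\<lambda>x. f x - g x) \<in> polyfuns I"
proof -
  have "(\<lambda>x. f x + (-1) * g x) \<in> polyfuns I"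
    by (intro polyfuns.intros assms)
  then show ?thesis by simp
qed

lemma polyfuns_cong:
  assumes "f \<in> polyfuns I" "\<And>i. i \<in> I \<Longrightarrow> x i = y i"
  shows "f x = f y"
  using assms(1) by induction (use assms(2) in auto)

lemma polyfuns_comp:
  assumes "f \<in> polyfuns I" "\<And>i. i \<in> I \<Longrightarrow> (\<lambda>y. g y i) \<in> polyfuns J"
  shows "(\<lambda>y. f (g y)) \<in> polyfuns J"
  using assms(1) by induction (use assms(2) in \<open>auto intro: polyfuns.intros\<close>)

section \<open>Monomials and the comparison with formal polynomials\<close>

definition monomial_fun :: "('v \<Rightarrow>\<^sub>0 nat) \<Rightarrow> ('v \<Rightarrow> 'a::comm_semiring_1) \<Rightarrow> 'a" where
  "monomial_fun m x = (\<Prod>v\<in>Poly_Mapping.keys m. x v ^ Poly_Mapping.lookup m v)"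

lemma monomial_fun_superset:
  assumes "finite S" "Poly_Mapping.keys m \<subseteq> S"
  shows "monomial_fun m x = (\<Prod>v\<in>S. x v ^ Poly_Mapping.lookup m v)"
  unfolding monomial_fun_def
  by (rule prod.mono_neutral_left) (use assms in \<open>auto simp: in_keys_iff\<close>)

lemma monomial_fun_add: "monomial_fun (m + m') x = monomial_fun m x * monomial_fun m' x"
proof -
  let ?S = "Poly_Mapping.keys m \<union> Poly_Mapping.keys m'"
  have "monomial_fun (m + m') x = (\<Prod>v\<in>?S. x v ^ Poly_Mapping.lookup (m + m') v)"
    by (rule monomial_fun_superset) (simp_all add: Poly_Mapping.keys_add)
  moreover have "monomial_fun m x = (\<Prod>v\<in>?S. x v ^ Poly_Mapping.lookup m v)"
    by (rule monomial_fun_superset) auto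
  moreover have "monomial_fun m' x = (\<Prod>v\<in>?S. x v ^ Poly_Mapping.lookup m' v)"
    by (rule monomial_fun_superset) auto
  ultimately show ?thesis
    by (simp add: lookup_add power_add prod.distrib)
qed

lemma mpoly_eval_superset:
  assumes "finite S" "Poly_Mapping.keys p \<subseteq> S"
  shows "mpoly_eval x p = (\<Sum>m\<in>S. Poly_Mapping.lookup p m * monomial_fun m x)"
  unfolding mpoly_eval_def monomial_fun_def[symmetric]
  by (rule sum.mono_neutral_left) (use assms in \<open>auto simp: in_keys_iff\<close>)

lemma mpoly_eval_add: "mpoly_eval x (p + q) = mpoly_eval x p + mpoly_eval x q"
proof -
  let ?S = "Poly_Mapping.keys p \<union> Poly_Mapping.keys q"
  have "mpoly_eval x (p + q) = (\<Sum>m\<in>?S. Poly_Mapping.lookup (p + q) m * monomial_fun m x)"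
    by (rule mpoly_eval_superset) (simp_all add: Poly_Mapping.keys_add)
  moreover have "mpoly_eval x p = (\<Sum>m\<in>?S. Poly_Mapping.lookup p m * monomial_fun m x)"
    by (rule mpoly_eval_superset) auto
  moreover have "mpoly_eval x q = (\<Sum>m\<in>?S. Poly_Mapping.lookup q m * monomial_fun m x)"
    by (rule mpoly_eval_superset) auto
  ultimately show ?thesis
    by (simp add: lookup_add algebra_simps sum.distrib)
qed

lemma mpoly_eval_single: "mpoly_eval x (Poly_Mapping.single m c) = c * monomial_fun m x"
  by (subst mpoly_eval_superset[of "{m}"]) (auto split: if_splits)

lemma polynomials_in_add:
  "p \<in> polynomials_in I \<Longrightarrow> q \<in> polynomials_in I \<Longrightarrow> p + q \<in> polynomials_in I"
  using Poly_Mapping.keys_add[of p q] by (fastforce simp: polynomials_in_def)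

lemma polynomials_in_single:
  "Poly_Mapping.keys m \<subseteq> I \<Longrightarrow> Poly_Mapping.single m c \<in> polynomials_in I"
  by (auto simp: polynomials_in_def split: if_splits)

text \<open>Evaluated polynomials are finite sums of monomial functions, and these are closed under
  products because exponents add. From here on polynomials can be handled by induction over the
  closure rules of \<open>polyfuns\<close>.\<close>

lemma polyfuns_eq_mpoly_eval:
  "polyfuns I = (\<lambda>p x. mpoly_eval x p) ` polynomials_in I" (is "_ = ?R")
proof (intro equalityI subsetI)
  fix f :: "('a \<Rightarrow> 'b) \<Rightarrow> 'b"
  assume "f \<in> ?R"
  then obtain p where p: "p \<in> polynomials_in I" "f = (\<lambda>x. mpoly_eval x p)" by auto
  show "f \<in> polyfuns I"
    unfolding p(2) mpoly_eval_def
    by (intro polyfuns_sum polyfuns.intros polyfuns_prod polyfuns_power)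
      (use p(1) in \<open>auto simp: polynomials_in_def\<close>)
next
  have single: "(\<lambda>x. c * monomial_fun m x) \<in> ?R" if "Poly_Mapping.keys m \<subseteq> I"
    for m and c :: 'b
    using polynomials_in_single[OF that, of c] by (force simp: mpoly_eval_single[symmetric])
  have sum: "(\<lambda>x. \<Sum>k\<in>A. h k x) \<in> ?R" if "\<And>k. k \<in> A \<Longrightarrow> h k \<in> ?R"
    for A :: "'c set" and h :: "'c \<Rightarrow> ('a \<Rightarrow> 'b) \<Rightarrow> 'b"
    using that
  proof (induction A rule: infinite_finite_induct)
    case (insert k A)
    have "h k \<in> ?R" "(\<lambda>x. \<Sum>k\<in>A. h k x) \<in> ?R"
      using insert by auto
    then obtain p q where "p \<in> polynomials_in I" "h k = (\<lambda>x. mpoly_eval x p)"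
      "q \<in> polynomials_in I" "(\<lambda>x. \<Sum>k\<in>A. h k x) = (\<lambda>x. mpoly_eval x q)" by blast
    then show ?case
      using insert.hyps by (intro image_eqI[of _ _ "p + q"] polynomials_in_add)
        (simp_all add: mpoly_eval_add fun_eq_iff)
  qed (use single[of 0 0] in \<open>auto simp: monomial_fun_def\<close>)
  fix f :: "('a \<Rightarrow> 'b) \<Rightarrow> 'b"
  assume "f \<in> polyfuns I"
  then show "f \<in> ?R"
  proof induction
    case (const c)
    then show ?case using single[of 0 c] by (simp add: monomial_fun_def)
  next
    case (var i)
    then show ?case using single[of "Poly_Mapping.single i 1" 1]
      by (simp add: monomial_fun_def)
  next
    case (add f g)
    then obtain p q where "p \<in> polynomials_in I" "f = (\<lambda>x. mpoly_eval x p)"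
      "q \<in> polynomials_in I" "g = (\<lambda>x. mpoly_eval x q)" by auto
    then show ?case
      by (auto intro!: image_eqI[of _ _ "p + q"] polynomials_in_add simp: mpoly_eval_add)
  next
    case (mult f g)
    then obtain p q where pq: "p \<in> polynomials_in I" "f = (\<lambda>x. mpoly_eval x p)"
      "q \<in> polynomials_in I" "g = (\<lambda>x. mpoly_eval x q)" by auto
    have "(\<lambda>x. f x * g x) = (\<lambda>x. \<Sum>m\<in>Poly_Mapping.keys p. \<Sum>m'\<in>Poly_Mapping.keys q.
      (Poly_Mapping.lookup p m * Poly_Mapping.lookup q m') * monomial_fun (m + m') x)"
      by (simp add: pq mpoly_eval_superset[OF finite_keys subset_refl] sum_product
          monomial_fun_add algebra_simps)
    also have "\<dots> \<in> ?R"
    proof (intro sum single)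
      fix m m' assume "m \<in> Poly_Mapping.keys p" "m' \<in> Poly_Mapping.keys q"
      then show "Poly_Mapping.keys (m + m') \<subseteq> I"
        using pq Poly_Mapping.keys_add[of m m'] by (fastforce simp: polynomials_in_def)
    qed
    finally show ?case .
  qed
qed

lemma regular_function_iff:
  "regular_function I V f \<longleftrightarrow> (\<exists>p\<in>polyfuns I. \<forall>x\<in>V. f x = p x)"
  by (auto simp: regular_function_def polyfuns_eq_mpoly_eval)

lemma zariski_closedI:
  assumes "S \<subseteq> polyfuns I" "V = {x \<in> affine_space I. \<forall>p\<in>S. p x = 0}"
  shows "zariski_closed I V"
proof -
  let ?T = "{p \<in> polynomials_in I. (\<lambda>x. mpoly_eval x p) \<in> S}"
  have "(\<forall>p\<in>S. p x = 0) \<longleftrightarrow> (\<forall>p\<in>?T. mpoly_eval x p = 0)" for x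
    using assms(1) by (fastforce simp: polyfuns_eq_mpoly_eval)
  then show ?thesis
    unfolding zariski_closed_def assms(2) by (intro exI[of _ ?T]) auto
qed

text \<open>Euclid's argument: over a finite field the product of all \<open>x - a\<close>, plus 1,
  has positive degree and no root.\<close>

lemma infinite_UNIV_alg_closed: "infinite (UNIV :: 'a::alg_closed_field set)"
proof
  assume fin: "finite (UNIV :: 'a set)"
  define p where "p = (\<Prod>a\<in>UNIV. [:- a, 1 :: 'a:])"
  have "degree p = card (UNIV :: 'a set)"
    unfolding p_def by (subst degree_prod_eq_sum_degree) auto
  then have "degree (p + 1) > 0"
    using fin by (subst degree_add_eq_left) (auto simp: card_gt_0_iff)
  then obtain x where "poly (p + 1) x = 0"
    using alg_closed_imp_poly_has_root by blast
  moreover have "poly p x = 0"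
    using fin by (auto simp: p_def poly_prod)
  ultimately show False by simp
qed

text \<open>This reduces questions in many variables to root counting in one. It also shows later
  that a component of a one-parameter family is polynomial in the parameter.\<close>

lemma polyfuns_line:
  assumes "f \<in> polyfuns I"
  shows "\<exists>P. \<forall>u. f (\<lambda>i. a i + u * b i) = poly P u"
  using assms
proof induction
  case (const c)
  show ?case by (rule exI[of _ "[:c:]"]) simp
next
  case (var i)
  show ?case by (rule exI[of _ "[:a i, b i:]"]) simp
next
  case (add f g)
  then show ?case by (metis poly_add)
next
  case (mult f g)
  then show ?case by (metis poly_mult)
qed

text \<open>On the line that joins \<open>p\<close> and \<open>q\<close> both functions become
  nonzero polynomials, one being nonzero at parameter 0 and the other at parameter 1. Their product
  has finitely many roots, and the field is infinite.\<close>

lemma polyfuns_no_zero_divisors: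
  fixes f g :: "('v \<Rightarrow> 'a::alg_closed_field) \<Rightarrow> 'a"
  assumes "f \<in> polyfuns I" "g \<in> polyfuns I" "f p \<noteq> 0" "g q \<noteq> 0"
  shows "\<exists>x. f x \<noteq> 0 \<and> g x \<noteq> 0"
proof -
  obtain P where P: "\<And>u. f (\<lambda>i. p i + u * (q i - p i)) = poly P u"
    using polyfuns_line[OF assms(1), of p "\<lambda>i. q i - p i"] by blast
  obtain Q where Q: "\<And>u. g (\<lambda>i. p i + u * (q i - p i)) = poly Q u"
    using polyfuns_line[OF assms(2), of p "\<lambda>i. q i - p i"] by blast
  have "P \<noteq> 0" "Q \<noteq> 0"
    using P[of 0] Q[of 1] assms(3,4) by auto
  then have "finite {u. poly (P * Q) u = 0}"
    by (intro poly_roots_finite) auto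
  then obtain u where "poly (P * Q) u \<noteq> 0"
    using ex_new_if_finite[OF infinite_UNIV_alg_closed] by blast
  then show ?thesis
    by (intro exI[of _ "\<lambda>i. p i + u * (q i - p i)"]) (auto simp: P Q)
qed


section \<open>Elimination of a variable\<close>

text \<open>
  The closure of \<open>X\<close> consists of points of the whole type, of which only the coordinates in \<open>I\<close>
  matter.
\<close>

definition zariski_closure :: "'v set \<Rightarrow> ('v \<Rightarrow> 'a::comm_semiring_1) set \<Rightarrow> ('v \<Rightarrow> 'a) set" where
  "zariski_closure I X = {z. \<forall>p\<in>polyfuns I. (\<forall>x\<in>X. p x = 0) \<longrightarrow> p z = 0}"

lemma zariski_closureD:
  "z \<in> zariski_closure I X \<Longrightarrow> p \<in> polyfuns I \<Longrightarrow> (\<And>x. x \<in> X \<Longrightarrow> p x = 0) \<Longrightarrow> p z = 0"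
  by (auto simp: zariski_closure_def)

text \<open>The functions in \<open>polyfuns I\<close> that vanish on \<open>X\<close> form a prime
  ideal (or the whole ring, when \<open>X\<close> is empty). This expresses irreducibility of the
  closure through points of \<open>X\<close>; a smaller \<open>I\<close> corresponds to a projection
  of \<open>X\<close>.\<close>

definition irreducible_on :: "'v set \<Rightarrow> ('v \<Rightarrow> 'a::comm_semiring_1) set \<Rightarrow> bool" where
  "irreducible_on I X \<longleftrightarrow> (\<forall>f\<in>polyfuns I. \<forall>g\<in>polyfuns I.
     (\<forall>x\<in>X. f x * g x = 0) \<longrightarrow> (\<forall>x\<in>X. f x = 0) \<or> (\<forall>x\<in>X. g x = 0))"

lemma irreducible_onD:
  assumes "irreducible_on I X" "f \<in> polyfuns I" "g \<in> polyfuns I"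
    and "\<And>x. x \<in> X \<Longrightarrow> f x * g x = 0" "x \<in> X" "f x \<noteq> 0" "y \<in> X"
  shows "g y = 0"
  using assms unfolding irreducible_on_def by blast

lemma irreducible_on_mono: "irreducible_on J X \<Longrightarrow> I \<subseteq> J \<Longrightarrow> irreducible_on I X"
  unfolding irreducible_on_def by (blast intro: polyfuns_mono)

section \<open>Expansion in powers of one coordinate, and division\<close>

definition expansion ::
    "'v \<Rightarrow> (nat \<Rightarrow> ('v \<Rightarrow> 'a::comm_semiring_1) \<Rightarrow> 'a) \<Rightarrow> nat \<Rightarrow> ('v \<Rightarrow> 'a) \<Rightarrow> 'a" where
  "expansion j c d x = (\<Sum>k\<le>d. c k x * x j ^ k)"

lemma expansion_in_polyfuns:
  "(\<And>k. c k \<in> polyfuns I) \<Longrightarrow> expansion j c d \<in> polyfuns (insert j I)"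
  unfolding expansion_def
  by (intro polyfuns_sum polyfuns.mult polyfuns_power polyfuns.var) (auto intro: polyfuns_mono)

lemma expansion_0 [simp]: "expansion j c 0 x = c 0 x"
  by (simp add: expansion_def)

lemma expansion_extend:
  "d \<le> e \<Longrightarrow> expansion j c d x = expansion j (\<lambda>k. if k \<le> d then c k else (\<lambda>_. 0)) e x"
  unfolding expansion_def by (rule sum.mono_neutral_cong_left) auto

lemma polyfuns_expand:
  assumes "f \<in> polyfuns (insert j I)"
  shows "\<exists>c d. (\<forall>k. c k \<in> polyfuns I) \<and> (\<forall>x. f x = expansion j c d x)"
proof -
  define R :: "(('a \<Rightarrow> 'b) \<Rightarrow> 'b) set" where "R = {f. \<exists>c d. (\<forall>k. c k \<in> polyfuns I) \<and> f = expansion j c d}"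
  have add: "(\<lambda>x. f x + g x) \<in> R" if "f \<in> R" "g \<in> R" for f g
  proof -
    obtain c d where c: "\<And>k. c k \<in> polyfuns I" "f = expansion j c d"
      using \<open>f \<in> R\<close> unfolding R_def by blast
    obtain c' d' where c': "\<And>k. c' k \<in> polyfuns I" "g = expansion j c' d'"
      using \<open>g \<in> R\<close> unfolding R_def by blast
    define b where "b k = (\<lambda>x. (if k \<le> d then c k else (\<lambda>_. 0)) x +
      (if k \<le> d' then c' k else (\<lambda>_. 0)) x)" for k
    have "b k \<in> polyfuns I" for k
      using c(1) c'(1) by (auto simp: b_def intro!: polyfuns.add polyfuns.const)
    moreover have "f x + g x = expansion j b (max d d') x" for x
      unfolding c(2) c'(2)
      by (simp add: expansion_extend[of d "max d d'"] expansion_extend[of d' "max d d'"])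
        (simp add: expansion_def b_def sum.distrib algebra_simps)
    ultimately show ?thesis
      unfolding R_def by blast
  qed
  have mono: "(\<lambda>x. c x * x j ^ d) \<in> R" if "c \<in> polyfuns I" for c d
  proof -
    have "(\<lambda>x. c x * x j ^ d) = expansion j (\<lambda>k. if k = d then c else (\<lambda>_. 0)) d"
      by (simp add: expansion_def fun_eq_iff if_distrib[where f = "\<lambda>h. h _"]
        if_distrib[where f = "\<lambda>h. h * _"] cong: if_cong)
    moreover have "\<forall>k. (if k = d then c else (\<lambda>_. 0)) \<in> polyfuns I"
      using that by (auto intro: polyfuns.const)
    ultimately show ?thesis unfolding R_def
      by (intro CollectI exI[of _ "\<lambda>k. if k = d then c else (\<lambda>_. 0)"] exI[of _ d] conjI)
  qed
  have const: "(\<lambda>_. c) \<in> R" for c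
    using mono[OF polyfuns.const, of c 0] by simp
  have sum: "(\<lambda>x. \<Sum>k\<in>A. h k x) \<in> R" if "\<And>k. k \<in> A \<Longrightarrow> h k \<in> R" for A :: "nat set" and h
    using that by (induction A rule: infinite_finite_induct) (auto intro: add const)
  from assms have "f \<in> R"
  proof induction
    case (var i)
    then show ?case
      using mono[OF polyfuns.const[of 1], of 1] mono[OF polyfuns.var[of i], of 0] by auto
  next
    case (mult f g)
    then obtain c d c' d' where c: "\<And>k. c k \<in> polyfuns I" "f = expansion j c d"
      and c': "\<And>k. c' k \<in> polyfuns I" "g = expansion j c' d'"
      unfolding R_def by blast
    have "(\<lambda>x. f x * g x) =
        (\<lambda>x. \<Sum>k\<le>d. \<Sum>l\<le>d'. (c k x * c' l x) * x j ^ (k + l))"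
      unfolding c(2) c'(2) expansion_def sum_product
      by (intro ext sum.cong) (simp_all add: power_add mult_ac)
    also have "\<dots> \<in> R"
      by (intro sum mono polyfuns.mult c c')
    finally show ?case .
  qed (auto intro: const add)
  then show ?thesis unfolding R_def by auto
qed

text \<open>The formal top coefficient of an expansion may vanish on all of \<open>X\<close>.
  Dropping the terms above the largest index whose coefficient is not identically 0 on
  \<open>X\<close> changes no value on \<open>X\<close> and gives a genuine degree there.\<close>

lemma expansion_leading:
  assumes "k \<le> d" "x \<in> X" "c k x \<noteq> 0"
  shows "\<exists>e\<le>d. (\<exists>y\<in>X. c e y \<noteq> 0) \<and> (\<forall>x\<in>X. expansion j c d x = expansion j c e x)"
proof -
  define K where "K = {k. k \<le> d \<and> (\<exists>x\<in>X. c k x \<noteq> 0)}"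
  have fin: "finite K" "k \<in> K" using assms by (auto simp: K_def)
  then have "Max K \<in> K" by (intro Max_in) auto
  then obtain y where y: "Max K \<le> d" "y \<in> X" "c (Max K) y \<noteq> 0"
    by (auto simp: K_def)
  moreover have "expansion j c d x = expansion j c (Max K) x" if "x \<in> X" for x
    unfolding expansion_def
  proof (rule sum.mono_neutral_right)
    show "\<forall>i\<in>{..d} - {..Max K}. c i x * x j ^ i = 0"
    proof
      fix i assume "i \<in> {..d} - {..Max K}"
      then have "i \<notin> K" "i \<le> d" using Max_ge[OF fin(1), of i] by auto
      then show "c i x * x j ^ i = 0" using that by (auto simp: K_def)
    qed
  qed (use y in auto)
  ultimately show ?thesis by blast
qed

lemma expansion_leading':
  assumes "x \<in> X" "expansion j c d x \<noteq> 0"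
  shows "\<exists>e\<le>d. (\<exists>y\<in>X. c e y \<noteq> 0) \<and> (\<forall>x\<in>X. expansion j c d x = expansion j c e x)"
proof -
  have "\<exists>k\<le>d. c k x \<noteq> 0"
    by (rule ccontr) (use assms(2) in \<open>auto simp: expansion_def\<close>)
  then obtain k where "k \<le> d" "c k x \<noteq> 0" by blast
  then show ?thesis using expansion_leading[of k d x X c j] assms(1) by blast
qed

text \<open>The leading coefficient \<open>r e\<close> of the divisor cannot be inverted in
  \<open>polyfuns I\<close>, so one factor \<open>r e\<close> is multiplied in for each of the
  \<open>s + 1\<close> division steps. The last conjunct records the leading coefficient of the
  quotient, which later shows that a quotient cannot vanish.\<close>

lemma pseudo_division:
  fixes r g :: "nat \<Rightarrow> ('v \<Rightarrow> 'a::comm_ring_1) \<Rightarrow> 'a"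
  assumes r: "\<And>k. r k \<in> polyfuns I" and g: "\<And>k. g k \<in> polyfuns I"
  shows "\<exists>q p. (\<forall>k. q k \<in> polyfuns I) \<and> (\<forall>k. p k \<in> polyfuns I) \<and>
    (\<forall>x. r e x ^ Suc s * expansion j g (e + s) x =
       expansion j q s x * expansion j r e x + (\<Sum>k<e. p k x * x j ^ k)) \<and>
    (\<forall>x. q s x = r e x ^ s * g (e + s) x)"
  using g
proof (induction s arbitrary: g)
  case 0
  define p where "p k = (\<lambda>x. r e x * g k x - g e x * r k x)" for k
  have "p k \<in> polyfuns I" for k
    unfolding p_def by (intro polyfuns_diff polyfuns.mult r 0)
  moreover have "r e x * expansion j g e x =
      g e x * expansion j r e x + (\<Sum>k<e. p k x * x j ^ k)" for x
    by (simp add: expansion_def p_def lessThan_Suc_atMost[symmetric] algebra_simps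
        sum_distrib_left sum_subtractf)
  ultimately show ?case
    by (intro exI[of _ "\<lambda>_. g e"] exI[of _ p]) (auto simp: 0)
next
  case (Suc s)
  define t where "t = g (e + Suc s)"
  \<comment> \<open>Multiplying by \<open>r e\<close> and subtracting \<open>t * x_j ^ Suc s\<close>
    times the divisor cancels the top coefficient, so the degree drops to at most
    \<open>e + s\<close>.\<close>
  define g' where "g' k = (\<lambda>x. r e x * g k x -
    (if k \<ge> Suc s then t x * r (k - Suc s) x else 0))" for k
  have g': "g' k \<in> polyfuns I" for k
  proof (cases "k \<ge> Suc s")
    case True
    then show ?thesis
      by (simp add: g'_def t_def) (intro polyfuns_diff polyfuns.mult r Suc.prems)
  next
    case False
    then show ?thesis
      by (simp add: g'_def) (intro polyfuns.mult r Suc.prems)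
  qed
  have step: "r e x * expansion j g (e + Suc s) x =
      expansion j g' (e + s) x + t x * x j ^ Suc s * expansion j r e x" for x
  proof -
    have "(\<Sum>k\<le>e + Suc s. (if k \<ge> Suc s then t x * r (k - Suc s) x else 0) * x j ^ k) =
        (\<Sum>k\<in>{0 + Suc s..e + Suc s}. t x * r (k - Suc s) x * x j ^ k)"
      by (rule sum.mono_neutral_cong_right) auto
    also have "\<dots> = (\<Sum>k\<in>{0..e}. t x * r k x * x j ^ (k + Suc s))"
      by (subst sum.shift_bounds_cl_nat_ivl) (simp del: power_Suc)
    also have "\<dots> = t x * x j ^ Suc s * expansion j r e x"
      by (simp add: expansion_def sum_distrib_left power_add mult_ac atMost_atLeast0)
    finally have *: "(\<Sum>k\<le>e + Suc s. (if k \<ge> Suc s then t x * r (k - Suc s) x else 0) * x j ^ k)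
      = t x * x j ^ Suc s * expansion j r e x" .
    have "expansion j g' (e + s) x = expansion j g' (e + Suc s) x"
      by (simp add: expansion_def g'_def t_def algebra_simps)
    also have "\<dots> = r e x * expansion j g (e + Suc s) x - t x * x j ^ Suc s * expansion j r e x"
      unfolding *[symmetric] unfolding expansion_def g'_def
      by (simp only: left_diff_distrib sum_subtractf sum_distrib_left mult.assoc)
    finally show ?thesis by simp
  qed
  obtain q p where q: "\<And>k. q k \<in> polyfuns I" and p: "\<And>k. p k \<in> polyfuns I"
    and qp: "\<And>x. r e x ^ Suc s * expansion j g' (e + s) x =
      expansion j q s x * expansion j r e x + (\<Sum>k<e. p k x * x j ^ k)"
    using Suc.IH[of g'] g' by blast
  define q' where "q' k = (if k = Suc s then (\<lambda>x. r e x ^ Suc s * t x) else q k)" for k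
  have "q' k \<in> polyfuns I" for k
    unfolding q'_def t_def using q Suc.prems
    by (auto simp del: power_Suc intro!: polyfuns.mult polyfuns_power r)
  moreover have "r e x ^ Suc (Suc s) * expansion j g (e + Suc s) x =
      expansion j q' (Suc s) x * expansion j r e x + (\<Sum>k<e. p k x * x j ^ k)" for x
  proof -
    have "expansion j q' (Suc s) x = expansion j q s x + r e x ^ Suc s * t x * x j ^ Suc s"
      by (simp add: expansion_def q'_def)
    moreover have "r e x ^ Suc (Suc s) * expansion j g (e + Suc s) x =
      r e x ^ Suc s * (expansion j g' (e + s) x + t x * x j ^ Suc s * expansion j r e x)"
      unfolding step[symmetric] by (simp add: mult_ac)
    ultimately show ?thesis using qp[of x] by (simp add: algebra_simps)
  qed
  moreover have "q' (Suc s) x = r e x ^ Suc s * g (e + Suc s) x" for x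
    by (simp add: q'_def t_def)
  ultimately show ?case using p
    by (intro exI[of _ q'] exI[of _ p]) blast
qed

text \<open>Coordinate \<open>j\<close> is algebraic over the coordinates in \<open>I\<close>, on
  \<open>X\<close>. The leading coefficient has to be nonzero somewhere on \<open>X\<close>; this
  also rules out \<open>d = 0\<close>, where the relation would say that this very coefficient
  vanishes.\<close>

definition algebraic_on :: "'v set \<Rightarrow> 'v \<Rightarrow> ('v \<Rightarrow> 'a::comm_semiring_1) set \<Rightarrow> bool" where
  "algebraic_on I j X \<longleftrightarrow> (\<exists>d c. (\<forall>k. c k \<in> polyfuns I) \<and> (\<exists>x\<in>X. c d x \<noteq> 0) \<and>
     (\<forall>x\<in>X. expansion j c d x = 0))"

lemma algebraic_on_mono: "algebraic_on I j X \<Longrightarrow> I \<subseteq> J \<Longrightarrow> algebraic_on J j X"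
  unfolding algebraic_on_def by (meson polyfuns_mono)

text \<open>Minimality of the degree is phrased as vanishing of every coefficient of a shorter
  relation, not just of the leading one. In this form relations can be carried from \<open>X\<close>
  to its closure coefficient by coefficient.\<close>

definition minimal_relation ::
    "'v set \<Rightarrow> 'v \<Rightarrow> ('v \<Rightarrow> 'a::comm_semiring_1) set \<Rightarrow> nat \<Rightarrow> (nat \<Rightarrow> ('v \<Rightarrow> 'a) \<Rightarrow> 'a) \<Rightarrow> bool"
  where "minimal_relation I j X d f \<longleftrightarrow>
    (\<forall>k. f k \<in> polyfuns I) \<and> (\<exists>x\<in>X. f d x \<noteq> 0) \<and> (\<forall>x\<in>X. expansion j f d x = 0) \<and>
    (\<forall>e c. (\<forall>k. c k \<in> polyfuns I) \<longrightarrow> (\<forall>x\<in>X. expansion j c e x = 0) \<longrightarrow> e < d \<longrightarrow>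
       (\<forall>k\<le>e. \<forall>x\<in>X. c k x = 0))"

lemma algebraic_on_minimal:
  assumes "algebraic_on I j X"
  shows "\<exists>d f. minimal_relation I j X d f"
proof -
  let ?P = "\<lambda>d. \<exists>c. (\<forall>k. c k \<in> polyfuns I) \<and> (\<exists>x\<in>X. c d x \<noteq> 0) \<and> (\<forall>x\<in>X. expansion j c d x = 0)"
  obtain d where d: "?P d" "\<And>e. e < d \<Longrightarrow> \<not> ?P e"
    using assms exists_least_iff[of ?P] unfolding algebraic_on_def by blast
  then obtain f where f: "\<And>k. f k \<in> polyfuns I" "\<exists>x\<in>X. f d x \<noteq> 0"
    "\<And>x. x \<in> X \<Longrightarrow> expansion j f d x = 0" by blast
  have "c k x = 0" if c: "\<And>k. c k \<in> polyfuns I" "\<And>x. x \<in> X \<Longrightarrow> expansion j c e x = 0"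
      "e < d" "k \<le> e" "x \<in> X" for c e k x
  proof (rule ccontr)
    assume "c k x \<noteq> 0"
    then obtain e' y where "e' \<le> e" "y \<in> X" "c e' y \<noteq> 0"
      "\<And>x. x \<in> X \<Longrightarrow> expansion j c e x = expansion j c e' x"
      using expansion_leading[of k e x X c j] c(4,5) by blast
    then have "?P e'" using c(1,2) by auto
    then show False using d(2)[of e'] \<open>e' \<le> e\<close> \<open>e < d\<close> by simp
  qed
  then show ?thesis
    using f unfolding minimal_relation_def by (intro exI[of _ d] exI[of _ f]) blast
qed

lemma sum_lessThan_expansion:
  "0 < d \<Longrightarrow> (\<Sum>k<d. c k x * x j ^ k) = expansion j c (d - 1) x"
  by (cases d) (auto simp: expansion_def lessThan_Suc_atMost)

text \<open>In a domain that is algebraic over a base ring, every nonzero element has a nonzero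
  multiple in the base ring. A multiple of \<open>b\<close> of least degree in \<open>x_j\<close> is
  shown to have degree 0 by comparing it with the minimal relation \<open>f\<close> through division
  in both directions.\<close>

lemma algebraic_on_multiple:
  fixes X :: "('v \<Rightarrow> 'a::field) set"
  assumes irr: "irreducible_on (insert j I) X" and alg: "algebraic_on I j X"
    and b: "b \<in> polyfuns (insert j I)" "x0 \<in> X" "b x0 \<noteq> 0"
  shows "\<exists>a\<in>polyfuns I. \<exists>h\<in>polyfuns (insert j I).
    (\<exists>y\<in>X. a y \<noteq> 0) \<and> (\<forall>x\<in>X. a x = h x * b x)"
proof -
  note sub = polyfuns_mono[OF _ subset_insertI]
  obtain d f where rel: "minimal_relation I j X d f"
    using algebraic_on_minimal[OF alg] by blast
  then have f: "\<And>k. f k \<in> polyfuns I" "\<exists>x\<in>X. f d x \<noteq> 0"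
    "\<And>x. x \<in> X \<Longrightarrow> expansion j f d x = 0"
    unfolding minimal_relation_def by simp_all
  from rel have min_d: "\<forall>e c. (\<forall>k. c k \<in> polyfuns I) \<longrightarrow> (\<forall>x\<in>X. expansion j c e x = 0) \<longrightarrow>
      e < d \<longrightarrow> (\<forall>k\<le>e. \<forall>x\<in>X. c k x = 0)"
    unfolding minimal_relation_def by (elim conjE)
  obtain w where w: "w \<in> X" "f d w \<noteq> 0" using f(2) by blast
  \<comment> \<open>The degrees in \<open>x_j\<close> of nonzero multiples of \<open>b\<close>,
    where everything is taken modulo functions that vanish on \<open>X\<close>.\<close>
  define P where "P e \<longleftrightarrow> (\<exists>r h. (\<forall>k. r k \<in> polyfuns I) \<and> h \<in> polyfuns (insert j I) \<and>
    (\<exists>x\<in>X. r e x \<noteq> 0) \<and> (\<forall>x\<in>X. expansion j r e x = h x * b x) \<and>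
    (\<exists>x\<in>X. expansion j r e x \<noteq> 0))" for e
  have truncate: "\<exists>e'\<le>e. P e'" if *: "\<And>k. r k \<in> polyfuns I" "h \<in> polyfuns (insert j I)"
      "\<And>x. x \<in> X \<Longrightarrow> expansion j r e x = h x * b x" "x \<in> X" "expansion j r e x \<noteq> 0" for e r h x
  proof -
    obtain e' y where "e' \<le> e" "y \<in> X" "r e' y \<noteq> 0"
      "\<And>x. x \<in> X \<Longrightarrow> expansion j r e x = expansion j r e' x"
      using expansion_leading'[OF *(4,5)] by blast
    then show ?thesis using *
      by (intro exI[of _ e'] conjI) (auto simp: P_def intro!: exI[of _ r] exI[of _ h])
  qed
  obtain c E where c: "\<And>k. c k \<in> polyfuns I" "\<And>x. b x = expansion j c E x"
    using polyfuns_expand[OF b(1)] by blast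
  have "\<exists>e\<le>E. P e"
    by (rule truncate[of c "\<lambda>_. 1" E x0]) (use c b in \<open>auto intro: polyfuns.const\<close>)
  then have "\<exists>e. P e" by blast
  define e where "e = (LEAST e. P e)"
  have e: "P e" unfolding e_def by (rule LeastI_ex) fact
  have min_e: "\<not> P e'" if "e' < e" for e'
    using that unfolding e_def by (rule not_less_Least)
  from e obtain r h where r: "\<And>k. r k \<in> polyfuns I" and h: "h \<in> polyfuns (insert j I)"
    and re: "\<exists>x\<in>X. r e x \<noteq> 0" and rh: "\<And>x. x \<in> X \<Longrightarrow> expansion j r e x = h x * b x"
    and r0: "\<exists>x\<in>X. expansion j r e x \<noteq> 0" unfolding P_def by blast
  obtain v where v: "v \<in> X" "r e v \<noteq> 0" using re by blast
  obtain u where u: "u \<in> X" "expansion j r e u \<noteq> 0" using r0 by blast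
  \<comment> \<open>Otherwise division by the relation \<open>f\<close>, which vanishes on
    \<open>X\<close>, leaves a remainder that is again a multiple of \<open>b\<close>, nonzero by
    irreducibility, and of degree below \<open>d \<le> e\<close>.\<close>
  have "e < d"
  proof (rule ccontr)
    assume "\<not> e < d"
    then have ed: "d + (e - d) = e" by simp
    obtain q p where qp: "\<And>k. q k \<in> polyfuns I" "\<And>k. p k \<in> polyfuns I"
      "\<And>x. f d x ^ Suc (e - d) * expansion j r e x =
         expansion j q (e - d) x * expansion j f d x + (\<Sum>k<d. p k x * x j ^ k)"
      using pseudo_division[of f I r d "e - d" j, OF f(1) r, unfolded ed] by (elim exE conjE) blast
    have eq: "(\<Sum>k<d. p k x * x j ^ k) = f d x ^ Suc (e - d) * expansion j r e x" if "x \<in> X" for x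
      using qp(3)[of x] f(3)[OF that] by simp
    have pw: "(\<lambda>x. f d x ^ Suc (e - d)) \<in> polyfuns (insert j I)"
      by (intro polyfuns_power sub f(1))
    have ex: "\<exists>x\<in>X. (\<Sum>k<d. p k x * x j ^ k) \<noteq> 0"
    proof (rule ccontr)
      assume *: "\<not> ?thesis"
      have "expansion j r e u = 0"
        by (rule irreducible_onD[OF irr pw expansion_in_polyfuns[of r, OF r] _ w(1) _ u(1)])
          (use * eq w in auto)
      then show False using u by simp
    qed
    then have "0 < d" by (cases d) auto
    from ex obtain x where x: "x \<in> X" "expansion j p (d - 1) x \<noteq> 0"
      using sum_lessThan_expansion[OF \<open>0 < d\<close>, of p] by metis
    have "\<exists>e'\<le>d - 1. P e'"
    proof (rule truncate[OF qp(2) _ _ x])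
      show "(\<lambda>x. f d x ^ Suc (e - d) * h x) \<in> polyfuns (insert j I)"
        by (intro polyfuns.mult pw h)
      show "expansion j p (d - 1) x = f d x ^ Suc (e - d) * h x * b x" if "x \<in> X" for x
        using eq[OF that] rh[OF that] sum_lessThan_expansion[OF \<open>0 < d\<close>, of p x j] by (simp add: mult_ac)
    qed
    then show False using min_e \<open>\<not> e < d\<close> \<open>0 < d\<close> by (meson diff_less le_less_trans less_one not_le order_less_le_trans)
  qed
  \<comment> \<open>Otherwise divide \<open>f\<close> by the multiple. The remainder is a multiple
    of \<open>b\<close> of degree below \<open>e\<close>, hence 0 on \<open>X\<close>, so by
    irreducibility the quotient is 0 on \<open>X\<close>. It is then a relation of degree
    \<open>d - e < d\<close>, although its leading coefficient \<open>r_e ^ (d - e) * f_d\<close> is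
    not identically 0 on \<open>X\<close>.\<close>
  have "e = 0"
  proof (rule ccontr)
    assume "e \<noteq> 0"
    then have "0 < e" by simp
    have ed: "e + (d - e) = d" using \<open>e < d\<close> by simp
    obtain q p where qp: "\<And>k. q k \<in> polyfuns I" "\<And>k. p k \<in> polyfuns I"
      "\<And>x. r e x ^ Suc (d - e) * expansion j f d x =
         expansion j q (d - e) x * expansion j r e x + (\<Sum>k<e. p k x * x j ^ k)"
      "\<And>x. q (d - e) x = r e x ^ (d - e) * f d x"
      using pseudo_division[of r I f e "d - e" j, OF r f(1), unfolded ed] by (elim exE conjE) blast
    note q_poly = expansion_in_polyfuns[of q I j "d - e", OF qp(1)]
    have eq: "expansion j p (e - 1) x = - (expansion j q (d - e) x * expansion j r e x)" if "x \<in> X" for x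
      using qp(3)[of x] f(3)[OF that] sum_lessThan_expansion[OF \<open>0 < e\<close>, of p x j]
      by (simp add: eq_neg_iff_add_eq_0 add.commute)
    have p0: "expansion j p (e - 1) x = 0" if "x \<in> X" for x
    proof (rule ccontr)
      assume "expansion j p (e - 1) x \<noteq> 0"
      have "\<exists>e'\<le>e - 1. P e'"
      proof (rule truncate[OF qp(2) _ _ \<open>x \<in> X\<close> \<open>expansion j p (e - 1) x \<noteq> 0\<close>])
        show "(\<lambda>x. (0 - expansion j q (d - e) x) * h x) \<in> polyfuns (insert j I)"
          by (intro polyfuns.mult polyfuns_diff polyfuns.const q_poly h)
        show "expansion j p (e - 1) x = (0 - expansion j q (d - e) x) * h x * b x" if "x \<in> X" for x
          using eq[OF that] rh[OF that] by (simp add: mult_ac)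
      qed
      then show False using min_e \<open>0 < e\<close>
        by (meson diff_less le_less_trans zero_less_one)
    qed
    have q0: "expansion j q (d - e) x = 0" if "x \<in> X" for x
      by (rule irreducible_onD[OF irr expansion_in_polyfuns[of r, OF r] q_poly _ u(1) _ that])
        (use p0 eq u in \<open>auto simp: mult.commute\<close>)
    have "q (d - e) x = 0" if "x \<in> X" for x
      using min_d[rule_format, of q "d - e" "d - e" x] qp(1) q0 \<open>0 < e\<close> \<open>e < d\<close> that by auto
    then have "f d w = 0"
      using irreducible_onD[OF irr polyfuns_power[OF sub[OF r], of e "d - e"] sub[OF f(1)] _ v(1) _ w(1)]
        qp(4) v(2) by simp
    then show False using w by simp
  qed
  then have "(\<exists>y\<in>X. r 0 y \<noteq> 0) \<and> (\<forall>x\<in>X. r 0 x = h x * b x)"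
    using re rh by auto
  then show ?thesis using r[of 0] h by blast
qed

section \<open>Lifting points of the closure to further coordinates\<close>

lemma nonroot_exists:
  fixes c :: "nat \<Rightarrow> 'a::alg_closed_field"
  assumes "k \<le> d" "c k \<noteq> 0"
  shows "\<exists>u. (\<Sum>i\<le>d. c i * u ^ i) \<noteq> 0"
proof -
  define p where "p = (\<Sum>i\<le>d. monom (c i) i)"
  have "coeff p k = c k"
    using assms(1) by (simp add: p_def coeff_sum)
  then have "finite {u. poly p u = 0}"
    using assms(2) by (intro poly_roots_finite) auto
  then obtain u where "poly p u \<noteq> 0"
    using ex_new_if_finite[OF infinite_UNIV_alg_closed] by blast
  then show ?thesis by (auto simp: p_def poly_sum poly_monom)
qed

lemma expansion_fun_upd:
  assumes "\<And>k. c k \<in> polyfuns I" "j \<notin> I"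
  shows "expansion j c d (z(j := u)) = (\<Sum>k\<le>d. c k z * u ^ k)"
proof -
  have "c k (z(j := u)) = c k z" for k
    by (rule polyfuns_cong[OF assms(1)]) (use assms(2) in auto)
  then show ?thesis by (simp add: expansion_def)
qed

text \<open>The extension step of elimination theory, with a nonvanishing condition \<open>b\<close>
  to be preserved. If \<open>x_j\<close> is algebraic over \<open>I\<close> on \<open>X\<close>, the
  new coordinate is a root of the minimal relation at \<open>z\<close>; if it is transcendental, any
  value that keeps \<open>b\<close> nonzero will do.\<close>

lemma eliminate_variable:
  fixes X :: "('v \<Rightarrow> 'a::alg_closed_field) set"
  assumes "j \<notin> I" and irr: "irreducible_on (insert j I) X"
    and b: "b \<in> polyfuns (insert j I)" "x0 \<in> X" "b x0 \<noteq> 0"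
  shows "\<exists>a\<in>polyfuns I. (\<exists>y\<in>X. a y \<noteq> 0) \<and> (\<forall>z\<in>zariski_closure I X. a z \<noteq> 0 \<longrightarrow>
       (\<exists>u. z(j := u) \<in> zariski_closure (insert j I) X \<and> b (z(j := u)) \<noteq> 0))"
proof (cases "algebraic_on I j X")
  case True
  note sub = polyfuns_mono[OF _ subset_insertI]
  obtain d f where rel: "minimal_relation I j X d f"
    using algebraic_on_minimal[OF True] by blast
  then have f: "\<And>k. f k \<in> polyfuns I" "\<exists>x\<in>X. f d x \<noteq> 0"
    "\<And>x. x \<in> X \<Longrightarrow> expansion j f d x = 0"
    unfolding minimal_relation_def by simp_all
  from rel have min_d: "\<forall>e c. (\<forall>k. c k \<in> polyfuns I) \<longrightarrow> (\<forall>x\<in>X. expansion j c e x = 0) \<longrightarrow>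
      e < d \<longrightarrow> (\<forall>k\<le>e. \<forall>x\<in>X. c k x = 0)"
    unfolding minimal_relation_def by (elim conjE)
  obtain a where a: "a \<in> polyfuns I" and "\<exists>h\<in>polyfuns (insert j I).
      (\<exists>y\<in>X. a y \<noteq> 0) \<and> (\<forall>x\<in>X. a x = h x * b x)"
    using algebraic_on_multiple[of j I X b x0] irr True b by blast
  then obtain h where h: "h \<in> polyfuns (insert j I)"
    and ah: "(\<exists>y\<in>X. a y \<noteq> 0) \<and> (\<forall>x\<in>X. a x = h x * b x)"
    by blast
  then obtain v where v: "v \<in> X" "a v \<noteq> 0" by blast
  obtain w where w: "w \<in> X" "f d w \<noteq> 0" using f(2) by blast
  have "0 < d" using f(3)[OF w(1)] w(2) by (cases d) auto
  have "\<exists>y\<in>X. f d y * a y \<noteq> 0"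
    using irreducible_onD[OF irr sub[OF f(1)] sub[OF a] _ w v(1)] v(2) by blast
  then obtain y where y: "y \<in> X" "f d y * a y \<noteq> 0" by blast
  show ?thesis
  \<comment> \<open>The factor \<open>f d\<close> keeps the degree of the relation at
    \<open>z\<close> positive, so that a root exists; the factor \<open>a\<close>, a multiple of
    \<open>b\<close> on \<open>X\<close>, keeps \<open>b\<close> nonzero at the lifted
    point.\<close>
  proof (rule bexI[of _ "\<lambda>x. f d x * a x"], safe)
    show "(\<lambda>x. f d x * a x) \<in> polyfuns I" by (intro polyfuns.mult f(1) a)
    show "\<exists>y\<in>X. f d y * a y \<noteq> 0" using y by blast
    fix z assume z: "z \<in> zariski_closure I X" and "f d z * a z \<noteq> 0"
    then have nz: "f d z \<noteq> 0" "a z \<noteq> 0" by auto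
    obtain u where u: "(\<Sum>k\<le>d. f k z * u ^ k) = 0"
      using alg_closed[of d "\<lambda>k. f k z"] \<open>0 < d\<close> nz by blast
    let ?z = "z(j := u)"
    have up: "g ?z = g z" if "g \<in> polyfuns I" for g
      by (rule polyfuns_cong[OF that]) (use \<open>j \<notin> I\<close> in auto)
    have fz: "expansion j f d ?z = 0"
      using u expansion_fun_upd[of f I j d z u] f(1) \<open>j \<notin> I\<close> by simp
    \<comment> \<open>After division of \<open>g\<close> by the relation, the remainder vanishes on
      \<open>X\<close> and has degree below \<open>d\<close>. Its coefficients therefore vanish on
      \<open>X\<close>, hence at \<open>z\<close>, and the choice of \<open>u\<close> kills the
      other term.\<close>
    have cl: "g ?z = 0" if g: "g \<in> polyfuns (insert j I)" "\<And>x. x \<in> X \<Longrightarrow> g x = 0" for g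
    proof -
      obtain c E where c: "\<And>k. c k \<in> polyfuns I" "\<And>x. g x = expansion j c E x"
        using polyfuns_expand[OF g(1)] by blast
      define c' where "c' = (\<lambda>k. if k \<le> E then c k else (\<lambda>_. 0))"
      have c': "c' k \<in> polyfuns I" for k
        using c(1) by (auto simp: c'_def intro: polyfuns.const)
      have gc: "g x = expansion j c' (d + E) x" for x
        using c(2) expansion_extend[of E "d + E" j c x] by (simp add: c'_def)
      obtain q p where qp: "\<And>k. q k \<in> polyfuns I" "\<And>k. p k \<in> polyfuns I"
        "\<And>x. f d x ^ Suc E * expansion j c' (d + E) x =
           expansion j q E x * expansion j f d x + (\<Sum>k<d. p k x * x j ^ k)"
        using pseudo_division[of f I c' d E j, OF f(1) c'] by (elim exE conjE) blast
      have p0: "expansion j p (d - 1) x = 0" if "x \<in> X" for x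
        using qp(3)[of x] f(3) g(2) that sum_lessThan_expansion[OF \<open>0 < d\<close>, of p x j]
        by (simp add: gc[symmetric])
      have "p k x = 0" if "k < d" "x \<in> X" for k x
        using min_d[rule_format, of p "d - 1" k x] qp(2) p0 that \<open>0 < d\<close> by auto
      then have "p k z = 0" if "k < d" for k
        using z qp(2)[of k] that unfolding zariski_closure_def by blast
      then have "(\<Sum>k<d. p k ?z * ?z j ^ k) = 0"
        by (simp add: up[OF qp(2)])
      then have "f d ?z ^ Suc E * g ?z = 0"
        using qp(3)[of ?z] fz by (simp add: gc)
      then show ?thesis using nz up[OF f(1)] by simp
    qed
    have "a ?z - h ?z * b ?z = 0"
    proof (rule cl)
      show "(\<lambda>x. a x - h x * b x) \<in> polyfuns (insert j I)"
        by (intro polyfuns_diff polyfuns.mult sub a h b(1))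
    qed (use ah in auto)
    then have "b ?z \<noteq> 0" using up[OF a] nz by auto
    then show "\<exists>u. z(j := u) \<in> zariski_closure (insert j I) X \<and> b (z(j := u)) \<noteq> 0"
      using cl by (auto simp: zariski_closure_def intro!: exI[of _ u])
  qed
next
  case False
  \<comment> \<open>For transcendental \<open>x_j\<close> a function that vanishes on
    \<open>X\<close> has all its coefficients vanishing on \<open>X\<close>, so the closure puts no
    condition on the new coordinate.\<close>
  have coeffs: "c k x = 0" if c: "\<And>k. c k \<in> polyfuns I"
    "\<And>x. x \<in> X \<Longrightarrow> expansion j c d x = 0" "k \<le> d" "x \<in> X" for c d k x
  proof (rule ccontr)
    assume "c k x \<noteq> 0"
    then obtain e y where "y \<in> X" "c e y \<noteq> 0"
      "\<And>x. x \<in> X \<Longrightarrow> expansion j c d x = expansion j c e x"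
      using expansion_leading[of k d x X c j] c(3,4) by blast
    then have "algebraic_on I j X"
      unfolding algebraic_on_def using c(1,2) by (intro exI[of _ e] exI[of _ c]) auto
    then show False using False by blast
  qed
  obtain c d where c: "\<And>k. c k \<in> polyfuns I" "\<And>x. b x = expansion j c d x"
    using polyfuns_expand[OF b(1)] by blast
  have "\<exists>k\<le>d. c k x0 \<noteq> 0"
    by (rule ccontr) (use b(3) in \<open>auto simp: c(2) expansion_def\<close>)
  then obtain k where k: "k \<le> d" "c k x0 \<noteq> 0" by blast
  show ?thesis
  proof (rule bexI[OF _ c(1)[of k]], safe)
    show "\<exists>y\<in>X. c k y \<noteq> 0" using b(2) k(2) by blast
    fix z assume z: "z \<in> zariski_closure I X" and "c k z \<noteq> 0"
    then obtain u where u: "(\<Sum>i\<le>d. c i z * u ^ i) \<noteq> 0"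
      using nonroot_exists[of k d "\<lambda>i. c i z"] k(1) by blast
    have "g (z(j := u)) = 0" if g: "g \<in> polyfuns (insert j I)" "\<And>x. x \<in> X \<Longrightarrow> g x = 0" for g
    proof -
      obtain c' E where c': "\<And>k. c' k \<in> polyfuns I" "\<And>x. g x = expansion j c' E x"
        using polyfuns_expand[OF g(1)] by blast
      have "c' i x = 0" if "i \<le> E" "x \<in> X" for i x
        by (rule coeffs[of c' E, OF c'(1) _ that]) (use c'(2) g(2) in auto)
      then have "c' i z = 0" if "i \<le> E" for i
        using z c'(1)[of i] that unfolding zariski_closure_def by blast
      then show ?thesis
        using expansion_fun_upd[of c' I j E z u] c' \<open>j \<notin> I\<close> by simp
    qed
    moreover have "b (z(j := u)) \<noteq> 0"
      using expansion_fun_upd[of c I j d z u] c \<open>j \<notin> I\<close> u by simp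
    ultimately show "\<exists>u. z(j := u) \<in> zariski_closure (insert j I) X \<and> b (z(j := u)) \<noteq> 0"
      by (auto simp: zariski_closure_def intro!: exI[of _ u])
  qed
qed


section \<open>Images of polynomial maps\<close>

text \<open>Coordinates of \<open>C\<close> are removed one at a time. The nonvanishing condition
  \<open>a1\<close> found in one elimination serves as the \<open>b\<close> of the remaining ones,
  which is the reason for carrying \<open>b\<close> along.\<close>

lemma eliminate_variables:
  fixes X :: "('v \<Rightarrow> 'a::alg_closed_field) set"
  assumes "finite C" "C \<inter> I = {}" "irreducible_on (I \<union> C) X"
    and "b \<in> polyfuns (I \<union> C)" "\<exists>x\<in>X. b x \<noteq> 0"
  shows "\<exists>a\<in>polyfuns I. (\<exists>y\<in>X. a y \<noteq> 0) \<and> (\<forall>z\<in>zariski_closure I X. a z \<noteq> 0 \<longrightarrow>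
    (\<exists>z'\<in>zariski_closure (I \<union> C) X. (\<forall>i. i \<notin> C \<longrightarrow> z' i = z i) \<and> b z' \<noteq> 0))"
  using assms
proof (induction C arbitrary: b)
  case empty
  then show ?case by (intro bexI[of _ b]) auto
next
  case (insert j C)
  have eq: "I \<union> insert j C = insert j (I \<union> C)" and j: "j \<notin> I \<union> C" using insert by auto
  from insert.prems(4) obtain x0 where x0: "x0 \<in> X" "b x0 \<noteq> 0" by blast
  obtain a1 where a1: "a1 \<in> polyfuns (I \<union> C)" "\<exists>y\<in>X. a1 y \<noteq> 0"
    "\<forall>z\<in>zariski_closure (I \<union> C) X. a1 z \<noteq> 0 \<longrightarrow>
       (\<exists>u. z(j := u) \<in> zariski_closure (insert j (I \<union> C)) X \<and> b (z(j := u)) \<noteq> 0)"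
    using eliminate_variable[of j "I \<union> C" X b x0] j insert.prems x0 unfolding eq by blast
  have "irreducible_on (I \<union> C) X"
    using irreducible_on_mono[OF insert.prems(2)] by blast
  then obtain a where a: "a \<in> polyfuns I" "\<exists>y\<in>X. a y \<noteq> 0"
    "\<forall>z\<in>zariski_closure I X. a z \<noteq> 0 \<longrightarrow>
      (\<exists>z'\<in>zariski_closure (I \<union> C) X. (\<forall>i. i \<notin> C \<longrightarrow> z' i = z i) \<and> a1 z' \<noteq> 0)"
    using insert.IH[of a1] insert.prems(1) a1(1,2) by blast
  show ?case
  proof (intro bexI[OF _ a(1)] conjI ballI impI a(2))
    fix z assume "z \<in> zariski_closure I X" "a z \<noteq> 0"
    then obtain z' where z': "z' \<in> zariski_closure (I \<union> C) X" "\<And>i. i \<notin> C \<Longrightarrow> z' i = z i" "a1 z' \<noteq> 0"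
      using a(3) by blast
    then obtain u where "z'(j := u) \<in> zariski_closure (insert j (I \<union> C)) X" "b (z'(j := u)) \<noteq> 0"
      using a1(3) by blast
    then show "\<exists>z'\<in>zariski_closure (I \<union> insert j C) X.
        (\<forall>i. i \<notin> insert j C \<longrightarrow> z' i = z i) \<and> b z' \<noteq> 0"
      unfolding eq using z'(2) by (intro bexI[of _ "z'(j := u)"]) auto
  qed
qed

text \<open>Composition with \<open>F\<close> pulls \<open>f\<close> and \<open>g\<close> back to
  polynomial functions of the parameters, which have no zero divisors.\<close>

lemma irreducible_on_range:
  fixes F :: "('w \<Rightarrow> 'a::alg_closed_field) \<Rightarrow> ('v \<Rightarrow> 'a)"
  assumes F: "\<And>j. j \<in> J \<Longrightarrow> (\<lambda>t. F t j) \<in> polyfuns T"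
  shows "irreducible_on J (range F)"
  unfolding irreducible_on_def
proof (intro ballI impI)
  fix f g assume f: "f \<in> polyfuns J" and g: "g \<in> polyfuns J"
    and fg: "\<forall>x\<in>range F. f x * g x = 0"
  have f': "(\<lambda>t. f (F t)) \<in> polyfuns T" and g': "(\<lambda>t. g (F t)) \<in> polyfuns T"
    by (intro polyfuns_comp[OF f] polyfuns_comp[OF g] F; assumption)+
  show "(\<forall>x\<in>range F. f x = 0) \<or> (\<forall>x\<in>range F. g x = 0)"
  proof (rule ccontr)
    assume "\<not> ?thesis"
    then obtain p q where "f (F p) \<noteq> 0" "g (F q) \<noteq> 0" by blast
    then have "\<exists>t. f (F t) \<noteq> 0 \<and> g (F t) \<noteq> 0"
      using polyfuns_no_zero_divisors[OF f' g', of p q] by blast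
    then show False using fg by auto
  qed
qed

text \<open>
  Eliminating the parameters from the graph of \<open>F\<close> shows that the image of \<open>F\<close> contains a nonempty
  open subset of its closure.
\<close>

lemma image_contains_open:
  fixes F :: "('w \<Rightarrow> 'a::alg_closed_field) \<Rightarrow> ('v \<Rightarrow> 'a)"
  assumes F: "\<And>j. j \<in> J \<Longrightarrow> (\<lambda>t. F t j) \<in> polyfuns T" and "finite T"
  shows "\<exists>a\<in>polyfuns J. (\<exists>y\<in>range F. a y \<noteq> 0) \<and>
    (\<forall>z\<in>zariski_closure J (range F). a z \<noteq> 0 \<longrightarrow> (\<exists>t. \<forall>j\<in>J. z j = F t j))"
proof -
  \<comment> \<open>The graph of \<open>F\<close>: parameters sit in the left summand, values in the
    right one.\<close>
  define X where "X = range (\<lambda>t. case_sum t (F t))"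
  let ?I = "Inr ` J" and ?C = "Inl ` T"
  have Fj: "(\<lambda>y. F (y \<circ> Inl) j) \<in> polyfuns (?I \<union> ?C)" if "j \<in> J" for j
    by (rule polyfuns_comp[OF F[OF that], where g = "\<lambda>y. y \<circ> Inl"]) (simp add: polyfuns.var)
  have irr: "irreducible_on (?I \<union> ?C) X"
    unfolding X_def by (rule irreducible_on_range[where T = T]) (auto intro: F polyfuns.var)
  have "\<exists>a\<in>polyfuns ?I. (\<exists>y\<in>X. a y \<noteq> 0) \<and> (\<forall>z\<in>zariski_closure ?I X. a z \<noteq> 0 \<longrightarrow>
    (\<exists>z'\<in>zariski_closure (?I \<union> ?C) X. (\<forall>i. i \<notin> ?C \<longrightarrow> z' i = z i) \<and> (1::'a) \<noteq> 0))"
    by (rule eliminate_variables[OF _ _ irr]) (use \<open>finite T\<close> in \<open>auto simp: X_def intro: polyfuns.const\<close>)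
  then obtain a where a: "a \<in> polyfuns ?I" "\<exists>y\<in>X. a y \<noteq> 0" "\<forall>z\<in>zariski_closure ?I X. a z \<noteq> 0 \<longrightarrow>
    (\<exists>z'\<in>zariski_closure (?I \<union> ?C) X. (\<forall>i. i \<notin> ?C \<longrightarrow> z' i = z i))"
    by auto
  \<comment> \<open>The parameter coordinates are filled with \<open>undefined\<close>; polynomials
    over \<open>?I\<close> do not read them.\<close>
  let ?E = "\<lambda>z. case_sum undefined z"
  have pE: "(\<lambda>z. p (?E z)) \<in> polyfuns J" if "p \<in> polyfuns ?I" for p :: "('w + 'v \<Rightarrow> 'a) \<Rightarrow> 'a"
    by (rule polyfuns_comp[OF that, where g = ?E]) (auto intro: polyfuns.var)
  have pE_eq: "p (?E (F t)) = p (case_sum t (F t))" if "p \<in> polyfuns ?I"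
    for p :: "('w + 'v \<Rightarrow> 'a) \<Rightarrow> 'a" and t
    by (rule polyfuns_cong[OF that]) auto
  show ?thesis
  proof (intro bexI[OF _ pE[OF a(1)]] conjI ballI impI)
    show "\<exists>y\<in>range F. a (?E y) \<noteq> 0"
      using a(2) pE_eq[OF a(1)] by (auto simp: X_def)
    fix z assume z: "z \<in> zariski_closure J (range F)" and az: "a (?E z) \<noteq> 0"
    have "?E z \<in> zariski_closure ?I X"
      unfolding zariski_closure_def
    proof (intro CollectI ballI impI)
      fix p assume p: "p \<in> polyfuns ?I" "\<forall>x\<in>X. p x = 0"
      then have "\<forall>x\<in>range F. p (?E x) = 0"
        using pE_eq[OF p(1)] by (auto simp: X_def)
      then show "p (?E z) = 0"
        using zariski_closureD[OF z pE[OF p(1)]] by blast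
    qed
    then obtain z' where z': "z' \<in> zariski_closure (?I \<union> ?C) X" "\<And>i. i \<notin> ?C \<Longrightarrow> z' i = ?E z i"
      using a(3) az by blast
    have "z j = F (z' \<circ> Inl) j" if "j \<in> J" for j
    proof -
      \<comment> \<open>The equations of the graph are polynomial, so they hold at every point of
        its closure, and the lift \<open>z'\<close> exhibits parameters for
        \<open>z\<close>.\<close>
      have "(\<lambda>y. y (Inr j) - F (y \<circ> Inl) j) \<in> polyfuns (?I \<union> ?C)"
        using that by (intro polyfuns_diff Fj polyfuns.var) auto
      then have "z' (Inr j) - F (z' \<circ> Inl) j = 0"
        by (rule zariski_closureD[OF z'(1)]) (auto simp: X_def comp_def)
      moreover have "z' (Inr j) = z j" using z'(2)[of "Inr j"] by (simp add: image_iff)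
      ultimately show ?thesis by simp
    qed
    then show "\<exists>t. \<forall>j\<in>J. z j = F t j" by blast
  qed
qed

text \<open>Iterates the case of one coordinate along \<open>C\<close>: the multiple of
  \<open>p\<close> is pushed into fewer and fewer coordinates, and the multipliers are multiplied
  together.\<close>

lemma algebraic_on_multiple_set:
  fixes Y :: "('v \<Rightarrow> 'a::field) set"
  assumes "finite C" "irreducible_on (B \<union> C) Y" "\<And>j. j \<in> C \<Longrightarrow> algebraic_on B j Y"
    and "p \<in> polyfuns (B \<union> C)" "\<exists>y\<in>Y. p y \<noteq> 0"
  shows "\<exists>a\<in>polyfuns B. \<exists>h\<in>polyfuns (B \<union> C). (\<exists>y\<in>Y. a y \<noteq> 0) \<and> (\<forall>x\<in>Y. a x = h x * p x)"
  using assms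
proof (induction C arbitrary: p)
  case empty
  then show ?case by (intro bexI[of _ p] bexI[of _ "\<lambda>_. 1"]) (auto intro: polyfuns.const)
next
  case (insert j C)
  have eq: "B \<union> insert j C = insert j (B \<union> C)" by auto
  have sub: "f \<in> polyfuns (insert j (B \<union> C))" if "f \<in> polyfuns (B \<union> C)" for f :: "('v \<Rightarrow> 'a) \<Rightarrow> 'a"
    by (rule polyfuns_mono[OF that]) auto
  have alg: "algebraic_on (B \<union> C) j Y"
    by (rule algebraic_on_mono[of B]) (use insert.prems in auto)
  obtain x0 where x0: "x0 \<in> Y" "p x0 \<noteq> 0" using insert.prems by blast
  obtain a h where a: "a \<in> polyfuns (B \<union> C)" "h \<in> polyfuns (insert j (B \<union> C))"
    "\<exists>y\<in>Y. a y \<noteq> 0" "\<forall>x\<in>Y. a x = h x * p x"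
    using algebraic_on_multiple[of j "B \<union> C" Y p x0] alg insert.prems x0 unfolding eq by blast
  have "irreducible_on (B \<union> C) Y"
    using irreducible_on_mono[OF insert.prems(1)] by blast
  then obtain a' h' where a': "a' \<in> polyfuns B" "h' \<in> polyfuns (B \<union> C)"
    "\<exists>y\<in>Y. a' y \<noteq> 0" "\<forall>x\<in>Y. a' x = h' x * a x"
    using insert.IH[of a] insert.prems(2) a(1,3) by blast
  have "(\<lambda>x. h' x * h x) \<in> polyfuns (insert j (B \<union> C))"
    by (intro polyfuns.mult sub a a')
  moreover have "\<forall>x\<in>Y. a' x = (h' x * h x) * p x"
    using a(4) a'(4) by (simp add: mult.assoc)
  ultimately have "\<exists>h\<in>polyfuns (insert j (B \<union> C)). (\<exists>y\<in>Y. a' y \<noteq> 0) \<and> (\<forall>x\<in>Y. a' x = h x * p x)"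
    using a'(3) by (intro bexI[of _ "\<lambda>x. h' x * h x"]) auto
  then show ?case unfolding eq using a'(1) by (rule bexI)
qed

text \<open>Algebraic independence of the coordinates in \<open>B\<close> on \<open>X\<close>.
  Vanishing at all points stands for being the zero polynomial, which is the same over an infinite
  field.\<close>

definition independent_on :: "'v set \<Rightarrow> ('v \<Rightarrow> 'a::comm_semiring_1) set \<Rightarrow> bool" where
  "independent_on B X \<longleftrightarrow> (\<forall>p\<in>polyfuns B. (\<forall>x\<in>X. p x = 0) \<longrightarrow> (\<forall>x. p x = 0))"

lemma independent_on_mono: "independent_on B X \<Longrightarrow> X \<subseteq> Y \<Longrightarrow> independent_on B Y"
  unfolding independent_on_def by blast

text \<open>Expand a nontrivial relation in powers of \<open>x_j\<close>. One of its coefficients is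
  not the zero function, so by independence of \<open>B\<close> it is nonzero somewhere on
  \<open>Y\<close>, and this provides a leading coefficient.\<close>

lemma dependent_imp_algebraic_on:
  assumes "independent_on B Y" "\<not> independent_on (insert j B) Y"
  shows "algebraic_on B j Y"
proof -
  obtain p x where p: "p \<in> polyfuns (insert j B)" "\<forall>y\<in>Y. p y = 0" "p x \<noteq> 0"
    using assms(2) unfolding independent_on_def by blast
  obtain c d where c: "\<And>k. c k \<in> polyfuns B" "\<And>x. p x = expansion j c d x"
    using polyfuns_expand[OF p(1)] by blast
  have "\<exists>k\<le>d. c k x \<noteq> 0"
    by (rule ccontr) (use p(3) in \<open>auto simp: c(2) expansion_def\<close>)
  then obtain k where k: "k \<le> d" "c k x \<noteq> 0" by blast
  then obtain y where y: "y \<in> Y" "c k y \<noteq> 0"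
    using assms(1) c(1)[of k] unfolding independent_on_def by blast
  obtain e where "\<exists>y\<in>Y. c e y \<noteq> 0" "\<forall>x\<in>Y. expansion j c d x = expansion j c e x"
    using expansion_leading[of k d y Y c j] k(1) y by blast
  then show ?thesis
    unfolding algebraic_on_def using c p(2) by (intro exI[of _ e] exI[of _ c]) auto
qed

text \<open>Enlarging \<open>X\<close> to an irreducible \<open>Y\<close> of the same transcendence
  degree does not enlarge the closure. If \<open>p\<close> vanished on \<open>X\<close> but not on
  \<open>Y\<close>, some multiple of \<open>p\<close> on \<open>Y\<close> would be a nonzero
  polynomial in the independent coordinates \<open>B\<close> that vanishes on
  \<open>X\<close>.\<close>

lemma vanishing_of_maximal_independent:
  fixes Y :: "('v \<Rightarrow> 'a::field) set"
  assumes "finite J" "B \<subseteq> J" "X \<subseteq> Y" "irreducible_on J Y" "independent_on B X"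
    and max: "\<And>j. j \<in> J - B \<Longrightarrow> \<not> independent_on (insert j B) Y"
    and p: "p \<in> polyfuns J" "\<forall>x\<in>X. p x = 0" "y \<in> Y"
  shows "p y = 0"
proof (rule ccontr)
  assume "p y \<noteq> 0"
  have J: "B \<union> (J - B) = J" using assms by auto
  have "independent_on B Y" using assms independent_on_mono by blast
  then have alg: "algebraic_on B j Y" if "j \<in> J - B" for j
    by (rule dependent_imp_algebraic_on[OF _ max[OF that]])
  have "\<exists>a\<in>polyfuns B. \<exists>h\<in>polyfuns (B \<union> (J - B)).
      (\<exists>y\<in>Y. a y \<noteq> 0) \<and> (\<forall>x\<in>Y. a x = h x * p x)"
    by (rule algebraic_on_multiple_set[OF _ _ alg])
      (use assms(1,4) p \<open>p y \<noteq> 0\<close> in \<open>auto simp: J simp del: Un_Diff_cancel\<close>)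
  then obtain a h where a: "a \<in> polyfuns B" "\<exists>y\<in>Y. a y \<noteq> 0" "\<forall>x\<in>Y. a x = h x * p x"
    by blast
  then have "\<forall>x\<in>X. a x = 0" using p(2) \<open>X \<subseteq> Y\<close> by auto
  then show False
    using \<open>independent_on B X\<close> a(1,2) unfolding independent_on_def by blast
qed

definition polynomial_image :: "'v set \<Rightarrow> ('v \<Rightarrow> 'a::comm_semiring_1) set \<Rightarrow> bool" where
  "polynomial_image J X \<longleftrightarrow> (\<exists>(T :: nat set) F.
     finite T \<and> (\<forall>j\<in>J. (\<lambda>t. F t j) \<in> polyfuns T) \<and> X = range F)"

text \<open>
  The closures of the members of the family are irreducible, and those whose transcendence degree is
  largest contain all the others.
\<close>

lemma directed_union_contains_open:
  fixes \<F> :: "('v \<Rightarrow> 'a::alg_closed_field) set set"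
  assumes "finite J" "\<F> \<noteq> {}" and img: "\<And>X. X \<in> \<F> \<Longrightarrow> polynomial_image J X"
    and dir: "\<And>X Y. X \<in> \<F> \<Longrightarrow> Y \<in> \<F> \<Longrightarrow> \<exists>Z\<in>\<F>. X \<subseteq> Z \<and> Y \<subseteq> Z"
  shows "\<exists>X\<in>\<F>. \<exists>b\<in>polyfuns J. (\<exists>y\<in>X. b y \<noteq> 0) \<and>
    (\<forall>z\<in>zariski_closure J (\<Union>\<F>). b z \<noteq> 0 \<longrightarrow> (\<exists>x\<in>X. \<forall>j\<in>J. z j = x j))"
proof -
  \<comment> \<open>The sizes of independent sets of coordinates on members of the family. They are
    bounded by \<open>card J\<close>, and the largest one plays the part of the dimension.\<close>
  define Q where "Q k \<longleftrightarrow> (\<exists>X\<in>\<F>. \<exists>B\<subseteq>J. independent_on B X \<and> card B = k)" for k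
  obtain X0 where X0: "X0 \<in> \<F>" using assms by blast
  have irr: "irreducible_on J X" and ne: "X \<noteq> {}" if X: "X \<in> \<F>" for X
  proof -
    obtain T :: "nat set" and F where "\<And>j. j \<in> J \<Longrightarrow> (\<lambda>t. F t j) \<in> polyfuns T" "X = range F"
      using img[OF X] unfolding polynomial_image_def by blast
    then show "irreducible_on J X" "X \<noteq> {}" using irreducible_on_range by auto
  qed
  have "independent_on {} X0"
    unfolding independent_on_def
  proof (intro ballI impI allI)
    fix p x assume p: "p \<in> polyfuns {}" "\<forall>x\<in>X0. p x = 0"
    obtain y where "y \<in> X0" using ne[OF X0] by blast
    then show "p x = 0" using p polyfuns_cong[OF p(1), of x y] by simp
  qed
  then have "Q 0" unfolding Q_def using X0 by (metis card.empty empty_subsetI)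
  moreover have bd: "k \<le> card J" if "Q k" for k
    using that \<open>finite J\<close> unfolding Q_def by (auto intro: card_mono)
  ultimately have Qm: "Q (Greatest Q)" and le: "k \<le> Greatest Q" if "Q k" for k
    using GreatestI_nat[of Q 0 "card J"] Greatest_le_nat[of Q _ "card J"] that by blast+
  then obtain X B where X: "X \<in> \<F>" and B: "B \<subseteq> J" "independent_on B X" "card B = Greatest Q"
    using \<open>Q 0\<close> unfolding Q_def by blast
  have vanish: "p y = 0" if p: "p \<in> polyfuns J" "\<forall>x\<in>X. p x = 0" and y: "y \<in> \<Union>\<F>" for p y
  proof -
    obtain Y where Y: "Y \<in> \<F>" "y \<in> Y" using y by blast
    obtain Z where Z: "Z \<in> \<F>" "X \<subseteq> Z" "Y \<subseteq> Z" using dir[OF X Y(1)] by blast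
    \<comment> \<open>\<open>Z\<close> is itself a member of the family, so a larger independent set
      on it would contradict the choice of \<open>B\<close>.\<close>
    have "\<not> independent_on (insert j B) Z" if "j \<in> J - B" for j
    proof
      assume "independent_on (insert j B) Z"
      then have "Q (card (insert j B))" using Z(1) B(1) that unfolding Q_def by blast
      then have "card (insert j B) \<le> card B" using le B(3) by simp
      then show False using that finite_subset[OF B(1) \<open>finite J\<close>] by simp
    qed
    then show ?thesis
      using vanishing_of_maximal_independent[OF \<open>finite J\<close> B(1) Z(2) irr[OF Z(1)] B(2) _ p]
        Y(2) Z(3) by blast
  qed
  obtain T :: "nat set" and F where F: "\<And>j. j \<in> J \<Longrightarrow> (\<lambda>t. F t j) \<in> polyfuns T" "finite T" "X = range F"
    using img[OF X] unfolding polynomial_image_def by blast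
  obtain b where b: "b \<in> polyfuns J" "\<exists>y\<in>X. b y \<noteq> 0"
    "\<forall>z\<in>zariski_closure J X. b z \<noteq> 0 \<longrightarrow> (\<exists>t. \<forall>j\<in>J. z j = F t j)"
    using image_contains_open[of J F T] F by blast
  have "zariski_closure J (\<Union>\<F>) \<subseteq> zariski_closure J X"
    using vanish unfolding zariski_closure_def by blast
  then show ?thesis using X b F(3) by (intro bexI[OF _ X] bexI[OF _ b(1)]) blast
qed


section \<open>Locally nilpotent difference operators\<close>

text \<open>Pullback minus the identity, the operator whose local nilpotency expresses unipotence.
  It acts on total functions; \<open>difference_cong\<close> recovers that only values on an
  invariant set \<open>S\<close> count.\<close>

definition difference :: "('x \<Rightarrow> 'x) \<Rightarrow> ('x \<Rightarrow> 'a::comm_ring_1) \<Rightarrow> 'x \<Rightarrow> 'a" where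
  "difference \<gamma> f = (\<lambda>x. f (\<gamma> x) - f x)"

lemma difference_cong:
  assumes "\<gamma> \<in> S \<rightarrow> S" "\<And>x. x \<in> S \<Longrightarrow> f x = g x" "x \<in> S"
  shows "(difference \<gamma> ^^ k) f x = (difference \<gamma> ^^ k) g x"
  using assms(3)
proof (induction k arbitrary: x)
  case (Suc k)
  then show ?case
    using Suc.IH[of x] Suc.IH[of "\<gamma> x"] assms(1) by (auto simp: difference_def)
qed (use assms in auto)

lemma difference_Suc:
  "(difference \<gamma> ^^ Suc k) f x = (difference \<gamma> ^^ k) f (\<gamma> x) - (difference \<gamma> ^^ k) f x"
  by (simp only: funpow.simps comp_apply) (simp only: difference_def)

lemma difference_zero: "(difference \<gamma> ^^ k) (\<lambda>_. 0) x = 0"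
  by (induction k arbitrary: x) (auto simp: difference_def)

lemma difference_add:
  "(difference \<gamma> ^^ k) (\<lambda>x. f x + g x) x = (difference \<gamma> ^^ k) f x + (difference \<gamma> ^^ k) g x"
  by (induction k arbitrary: x) (auto simp: difference_def)

lemma difference_mult_const:
  "(difference \<gamma> ^^ k) (\<lambda>x. c * f x) x = c * (difference \<gamma> ^^ k) f x"
  by (induction k arbitrary: x) (auto simp: difference_def right_diff_distrib)

lemma difference_diff:
  "(difference \<gamma> ^^ k) (\<lambda>x. f x - g x) x = (difference \<gamma> ^^ k) f x - (difference \<gamma> ^^ k) g x"
  by (induction k arbitrary: x) (auto simp: difference_def)

lemma difference_sum:
  "(difference \<gamma> ^^ k) (\<lambda>x. \<Sum>p\<in>P. f p x) x = (\<Sum>p\<in>P. (difference \<gamma> ^^ k) (f p) x)"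
  by (induction P rule: infinite_finite_induct) (auto simp: difference_zero difference_add)

lemma difference_vanish_mono:
  assumes "\<gamma> \<in> S \<rightarrow> S" "\<And>x. x \<in> S \<Longrightarrow> (difference \<gamma> ^^ k) f x = 0" "k \<le> l" "x \<in> S"
  shows "(difference \<gamma> ^^ l) f x = 0"
proof -
  have "(difference \<gamma> ^^ l) f = (difference \<gamma> ^^ (l - k)) ((difference \<gamma> ^^ k) f)"
    using assms(3) by (metis funpow_add comp_apply le_add_diff_inverse2)
  then show ?thesis
    using difference_cong[of \<gamma> S "(difference \<gamma> ^^ k) f" "\<lambda>_. 0" x "l - k"] assms
    by (simp add: difference_zero)
qed

text \<open>The twisted Leibniz rule \<open>D (f g) = D f D g + D f g + f D g\<close> splits the
  product into three with a smaller sum of exponents, so the induction runs over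
  \<open>a + b\<close>.\<close>

lemma difference_mult_vanish:
  fixes f g :: "'x \<Rightarrow> 'a::comm_ring_1"
  assumes "\<gamma> \<in> S \<rightarrow> S"
    and "\<And>x. x \<in> S \<Longrightarrow> (difference \<gamma> ^^ a) f x = 0" "\<And>x. x \<in> S \<Longrightarrow> (difference \<gamma> ^^ b) g x = 0"
    and "x \<in> S"
  shows "(difference \<gamma> ^^ (a + b)) (\<lambda>x. f x * g x) x = 0"
  using assms(2-)
proof (induction "a + b" arbitrary: a b f g x rule: less_induct)
  case less
  have zero: "(difference \<gamma> ^^ k) (\<lambda>x. f x * g x) x = 0"
    if "a = 0 \<or> b = 0" for k
    using difference_cong[OF assms(1), of "\<lambda>x. f x * g x" "\<lambda>_. 0" x k] less.prems that
    by (auto simp: difference_zero)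
  show ?case
  proof (cases "a = 0 \<or> b = 0")
    case False
    then obtain a' b' where ab: "a = Suc a'" "b = Suc b'"
      by (meson not0_implies_Suc)
    let ?D = "difference \<gamma>"
    have f: "(?D ^^ a') (?D f) x = 0" and g: "(?D ^^ b') (?D g) x = 0" if "x \<in> S" for x
      using less.prems(1,2)[OF that] by (simp_all add: ab funpow_swap1)
    have "(?D ^^ (a' + b')) (\<lambda>x. ?D f x * ?D g x) y = 0" if "y \<in> S" for y
      by (rule less.hyps) (use ab f g that in auto)
    then have 1: "(?D ^^ (a' + b)) (\<lambda>x. ?D f x * ?D g x) x = 0"
      by (rule difference_vanish_mono[OF assms(1)]) (use ab less.prems in auto)
    have 2: "(?D ^^ (a' + b)) (\<lambda>x. ?D f x * g x) x = 0"
      by (rule less.hyps) (use ab f less.prems in auto)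
    have "(?D ^^ (a + b')) (\<lambda>x. f x * ?D g x) x = 0"
      by (rule less.hyps) (use ab g less.prems in auto)
    then have 3: "(?D ^^ (a' + b)) (\<lambda>x. f x * ?D g x) x = 0"
      by (simp add: ab)
    have "?D (\<lambda>x. f x * g x) = (\<lambda>x. (?D f x * ?D g x + ?D f x * g x) + f x * ?D g x)"
      by (simp add: difference_def fun_eq_iff algebra_simps)
    then have "(?D ^^ (a + b)) (\<lambda>x. f x * g x) x =
        (?D ^^ (a' + b)) (\<lambda>x. (?D f x * ?D g x + ?D f x * g x) + f x * ?D g x) x"
      by (simp add: ab funpow_swap1)
    then show ?thesis
      by (simp only: difference_add 1 2 3 add_0_left)
  qed (use zero in auto)
qed

definition nilpotent_functions :: "('x \<Rightarrow> 'x) \<Rightarrow> 'x set \<Rightarrow> ('x \<Rightarrow> 'a::comm_ring_1) set" where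
  "nilpotent_functions \<gamma> S = {f. \<exists>k. \<forall>x\<in>S. (difference \<gamma> ^^ k) f x = 0}"

text \<open>Functions killed by a power of the difference contain the constants and are closed under
  sums and products, so it suffices to test coordinates.\<close>

lemma nilpotent_functions_polyfuns:
  assumes "\<gamma> \<in> S \<rightarrow> S" "f \<in> polyfuns I"
    and "\<And>i. i \<in> I \<Longrightarrow> (\<lambda>x. c x i) \<in> nilpotent_functions \<gamma> S"
  shows "(\<lambda>x. f (c x)) \<in> nilpotent_functions \<gamma> S"
  using assms(2)
proof induction
  case (const c)
  then show ?case
    by (auto simp: nilpotent_functions_def difference_def intro!: exI[of _ "1::nat"])
next
  case (var i)
  then show ?case by (rule assms(3))
next
  case (add f g)
  then obtain a b where ab: "\<forall>x\<in>S. (difference \<gamma> ^^ a) (\<lambda>x. f (c x)) x = 0"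
    "\<forall>x\<in>S. (difference \<gamma> ^^ b) (\<lambda>x. g (c x)) x = 0"
    unfolding nilpotent_functions_def by blast
  have "(difference \<gamma> ^^ max a b) (\<lambda>x. f (c x)) x = 0"
    "(difference \<gamma> ^^ max a b) (\<lambda>x. g (c x)) x = 0" if "x \<in> S" for x
    using difference_vanish_mono[OF assms(1), of a _ "max a b" x]
      difference_vanish_mono[OF assms(1), of b _ "max a b" x] ab that by auto
  then show ?case
    by (auto simp: nilpotent_functions_def difference_add intro!: exI[of _ "max a b"])
next
  case (mult f g)
  then obtain a b where "\<forall>x\<in>S. (difference \<gamma> ^^ a) (\<lambda>x. f (c x)) x = 0"
    "\<forall>x\<in>S. (difference \<gamma> ^^ b) (\<lambda>x. g (c x)) x = 0"
    unfolding nilpotent_functions_def by blast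
  then have "\<forall>x\<in>S. (difference \<gamma> ^^ (a + b)) (\<lambda>x. f (c x) * g (c x)) x = 0"
    by (intro ballI difference_mult_vanish[OF assms(1)]) auto
  then show ?case unfolding nilpotent_functions_def by blast
qed

text \<open>The difference of \<open>x_i\<close> is \<open>h\<close>, a polynomial in earlier
  coordinates, which is nilpotent by induction; one further application handles
  \<open>x_i\<close>.\<close>

lemma nilpotent_functions_unitriangular:
  assumes "\<gamma> \<in> S \<rightarrow> S" and tri: "\<And>i. i \<in> {1..n::nat} \<Longrightarrow>
      \<exists>h\<in>polyfuns {1..<i}. \<forall>x\<in>S. \<gamma> x i = x i + h x"
    and "f \<in> polyfuns {1..n}"
  shows "f \<in> nilpotent_functions \<gamma> S"
proof -
  have "(\<lambda>x. x i) \<in> nilpotent_functions \<gamma> S" if "i \<in> {1..n}" for i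
    using that
  proof (induction i rule: less_induct)
    case (less i)
    obtain h where h: "h \<in> polyfuns {1..<i}" "\<forall>x\<in>S. \<gamma> x i = x i + h x"
      using tri[OF less.prems] by blast
    have "(\<lambda>x. h x) \<in> nilpotent_functions \<gamma> S"
      by (rule nilpotent_functions_polyfuns[OF assms(1) h(1), where c = "\<lambda>x. x"])
        (use less in auto)
    then obtain k where k: "\<forall>x\<in>S. (difference \<gamma> ^^ k) h x = 0"
      unfolding nilpotent_functions_def by auto
    have "(difference \<gamma> ^^ Suc k) (\<lambda>x. x i) x = 0" if "x \<in> S" for x
      using difference_cong[OF assms(1), of "difference \<gamma> (\<lambda>x. x i)" h x k] k h(2) that
      by (simp add: funpow_swap1) (simp add: difference_def)
    then show ?case unfolding nilpotent_functions_def by blast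
  qed
  then show ?thesis
    using nilpotent_functions_polyfuns[OF assms(1,3), where c = "\<lambda>x. x"] by simp
qed


section \<open>Interpolation\<close>

text \<open>The functions in \<open>E\<close>, restricted to \<open>S\<close>, span a space of
  finite dimension on which evaluation at suitable points of \<open>S\<close> gives coordinates.
  Nodes and dual functions \<open>e p\<close> are built by adding the members of \<open>E\<close>
  one after another, in the manner of Gram-Schmidt.\<close>

lemma interpolation:
  fixes E :: "(('v \<Rightarrow> 'a::field) \<Rightarrow> 'a) set"
  assumes "finite E" "E \<subseteq> polyfuns I"
  shows "\<exists>P e. finite P \<and> P \<subseteq> S \<and> (\<forall>p\<in>P. e p \<in> polyfuns I) \<and>
    (\<forall>p\<in>P. \<forall>q\<in>P. e p q = (if p = q then 1 else 0)) \<and>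
    (\<forall>f\<in>E. \<forall>x\<in>S. f x = (\<Sum>p\<in>P. f p * e p x))"
  using assms
proof (induction E)
  case empty
  then show ?case by (intro exI[of _ "{}"]) auto
next
  case (insert g E)
  then obtain P e where P: "finite P" "P \<subseteq> S" "\<forall>p\<in>P. e p \<in> polyfuns I"
    and delta: "\<forall>p\<in>P. \<forall>q\<in>P. e p q = (if p = q then 1 else 0)"
    and E: "\<forall>f\<in>E. \<forall>x\<in>S. f x = (\<Sum>p\<in>P. f p * e p x)"
    using insert.IH[OF order_trans[OF subset_insertI insert.prems]]
    by (elim exE conjE) (rule that)
  \<comment> \<open>The interpolation error of \<open>g\<close>. It vanishes at the nodes, and if it
    is nonzero at some \<open>r\<close> in \<open>S\<close>, this \<open>r\<close> becomes a new
    node.\<close>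
  define g' where "g' = (\<lambda>x. g x - (\<Sum>p\<in>P. g p * e p x))"
  have g': "g' \<in> polyfuns I"
    unfolding g'_def using insert.prems P
    by (intro polyfuns_diff polyfuns_sum polyfuns.mult polyfuns.const) auto
  show ?case
  proof (cases "\<forall>x\<in>S. g' x = 0")
    case True
    then show ?thesis
      using P delta E by (intro exI[of _ P] exI[of _ e]) (auto simp: g'_def)
  next
    case False
    then obtain r where r: "r \<in> S" "g' r \<noteq> 0" by blast
    define u where "u = (\<lambda>x. inverse (g' r) * g' x)"
    have u: "u \<in> polyfuns I" "u r = 1"
      unfolding u_def using r g' by (auto intro: polyfuns.intros)
    have g'0: "g' q = 0" if "q \<in> P" for q
    proof -
      have "(\<Sum>p\<in>P. g p * e p q) = (\<Sum>p\<in>P. if p = q then g p else 0)"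
        by (rule sum.cong) (use delta that in auto)
      then show ?thesis using that P(1) by (simp add: g'_def)
    qed
    then have u0: "u q = 0" if "q \<in> P" for q using that by (simp add: u_def)
    have rP: "r \<notin> P" using g'0 r by auto
    \<comment> \<open>The old dual functions are corrected so as to vanish at \<open>r\<close>;
      since \<open>u\<close> vanishes at the old nodes, their values there do not change.\<close>
    define e' where "e' p = (if p = r then u else (\<lambda>x. e p x - e p r * u x))" for p
    have e'_P: "e' p = (\<lambda>x. e p x - e p r * u x)" if "p \<in> P" for p
      using that rP by (auto simp: e'_def)
    have sum: "(\<Sum>p\<in>insert r P. f p * e' p x) =
        (\<Sum>p\<in>P. f p * e p x) + (f r - (\<Sum>p\<in>P. f p * e p r)) * u x" for f x
    proof -
      have "(\<Sum>p\<in>P. f p * e' p x) = (\<Sum>p\<in>P. f p * e p x) - (\<Sum>p\<in>P. f p * e p r) * u x"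
        by (simp add: e'_P sum_subtractf sum_distrib_right right_diff_distrib mult.assoc)
      then show ?thesis
        using P(1) rP by (simp add: e'_def algebra_simps)
    qed
    show ?thesis
    proof (intro exI[of _ "insert r P"] exI[of _ e'] conjI ballI)
      fix p assume p: "p \<in> insert r P"
      show "e' p \<in> polyfuns I"
        using p u P(3) by (auto simp: e'_def intro!: polyfuns_diff polyfuns.mult polyfuns.const)
      fix q assume q: "q \<in> insert r P"
      show "e' p q = (if p = q then 1 else 0)"
        using p q delta u0 u(2) rP by (auto simp: e'_def)
    next
      fix f x assume f: "f \<in> insert g E" and x: "x \<in> S"
      show "f x = (\<Sum>p\<in>insert r P. f p * e' p x)"
      proof (cases "f = g")
        case True
        have "(g r - (\<Sum>p\<in>P. g p * e p r)) * u x = g' x"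
          using r(2) by (simp add: u_def g'_def)
        then show ?thesis unfolding sum True by (simp add: g'_def)
      next
        case False
        then have "f \<in> E" using f by simp
        then show ?thesis unfolding sum using E x r(1) by simp
      qed
    qed (use P r in auto)
  qed
qed


section \<open>Weighted degrees\<close>

text \<open>An upper bound for the weighted degree of a function: some way of writing it stays
  within \<open>w\<close>. The slack in the rules for variables and products makes the bound
  monotone, and the inductive form suits substitution.\<close>

inductive weight_le :: "('v \<Rightarrow> nat) \<Rightarrow> 'v set \<Rightarrow> nat \<Rightarrow> (('v \<Rightarrow> 'a::comm_semiring_1) \<Rightarrow> 'a) \<Rightarrow> bool"
  for d I where
  const: "weight_le d I w (\<lambda>_. c)"
| var: "i \<in> I \<Longrightarrow> d i \<le> w \<Longrightarrow> weight_le d I w (\<lambda>x. x i)"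
| add: "weight_le d I w f \<Longrightarrow> weight_le d I w g \<Longrightarrow> weight_le d I w (\<lambda>x. f x + g x)"
| mult: "weight_le d I v f \<Longrightarrow> weight_le d I w g \<Longrightarrow> v + w \<le> u \<Longrightarrow> weight_le d I u (\<lambda>x. f x * g x)"

lemma weight_le_mono:
  assumes "weight_le d I v f" "v \<le> w" "I \<subseteq> J"
  shows "weight_le d J w f"
  using assms
proof (induction arbitrary: w)
  case (mult v f v' g u)
  then show ?case by (intro weight_le.mult[of d J v f v' g w]) auto
qed (auto intro: weight_le.intros)

lemma weight_le_imp_polyfuns: "weight_le d I w f \<Longrightarrow> f \<in> polyfuns I"
  by (induction rule: weight_le.induct) (auto intro: polyfuns.intros)

text \<open>This is the mechanism that keeps degrees bounded under composition: a variable of weight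
  \<open>d i\<close> may be traded for any function of weight at most \<open>d i\<close>.\<close>

lemma weight_le_comp:
  assumes "weight_le d I w f" "\<And>i. i \<in> I \<Longrightarrow> weight_le d' J (d i) (\<lambda>x. g x i)"
  shows "weight_le d' J w (\<lambda>x. f (g x))"
  using assms(1)
proof induction
  case (var i w)
  then show ?case using weight_le_mono[OF assms(2)[of i], of w J] by auto
next
  case (mult v f v' h u)
  then show ?case by (intro weight_le.mult[of d' J v _ v' _ u]) auto
qed (auto intro: weight_le.intros)

text \<open>Since all weights are at least 1, no exponent can exceed \<open>w\<close>. The monomials
  with exponents at most \<open>w\<close> are more than enough, and there are finitely many.\<close>

lemma weight_le_span:
  fixes f :: "('v \<Rightarrow> 'a::comm_semiring_1) \<Rightarrow> 'a"
  assumes "finite I" "\<And>i. i \<in> I \<Longrightarrow> 1 \<le> d i" "weight_le d I w f"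
  shows "\<exists>c. f = (\<lambda>x. \<Sum>m\<in>I \<rightarrow>\<^sub>E {..w}. c m * (\<Prod>i\<in>I. x i ^ m i))"
proof -
  define mon :: "('v \<Rightarrow> nat) \<Rightarrow> ('v \<Rightarrow> 'a) \<Rightarrow> 'a" where "mon m x = (\<Prod>i\<in>I. x i ^ m i)" for m x
  define R where "R w = {f. \<exists>c. f = (\<lambda>x. \<Sum>m\<in>I \<rightarrow>\<^sub>E {..w}. c m * mon m x)}" for w :: nat
  have fin: "finite (I \<rightarrow>\<^sub>E {..w})" for w :: nat using assms(1) by (intro finite_PiE) auto
  have add: "(\<lambda>x. f x + g x) \<in> R w" if fg: "f \<in> R w" "g \<in> R w" for f g w
  proof -
    obtain c c' where "f = (\<lambda>x. \<Sum>m\<in>I \<rightarrow>\<^sub>E {..w}. c m * mon m x)"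
      "g = (\<lambda>x. \<Sum>m\<in>I \<rightarrow>\<^sub>E {..w}. c' m * mon m x)"
      using fg unfolding R_def by blast
    then have "(\<lambda>x. f x + g x) = (\<lambda>x. \<Sum>m\<in>I \<rightarrow>\<^sub>E {..w}. (c m + c' m) * mon m x)"
      by (simp add: sum.distrib distrib_right)
    then show ?thesis unfolding R_def by (intro CollectI exI[of _ "\<lambda>m. c m + c' m"])
  qed
  have mon: "(\<lambda>x. c * mon m x) \<in> R w" if "m \<in> I \<rightarrow>\<^sub>E {..w}" for c m w
  proof -
    have "(\<lambda>x. c * mon m x) = (\<lambda>x. \<Sum>m'\<in>I \<rightarrow>\<^sub>E {..w}. (if m' = m then c else 0) * mon m' x)"
      using that fin[of w] by (simp add: if_distrib[where f = "\<lambda>a. a * _"] cong: if_cong)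
    then show ?thesis unfolding R_def by (intro CollectI exI[of _ "\<lambda>m'. if m' = m then c else 0"])
  qed
  have zero: "(\<lambda>x. 0) \<in> R w" for w
    unfolding R_def by (intro CollectI exI[of _ "\<lambda>_. 0"]) simp
  have sum: "(\<lambda>x. \<Sum>k\<in>A. h k x) \<in> R w" if "\<And>k. k \<in> A \<Longrightarrow> h k \<in> R w"
    for A :: "('v \<Rightarrow> nat) set" and h w
    using that by (induction A rule: infinite_finite_induct) (auto intro: add zero)
  from assms(3) have "f \<in> R w"
  proof induction
    case (const w c)
    have "mon (\<lambda>i\<in>I. 0) x = 1" for x by (simp add: mon_def)
    then show ?case using mon[of "\<lambda>i\<in>I. 0" w c] by auto
  next
    case (var j w)
    have "mon (\<lambda>i\<in>I. if i = j then 1 else 0) x = x j" for x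
      using var(1) assms(1) by (simp add: mon_def if_distrib[where f = "\<lambda>a. _ ^ a"] cong: if_cong)
    moreover have "1 \<le> w" using assms(2)[of j] var by simp
    ultimately show ?case
      using mon[of "\<lambda>i\<in>I. if i = j then 1 else 0" w 1] by auto
  next
    case (add w f g)
    then show ?case using \<open>\<And>w g f. f \<in> R w \<Longrightarrow> g \<in> R w \<Longrightarrow> (\<lambda>x. f x + g x) \<in> R w\<close> by blast
  next
    case (mult v f w g u)
    then obtain c c' where c: "f = (\<lambda>x. \<Sum>m\<in>I \<rightarrow>\<^sub>E {..v}. c m * mon m x)"
      "g = (\<lambda>x. \<Sum>m\<in>I \<rightarrow>\<^sub>E {..w}. c' m * mon m x)"
      unfolding R_def by blast
    have "mon m x * mon m' x = mon (\<lambda>i\<in>I. m i + m' i) x" for m m' x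
      by (simp add: mon_def power_add prod.distrib)
    then have "(\<lambda>x. f x * g x) = (\<lambda>x. \<Sum>m\<in>I \<rightarrow>\<^sub>E {..v}. \<Sum>m'\<in>I \<rightarrow>\<^sub>E {..w}.
        (c m * c' m') * mon (\<lambda>i\<in>I. m i + m' i) x)"
      unfolding c sum_product by (intro ext sum.cong refl) (metis mult.assoc mult.left_commute)
    moreover have "(\<lambda>x. \<Sum>m\<in>I \<rightarrow>\<^sub>E {..v}. \<Sum>m'\<in>I \<rightarrow>\<^sub>E {..w}.
        (c m * c' m') * mon (\<lambda>i\<in>I. m i + m' i) x) \<in> R u"
    proof (intro sum mon)
      fix m m' :: "'v \<Rightarrow> nat" assume "m \<in> I \<rightarrow>\<^sub>E {..v}" "m' \<in> I \<rightarrow>\<^sub>E {..w}"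
      then have "m i + m' i \<le> u" if "i \<in> I" for i
        using mult.hyps(3) that by (meson PiE_mem add_mono atMost_iff order_trans)
      then show "(\<lambda>i\<in>I. m i + m' i) \<in> I \<rightarrow>\<^sub>E {..u}" by auto
    qed
    ultimately show ?case by simp
  qed
  then show ?thesis unfolding R_def mon_def by blast
qed

text \<open>\<open>N\<close> bounds the degree of \<open>Q\<close> in the variables from
  \<open>I\<close>. The parameter \<open>t\<close> counts as a constant, so the bound is the same
  for all \<open>t\<close>; it is also fixed before the weights are chosen.\<close>

lemma weight_le_uniform:
  fixes Q :: "(unit + 'v \<Rightarrow> 'a::comm_semiring_1) \<Rightarrow> 'a"
  assumes "Q \<in> polyfuns ({()} <+> I)"
  shows "\<exists>N. \<forall>M d t. (\<forall>i\<in>I. d i \<le> M) \<longrightarrow> weight_le d I (N * M) (\<lambda>x. Q (case_sum (\<lambda>_. t) x))"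
  using assms
proof induction
  case (const c)
  then show ?case by (auto intro: weight_le.const)
next
  case (var i)
  then show ?case
  proof (cases i)
    case (Inr j)
    then have "weight_le d I (1 * M) (\<lambda>x :: 'v \<Rightarrow> 'a. x j)" if "\<forall>i\<in>I. d i \<le> M" for M d
      using that var by (intro weight_le.var) auto
    then show ?thesis using Inr by (intro exI[of _ 1]) simp
  qed (auto intro: weight_le.const)
next
  case (add f g)
  from add.IH(1) obtain N where N: "\<forall>M d t. (\<forall>i\<in>I. d i \<le> M) \<longrightarrow>
    weight_le d I (N * M) (\<lambda>x. f (case_sum (\<lambda>_. t) x))" ..
  from add.IH(2) obtain N' where N': "\<forall>M d t. (\<forall>i\<in>I. d i \<le> M) \<longrightarrow>
    weight_le d I (N' * M) (\<lambda>x. g (case_sum (\<lambda>_. t) x))" ..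
  have "weight_le d I (max N N' * M) (\<lambda>x. f (case_sum (\<lambda>_. t) x) + g (case_sum (\<lambda>_. t) x))"
    if "\<forall>i\<in>I. d i \<le> M" for M d t
    by (intro weight_le.add weight_le_mono[OF N[rule_format]] weight_le_mono[OF N'[rule_format]])
      (use that in auto)
  then show ?case by (intro exI[of _ "max N N'"] allI impI)
next
  case (mult f g)
  from mult.IH(1) obtain N where N: "\<forall>M d t. (\<forall>i\<in>I. d i \<le> M) \<longrightarrow>
    weight_le d I (N * M) (\<lambda>x. f (case_sum (\<lambda>_. t) x))" ..
  from mult.IH(2) obtain N' where N': "\<forall>M d t. (\<forall>i\<in>I. d i \<le> M) \<longrightarrow>
    weight_le d I (N' * M) (\<lambda>x. g (case_sum (\<lambda>_. t) x))" ..
  have "weight_le d I ((N + N') * M) (\<lambda>x. f (case_sum (\<lambda>_. t) x) * g (case_sum (\<lambda>_. t) x))"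
    if "\<forall>i\<in>I. d i \<le> M" for M d t
    by (rule weight_le.mult[OF N[rule_format] N'[rule_format]]) (use that in \<open>auto simp: distrib_right\<close>)
  then show ?case by (intro exI[of _ "N + N'"] allI impI)
qed


section \<open>The group of automorphisms of affine space\<close>

lemma restrict_in_affine_space: "restrict x I \<in> affine_space I"
  by (simp add: affine_space_def)

lemma variety_morphism_affine_iff:
  "variety_morphism I V J W f \<longleftrightarrow> f \<in> V \<rightarrow> W \<and> (\<forall>j\<in>J. \<exists>p\<in>polyfuns I. \<forall>x\<in>V. f x j = p x)"
  by (simp add: variety_morphism_def regular_function_iff)

lemma variety_morphism_compose:
  assumes f: "variety_morphism I V J W f" and g: "variety_morphism J W K Z g"
    and h: "\<And>x. x \<in> V \<Longrightarrow> h x = g (f x)"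
  shows "variety_morphism I V K Z h"
  unfolding variety_morphism_affine_iff
proof (intro conjI ballI)
  show "h \<in> V \<rightarrow> Z" using f g h by (auto simp: variety_morphism_def)
  fix k assume "k \<in> K"
  then obtain p where p: "p \<in> polyfuns J" "\<forall>y\<in>W. g y k = p y"
    using g unfolding variety_morphism_affine_iff by blast
  obtain q where q: "\<forall>j\<in>J. q j \<in> polyfuns I \<and> (\<forall>x\<in>V. f x j = q j x)"
    using f bchoice[of J "\<lambda>j p. p \<in> polyfuns I \<and> (\<forall>x\<in>V. f x j = p x)"]
    unfolding variety_morphism_affine_iff by blast
  have "(\<lambda>x. p (\<lambda>j. q j x)) \<in> polyfuns I"
    by (rule polyfuns_comp[OF p(1), where g = "\<lambda>x j. q j x"]) (use q in auto)
  moreover have "h x k = p (\<lambda>j. q j x)" if "x \<in> V" for x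
  proof -
    have "h x k = p (f x)"
      using h[OF that] p(2) f that by (auto simp: variety_morphism_def)
    also have "\<dots> = p (\<lambda>j. q j x)"
      by (rule polyfuns_cong[OF p(1)]) (use q that in auto)
    finally show ?thesis .
  qed
  ultimately show "\<exists>p\<in>polyfuns I. \<forall>x\<in>V. h x k = p x" by (intro bexI[of _ "\<lambda>x. p (\<lambda>j. q j x)"]) auto
qed

lemma carrier_Aut_affine:
  "carrier (Aut_affine n) = {\<phi> \<in> Bij (affine_nspace n).
     variety_morphism {1..n} (affine_nspace n) {1..n} (affine_nspace n) \<phi> \<and>
     variety_morphism {1..n} (affine_nspace n) {1..n} (affine_nspace n)
       (inv_into (affine_nspace n) \<phi>)}"
  by (simp add: Aut_affine_def)

lemma Aut_affine_bij: "\<phi> \<in> carrier (Aut_affine n) \<Longrightarrow> bij_betw \<phi> (affine_nspace n) (affine_nspace n)"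
  by (simp add: carrier_Aut_affine Bij_def)

lemma Aut_affine_closed:
  "\<phi> \<in> carrier (Aut_affine n) \<Longrightarrow> x \<in> affine_nspace n \<Longrightarrow> \<phi> x \<in> affine_nspace n"
  using Aut_affine_bij bij_betwE by fast

lemma Aut_affine_eqI:
  assumes "\<phi> \<in> carrier (Aut_affine n)" "\<psi> \<in> carrier (Aut_affine n)"
    and "\<And>x i. x \<in> affine_nspace n \<Longrightarrow> i \<in> {1..n} \<Longrightarrow> \<phi> x i = \<psi> x i"
  shows "\<phi> = \<psi>"
proof (rule extensionalityI[of _ "affine_nspace n"])
  fix x :: "nat \<Rightarrow> 'a" assume x: "x \<in> affine_nspace n"
  have "\<phi> x \<in> affine_nspace n" "\<psi> x \<in> affine_nspace n"
    using Aut_affine_closed assms x by blast+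
  then show "\<phi> x = \<psi> x"
    unfolding affine_space_def by (rule PiE_ext) (use assms(3)[OF x] in auto)
qed (use assms in \<open>auto simp: carrier_Aut_affine Bij_def\<close>)

lemma Aut_affine_mult:
  "\<phi> \<in> carrier (Aut_affine n) \<Longrightarrow> \<psi> \<in> carrier (Aut_affine n) \<Longrightarrow>
    \<phi> \<otimes>\<^bsub>Aut_affine n\<^esub> \<psi> = compose (affine_nspace n) \<phi> \<psi>"
  by (simp add: carrier_Aut_affine) (simp add: Aut_affine_def BijGroup_def)

lemma Aut_affine_mult_apply:
  "\<phi> \<in> carrier (Aut_affine n) \<Longrightarrow> \<psi> \<in> carrier (Aut_affine n) \<Longrightarrow> x \<in> affine_nspace n \<Longrightarrow>
    (\<phi> \<otimes>\<^bsub>Aut_affine n\<^esub> \<psi>) x = \<phi> (\<psi> x)"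
  by (simp add: Aut_affine_mult compose_eq)

lemma Aut_affine_one: "\<one>\<^bsub>Aut_affine n\<^esub> = (\<lambda>x\<in>affine_nspace n. x)"
  by (simp add: Aut_affine_def BijGroup_def)

text \<open>A map and its inverse are both required to be polynomial, so closure under inverses is a
  matter of symmetry. What has to be checked is how \<open>inv_into\<close> behaves on restricted
  and composed maps; \<open>inv_eq\<close> computes it from a preimage.\<close>

lemma group_Aut_affine: "group (Aut_affine n :: ((nat \<Rightarrow> 'a::field) \<Rightarrow> nat \<Rightarrow> 'a) monoid)"
proof -
  let ?S = "affine_nspace n :: (nat \<Rightarrow> 'a) set"
  let ?M = "variety_morphism {1..n} ?S {1..n} ?S"
  let ?C = "carrier (Aut_affine n) :: ((nat \<Rightarrow> 'a) \<Rightarrow> nat \<Rightarrow> 'a) set"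
  interpret B: group "BijGroup ?S" by (rule group_BijGroup)
  have inv_eq: "inv_into ?S f x = y" if "bij_betw f ?S ?S" "y \<in> ?S" "f y = x" for f x y
    using that by (metis bij_betw_inv_into_left)
  have "subgroup ?C (BijGroup ?S)"
  proof (rule B.subgroupI)
    show "?C \<subseteq> carrier (BijGroup ?S)"
      by (auto simp: carrier_Aut_affine BijGroup_def)
    have id: "?M (\<lambda>x\<in>?S. x)"
      unfolding variety_morphism_affine_iff by (auto intro!: bexI[OF _ polyfuns.var])
    moreover have "?M (inv_into ?S (\<lambda>x\<in>?S. x))"
      by (rule variety_morphism_compose[OF id id])
        (use inv_eq[of "\<lambda>x\<in>?S. x"] id_Bij[of ?S] in \<open>auto simp: Bij_def\<close>)
    ultimately show "?C \<noteq> {}"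
      using id_Bij[of ?S] unfolding carrier_Aut_affine by blast
  next
    fix f assume f: "f \<in> ?C"
    then have inv: "inv\<^bsub>BijGroup ?S\<^esub> f = (\<lambda>x\<in>?S. inv_into ?S f x)" and b: "bij_betw f ?S ?S"
      by (simp_all add: carrier_Aut_affine inv_BijGroup Bij_def)
    have M: "?M f" "?M (inv_into ?S f)" using f by (simp_all add: carrier_Aut_affine)
    have id: "?M (\<lambda>x. x)"
      unfolding variety_morphism_affine_iff by (auto intro!: bexI[OF _ polyfuns.var])
    have Bij: "(\<lambda>x\<in>?S. inv_into ?S f x) \<in> Bij ?S"
      using f by (intro restrict_inv_into_Bij) (simp add: carrier_Aut_affine)
    have "inv_into ?S (\<lambda>x\<in>?S. inv_into ?S f x) x = f x" if "x \<in> ?S" for x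
      by (rule inv_eq) (use Bij b that in \<open>auto simp: Bij_def bij_betw_inv_into_left bij_betwE\<close>)
    then have "?M (inv_into ?S (\<lambda>x\<in>?S. inv_into ?S f x))"
      by (intro variety_morphism_compose[OF M(1) id]) auto
    moreover have "?M (\<lambda>x\<in>?S. inv_into ?S f x)"
      by (rule variety_morphism_compose[OF M(2) id]) auto
    ultimately show "inv\<^bsub>BijGroup ?S\<^esub> f \<in> ?C"
      unfolding inv using Bij by (simp add: carrier_Aut_affine)
  next
    fix f g assume fg: "f \<in> ?C" "g \<in> ?C"
    then have eq: "f \<otimes>\<^bsub>BijGroup ?S\<^esub> g = compose ?S f g"
      by (simp add: carrier_Aut_affine BijGroup_def)
    have b: "bij_betw f ?S ?S" "bij_betw g ?S ?S" using fg Aut_affine_bij by blast+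
    have M: "?M f" "?M (inv_into ?S f)" "?M g" "?M (inv_into ?S g)"
      using fg by (simp_all add: carrier_Aut_affine)
    have Bij: "compose ?S f g \<in> Bij ?S"
      using fg by (intro compose_Bij) (simp_all add: carrier_Aut_affine)
    have "inv_into ?S (compose ?S f g) x = inv_into ?S g (inv_into ?S f x)" if "x \<in> ?S" for x
    proof (rule inv_eq)
      have i: "inv_into ?S f x \<in> ?S" "inv_into ?S g (inv_into ?S f x) \<in> ?S"
        using b that by (auto intro!: bij_betw_apply[OF bij_betw_inv_into])
      then show "inv_into ?S g (inv_into ?S f x) \<in> ?S" by simp
      show "compose ?S f g (inv_into ?S g (inv_into ?S f x)) = x"
        using b that i by (simp add: compose_eq bij_betw_inv_into_right)
    qed (use Bij in \<open>simp add: Bij_def\<close>)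
    then have "?M (inv_into ?S (compose ?S f g))"
      by (rule variety_morphism_compose[OF M(2) M(4)])
    moreover have "?M (compose ?S f g)"
      by (rule variety_morphism_compose[OF M(3) M(1)]) (simp add: compose_eq)
    ultimately show "f \<otimes>\<^bsub>BijGroup ?S\<^esub> g \<in> ?C"
      unfolding eq using Bij by (simp add: carrier_Aut_affine)
  qed
  then have "group (BijGroup ?S\<lparr>carrier := ?C\<rparr>)"
    by (rule B.subgroup_imp_group)
  then show ?thesis by (simp add: Aut_affine_def)
qed

section \<open>Triangular actions of the additive group\<close>

lemma nonvanishing_poly_constant:
  fixes P :: "'a::alg_closed_field poly"
  assumes "\<And>t. poly P t \<noteq> 0"
  shows "poly P s = poly P t"
proof -
  have "degree P = 0"
    using assms alg_closed_imp_poly_has_root[of P] by blast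
  then obtain c where "P = [:c:]" by (rule degree_eq_zeroE)
  then show ?thesis by simp
qed

text \<open>The parameter is carried over from the additive group through the inverse of
  \<open>f\<close> and then \<open>\<rho>\<close>. The corrections \<open>Q i\<close> come out
  polynomial in \<open>t\<close> and \<open>x\<close> together, which a separate choice of
  \<open>h\<close> for every element of \<open>U\<close> would not provide.\<close>

lemma triangular_Ga_parametrization:
  fixes U :: "((nat \<Rightarrow> 'a::alg_closed_field) \<Rightarrow> (nat \<Rightarrow> 'a)) set"
  assumes tri: "triangular_subgroup n U" and Ga: "Ga_subgroup n U"
  shows "\<exists>\<theta> Q. range \<theta> = U \<and> (\<forall>i\<in>{1..n}. Q i \<in> polyfuns ({()} <+> {1..<i}) \<and>
    (\<forall>t. \<forall>x\<in>affine_nspace n. \<theta> t x i = x i + Q i (case_sum (\<lambda>_::unit. t :: 'a) x)))"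
proof -
  let ?S = "affine_nspace n :: (nat \<Rightarrow> 'a) set"
  obtain m G \<rho> f where alg: "algebraic_structure n U m G \<rho>"
    and iso: "algebraic_group_iso m G 1 additive_group f"
    using Ga unfolding Ga_subgroup_def by blast
  have subU: "subgroup U (Aut_affine n)" using tri by (simp add: triangular_subgroup_def)
  have \<rho>: "bij_betw \<rho> (carrier G) U"
    using alg by (simp add: algebraic_structure_def iso_def)
  have f: "bij_betw f (carrier G) (affine_space {1..1})"
    using iso by (simp add: algebraic_group_iso_def iso_def additive_group_def)
  define \<alpha> where "\<alpha> t = inv_into (carrier G) f (\<lambda>i\<in>{1..1}. t)" for t :: 'a
  define \<theta> where "\<theta> t = \<rho> (\<alpha> t)" for t
  have "range (\<lambda>t::'a. \<lambda>i\<in>{1..1::nat}. t) = affine_space {1..1}"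
  proof (intro equalityI subsetI)
    fix y :: "nat \<Rightarrow> 'a" assume "y \<in> affine_space {1..1}"
    then have "y = (\<lambda>i\<in>{1..1}. y 1)"
      by (auto simp: affine_space_def PiE_def extensional_def fun_eq_iff)
    then show "y \<in> range (\<lambda>t::'a. \<lambda>i\<in>{1..1::nat}. t)" by blast
  qed (auto simp only: restrict_in_affine_space)
  moreover have "range \<alpha> = inv_into (carrier G) f ` range (\<lambda>t::'a. \<lambda>i\<in>{1..1::nat}. t)"
    unfolding \<alpha>_def by blast
  ultimately have \<alpha>: "range \<alpha> = carrier G"
    using bij_betw_inv_into[OF f] by (simp add: bij_betw_def)
  have "range \<theta> = \<rho> ` range \<alpha>" by (auto simp: \<theta>_def)
  then have \<theta>: "range \<theta> = U" using \<rho> by (simp add: \<alpha> bij_betw_def)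
  have "\<forall>j\<in>{1..m}. \<exists>g\<in>polyfuns {1..1}. \<forall>y\<in>affine_space {1..1}. inv_into (carrier G) f y j = g y"
    using iso by (simp add: algebraic_group_iso_def variety_morphism_affine_iff additive_group_def)
  then obtain g where g: "\<forall>j\<in>{1..m}. g j \<in> polyfuns {1..1} \<and>
      (\<forall>y\<in>affine_space {1..1}. inv_into (carrier G) f y j = g j y)"
    using bchoice[of "{1..m}" "\<lambda>j g. g \<in> polyfuns {1..1} \<and>
      (\<forall>y\<in>affine_space {1..1}. inv_into (carrier G) f y j = g y)"] by blast
  have \<alpha>_g: "\<alpha> t j = g j (\<lambda>_. t)" if "j \<in> {1..m}" for t j
  proof -
    have "\<alpha> t j = g j (\<lambda>i\<in>{1..1}. t)"
      using g that restrict_in_affine_space[of "\<lambda>_. t" "{1..1}"] unfolding \<alpha>_def by blast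
    also have "\<dots> = g j (\<lambda>_. t)"
      using g that by (intro polyfuns_cong[of "g j" "{1..1}"]) auto
    finally show ?thesis .
  qed
  have "\<forall>i\<in>{1..n}. \<exists>p\<in>polyfuns ({1..m} <+> {1..n}).
      \<forall>z\<in>variety_product (carrier G) ?S. \<rho> (z \<circ> Inl) (z \<circ> Inr) i = p z"
    using alg by (simp add: algebraic_structure_def variety_morphism_affine_iff)
  then obtain P where P: "\<forall>i\<in>{1..n}. P i \<in> polyfuns ({1..m} <+> {1..n}) \<and>
      (\<forall>z\<in>variety_product (carrier G) ?S. \<rho> (z \<circ> Inl) (z \<circ> Inr) i = P i z)"
    using bchoice[of "{1..n}" "\<lambda>i p. p \<in> polyfuns ({1..m} <+> {1..n}) \<and>
      (\<forall>z\<in>variety_product (carrier G) ?S. \<rho> (z \<circ> Inl) (z \<circ> Inr) i = p z)"] by blast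
  define R where "R i z = P i (case_sum (\<lambda>j. g j (\<lambda>_. z (Inl ()))) (z \<circ> Inr))"
    for i and z :: "unit + nat \<Rightarrow> 'a"
  have R: "R i \<in> polyfuns ({()} <+> {1..n})" if "i \<in> {1..n}" for i
  proof -
    have "(\<lambda>z. P i (case_sum (\<lambda>j. g j (\<lambda>_. z (Inl ()))) (z \<circ> Inr))) \<in> polyfuns ({()} <+> {1..n})"
    proof (rule polyfuns_comp[where I = "{1..m} <+> {1..n}" and
          g = "\<lambda>z. case_sum (\<lambda>j. g j (\<lambda>_. z (Inl ()))) (z \<circ> Inr)"])
      fix v assume v: "v \<in> {1..m} <+> {1..n}"
      show "(\<lambda>z :: unit + nat \<Rightarrow> 'a. case_sum (\<lambda>j. g j (\<lambda>_. z (Inl ()))) (z \<circ> Inr) v)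
          \<in> polyfuns ({()} <+> {1..n})"
      proof (cases v)
        case (Inl j)
        then have "g j \<in> polyfuns {1..1}" using v g by auto
        then have "(\<lambda>z :: unit + nat \<Rightarrow> 'a. g j (\<lambda>_. z (Inl ()))) \<in> polyfuns ({()} <+> {1..n})"
          by (rule polyfuns_comp[where g = "\<lambda>z _. z (Inl ())"]) (auto intro: polyfuns.var)
        then show ?thesis using Inl by simp
      qed (use v in \<open>auto intro: polyfuns.var\<close>)
    qed (use P that in auto)
    then show ?thesis by (simp add: R_def[abs_def])
  qed
  have \<theta>_R: "\<theta> t x i = R i (case_sum (\<lambda>_. t) x)" if i: "i \<in> {1..n}" and x: "x \<in> ?S" for t x i
  proof -
    have "case_sum (\<alpha> t) x \<in> variety_product (carrier G) ?S"
      unfolding variety_product_def using \<alpha> x by blast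
    then have "\<theta> t x i = P i (case_sum (\<alpha> t) x)"
      using P i by (fastforce simp: \<theta>_def comp_def)
    also have "\<dots> = R i (case_sum (\<lambda>_. t) x)"
      unfolding R_def
      by (rule polyfuns_cong[of "P i" "{1..m} <+> {1..n}"]) (use P i in \<open>auto simp: \<alpha>_g\<close>)
    finally show ?thesis .
  qed
  \<comment> \<open>Setting the variables from \<open>i\<close> on to 0 removes the diagonal term
    and leaves the lower part of a triangular map; taken from \<open>R\<close>, it is polynomial in
    the parameter.\<close>
  define Q where "Q i z = R i (case_sum (z \<circ> Inl) (\<lambda>j. if j < i then z (Inr j) else 0))"
    for i and z :: "unit + nat \<Rightarrow> 'a"
  have Q: "Q i \<in> polyfuns ({()} <+> {1..<i})" if "i \<in> {1..n}" for i
  proof -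
    have "(\<lambda>z. R i (case_sum (z \<circ> Inl) (\<lambda>j. if j < i then z (Inr j) else 0))) \<in> polyfuns ({()} <+> {1..<i})"
    proof (rule polyfuns_comp[OF R[OF that],
          where g = "\<lambda>z. case_sum (z \<circ> Inl) (\<lambda>j. if j < i then z (Inr j) else 0)"])
      fix v assume "v \<in> {()} <+> {1..n}"
      then show "(\<lambda>z :: unit + nat \<Rightarrow> 'a. case_sum (z \<circ> Inl) (\<lambda>j. if j < i then z (Inr j) else 0) v)
          \<in> polyfuns ({()} <+> {1..<i})"
        by (cases "\<exists>j. v = Inr j \<and> j < i") (auto intro!: polyfuns.const polyfuns.var)
    qed
    moreover have "Q i = (\<lambda>z. R i (case_sum (z \<circ> Inl) (\<lambda>j. if j < i then z (Inr j) else 0)))"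
      by (rule ext) (rule Q_def)
    ultimately show ?thesis by (simp only:)
  qed
  define trunc where "trunc i x = (\<lambda>j\<in>{1..n}. if j < i then x j else 0)" for i and x :: "nat \<Rightarrow> 'a"
  have trunc: "trunc i x \<in> ?S" for i x unfolding trunc_def by (rule restrict_in_affine_space)
  define E where "E i = (\<lambda>j\<in>{1..n}. if j = i then 1 else 0 :: 'a)" for i
  have E: "E i \<in> ?S" for i unfolding E_def by (rule restrict_in_affine_space)
  have \<theta>_Q: "\<theta> t (trunc i x) i = Q i (case_sum (\<lambda>_. t) x)" if "i \<in> {1..n}" for t x i
    unfolding \<theta>_R[OF that trunc] Q_def
    by (rule polyfuns_cong[OF R[OF that]]) (auto simp: trunc_def)
  have diag: "\<exists>c. c \<noteq> 0 \<and> (\<forall>x\<in>?S. \<theta> t x i = c * x i + Q i (case_sum (\<lambda>_. t) x))"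
    if i: "i \<in> {1..n}" for t i
  proof -
    have "\<theta> t \<in> U" using \<theta> by blast
    then have "triangular_automorphism n (\<theta> t)"
      using tri by (simp add: triangular_subgroup_def)
    then obtain c h where c: "c \<noteq> 0" and h: "h \<in> polynomials_in {1..<i}"
      and eq: "\<forall>x\<in>?S. \<theta> t x i = c * x i + mpoly_eval x h"
      using i unfolding triangular_automorphism_def by blast
    have h': "(\<lambda>x. mpoly_eval x h) \<in> polyfuns {1..<i}"
      using h by (auto simp: polyfuns_eq_mpoly_eval)
    have "\<theta> t x i = c * x i + Q i (case_sum (\<lambda>_. t) x)" if "x \<in> ?S" for x
    proof -
      have "mpoly_eval x h = mpoly_eval (trunc i x) h"
        by (rule polyfuns_cong[OF h']) (use i in \<open>auto simp: trunc_def\<close>)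
      also have "\<dots> = \<theta> t (trunc i x) i"
        using bspec[OF eq trunc[of i x]] i by (simp add: trunc_def)
      finally show ?thesis using eq that \<theta>_Q[OF i] by simp
    qed
    then show ?thesis using c by blast
  qed
  have "\<theta> t x i = x i + Q i (case_sum (\<lambda>_. t) x)" if i: "i \<in> {1..n}" and x: "x \<in> ?S" for t x i
  proof -
    obtain c where c: "\<And>t. c t \<noteq> 0"
      "\<And>t x. x \<in> ?S \<Longrightarrow> \<theta> t x i = c t * x i + Q i (case_sum (\<lambda>_. t) x)"
      using diag[OF i] by metis
    have "Q i (case_sum (\<lambda>_. t) (E i)) = Q i (case_sum (\<lambda>_. t) (trunc 0 x))" for t x
      by (rule polyfuns_cong[OF Q[OF i]]) (use i in \<open>auto simp: E_def trunc_def\<close>)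
    \<comment> \<open>The diagonal entry is the difference of the \<open>i\<close>-th coordinates of
      the images of the unit point \<open>E i\<close> and of the origin, which is
      \<open>trunc 0 x\<close>.\<close>
    then have c_eq: "c t = \<theta> t (E i) i - \<theta> t (trunc 0 x) i" for t
      using c(2)[OF E[of i], of t] c(2)[OF trunc[of 0 x], of t] i by (simp add: E_def trunc_def)
    have lin: "case_sum (\<lambda>_. t) y =
        (\<lambda>v. case_sum (\<lambda>_. 0) y v + t * case_sum (\<lambda>_. 1) (\<lambda>_. 0) v)" for t and y :: "nat \<Rightarrow> 'a"
      by (auto simp: fun_eq_iff split: sum.split)
    have poly: "\<exists>P. \<forall>t. \<theta> t y i = poly P t" if "y \<in> ?S" for y
      using polyfuns_line[OF R[OF i], of "case_sum (\<lambda>_. 0) y" "case_sum (\<lambda>_. 1) (\<lambda>_. 0)"]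
      unfolding \<theta>_R[OF i that] lin[symmetric] .
    obtain P1 where P1: "\<forall>t. \<theta> t (E i) i = poly P1 t" using poly[OF E] by blast
    obtain P2 where P2: "\<forall>t. \<theta> t (trunc 0 x) i = poly P2 t" using poly[OF trunc] by blast
    have c_poly: "c t = poly (P1 - P2) t" for t using c_eq P1 P2 by simp
    \<comment> \<open>Some parameter gives the identity, because \<open>\<theta>\<close> maps onto
      the subgroup \<open>U\<close>; there the diagonal entry is 1.\<close>
    obtain t0 where t0: "\<theta> t0 = \<one>\<^bsub>Aut_affine n\<^esub>"
      using \<theta> subgroup.one_closed[OF subU] by (metis rangeE)
    have "c t0 = 1"
      unfolding c_eq t0 Aut_affine_one restrict_apply'[OF E] restrict_apply'[OF trunc]
      using i by (simp add: E_def trunc_def)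
    moreover have "poly (P1 - P2) u \<noteq> 0" for u
      using c(1)[of u] c_poly[of u] by simp
    then have "c t = c t0"
      unfolding c_poly by (rule nonvanishing_poly_constant)
    ultimately show ?thesis using c(2)[OF x, of t] by simp
  qed
  then show ?thesis using \<theta> Q by (intro exI[of _ \<theta>] exI[of _ Q] conjI ballI allI)
qed


section \<open>Groups determined by values at finitely many points\<close>

declare One_nat_def [simp del]

text \<open>
  The coordinates of an automorphism \<open>\<phi>\<close> of the group \<open>H\<close> are the coordinates of the points \<open>\<phi> p\<close>,
  where \<open>p\<close> ranges over the nodes. In these coordinates the action and the product are given by the
  interpolation formula, without any mention of coefficients.
\<close>

locale interpolated_group =
  fixes n :: nat and H :: "((nat \<Rightarrow> 'a::alg_closed_field) \<Rightarrow> (nat \<Rightarrow> 'a)) set"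
    and P :: "(nat \<Rightarrow> 'a) set" and e :: "(nat \<Rightarrow> 'a) \<Rightarrow> (nat \<Rightarrow> 'a) \<Rightarrow> 'a"
  assumes sub: "subgroup H (Aut_affine n)"
    and finite_nodes: "finite P" and nodes: "P \<subseteq> affine_nspace n"
    and e: "\<And>p. p \<in> P \<Longrightarrow> e p \<in> polyfuns {1..n}"
    and interp: "\<And>\<phi> x i. \<phi> \<in> H \<Longrightarrow> x \<in> affine_nspace n \<Longrightarrow> i \<in> {1..n} \<Longrightarrow>
      \<phi> x i = (\<Sum>p\<in>P. \<phi> p i * e p x)"
    and unitri: "\<And>\<phi> i. \<phi> \<in> H \<Longrightarrow> i \<in> {1..n} \<Longrightarrow>
      \<exists>h\<in>polyfuns {1..<i}. \<forall>x\<in>affine_nspace n. \<phi> x i = x i + h x"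
begin

sublocale A: group "Aut_affine n :: ((nat \<Rightarrow> 'a) \<Rightarrow> nat \<Rightarrow> 'a) monoid"
  by (rule group_Aut_affine)

abbreviation "S \<equiv> affine_nspace n :: (nat \<Rightarrow> 'a) set"
abbreviation "A \<equiv> Aut_affine n :: ((nat \<Rightarrow> 'a) \<Rightarrow> nat \<Rightarrow> 'a) monoid"

definition m :: nat where
  "m = card ({1..n} \<times> P)"

text \<open>Algebraic groups have coordinates numbered from 1 to \<open>m\<close>, whereas the
  natural index here is a pair of a component and an interpolation point; \<open>node\<close> fixes
  a numbering of these pairs and \<open>entry\<close> inverts it.\<close>

definition node :: "nat \<Rightarrow> nat \<times> (nat \<Rightarrow> 'a)" where
  "node = (SOME \<beta>. bij_betw \<beta> {1..m} ({1..n} \<times> P))"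

definition entry :: "nat \<Rightarrow> (nat \<Rightarrow> 'a) \<Rightarrow> nat" where
  "entry i p = inv_into {1..m} node (i, p)"

definition coords :: "((nat \<Rightarrow> 'a) \<Rightarrow> (nat \<Rightarrow> 'a)) \<Rightarrow> nat \<Rightarrow> 'a" where
  "coords \<phi> = (\<lambda>k\<in>{1..m}. \<phi> (snd (node k)) (fst (node k)))"

text \<open>The interpolation formula makes sense for every vector \<open>a\<close>, whether or not
  it comes from an element of \<open>H\<close>. Hence \<open>act\<close> and \<open>prod\<close> can
  be evaluated on the closure of the group too.\<close>

definition act :: "(nat \<Rightarrow> 'a) \<Rightarrow> (nat \<Rightarrow> 'a) \<Rightarrow> nat \<Rightarrow> 'a" where
  "act a x = (\<lambda>i\<in>{1..n}. \<Sum>p\<in>P. a (entry i p) * e p x)"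

definition prod :: "(nat \<Rightarrow> 'a) \<Rightarrow> (nat \<Rightarrow> 'a) \<Rightarrow> nat \<Rightarrow> 'a" where
  "prod a b = (\<lambda>k\<in>{1..m}. act a (act b (snd (node k))) (fst (node k)))"

lemma bij_node: "bij_betw node {1..m} ({1..n} \<times> P)"
proof -
  have "\<exists>\<beta>. bij_betw \<beta> {1..m} ({1..n} \<times> P)"
    unfolding m_def by (rule ex_bij_betw_nat_finite_1) (simp add: finite_nodes)
  then show ?thesis unfolding node_def by (rule someI_ex)
qed

lemma node:
  assumes "k \<in> {1..m}"
  shows "fst (node k) \<in> {1..n}" "snd (node k) \<in> P" "snd (node k) \<in> S"
proof -
  have "node k \<in> {1..n} \<times> P" using bij_betw_apply[OF bij_node assms] .
  then show "fst (node k) \<in> {1..n}" "snd (node k) \<in> P" by (simp_all add: mem_Times_iff)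
  then show "snd (node k) \<in> S" using nodes by blast
qed

lemma entry:
  assumes "i \<in> {1..n}" "p \<in> P"
  shows "entry i p \<in> {1..m}" "node (entry i p) = (i, p)"
proof -
  have ip: "(i, p) \<in> {1..n} \<times> P" using assms by simp
  show "entry i p \<in> {1..m}"
    unfolding entry_def by (rule bij_betw_apply[OF bij_betw_inv_into[OF bij_node] ip])
  show "node (entry i p) = (i, p)"
    unfolding entry_def by (rule bij_betw_inv_into_right[OF bij_node ip])
qed

lemma H_carrier: "\<phi> \<in> H \<Longrightarrow> \<phi> \<in> carrier A"
  using subgroup.mem_carrier[OF sub] .

lemma H_closed:
  assumes "\<phi> \<in> H" "x \<in> S"
  shows "\<phi> x \<in> S"
  using Aut_affine_closed[OF H_carrier[OF assms(1)] assms(2)] .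

lemma H_mult_apply:
  assumes "\<phi> \<in> H" "\<psi> \<in> H" "x \<in> S"
  shows "(\<phi> \<otimes>\<^bsub>A\<^esub> \<psi>) x = \<phi> (\<psi> x)"
  using Aut_affine_mult_apply[OF H_carrier[OF assms(1)] H_carrier[OF assms(2)] assms(3)] .

lemmas H_mult = subgroup.m_closed[OF sub]
  and H_inv = subgroup.m_inv_closed[OF sub]
  and H_one = subgroup.one_closed[OF sub]

lemma affine_eqI:
  "x \<in> affine_space I \<Longrightarrow> y \<in> affine_space I \<Longrightarrow> (\<And>i. i \<in> I \<Longrightarrow> x i = y i) \<Longrightarrow> x = y"
  unfolding affine_space_def by (rule PiE_ext)

lemma coords_affine: "coords \<phi> \<in> affine_space {1..m}"
  unfolding coords_def by (rule restrict_in_affine_space)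

lemma act_affine: "act a x \<in> S"
  unfolding act_def by (rule restrict_in_affine_space)

lemma prod_affine: "prod a b \<in> affine_space {1..m}"
  unfolding prod_def by (rule restrict_in_affine_space)

lemma act_coords:
  assumes "\<phi> \<in> H" "x \<in> S"
  shows "act (coords \<phi>) x = \<phi> x"
proof (rule affine_eqI[OF act_affine H_closed[OF assms]])
  fix i assume i: "i \<in> {1..n}"
  have "coords \<phi> (entry i p) = \<phi> p i" if "p \<in> P" for p
    using entry[OF i that] by (simp add: coords_def)
  then show "act (coords \<phi>) x i = \<phi> x i"
    using i interp[OF assms i] by (simp add: act_def)
qed

lemma coords_mult:
  assumes "\<phi> \<in> H" "\<psi> \<in> H"
  shows "coords (\<phi> \<otimes>\<^bsub>A\<^esub> \<psi>) = prod (coords \<phi>) (coords \<psi>)"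
proof (rule affine_eqI[OF coords_affine prod_affine])
  fix k assume k: "k \<in> {1..m}"
  note s = node(3)[OF k]
  show "coords (\<phi> \<otimes>\<^bsub>A\<^esub> \<psi>) k = prod (coords \<phi>) (coords \<psi>) k"
    using k by (simp add: coords_def[of "\<phi> \<otimes>\<^bsub>A\<^esub> \<psi>"] prod_def H_mult_apply[OF assms s]
      act_coords[OF assms(2) s] act_coords[OF assms(1) H_closed[OF assms(2) s]])
qed

lemma inj_coords: "inj_on coords H"
proof (rule inj_onI)
  fix \<phi> \<psi> assume \<phi>: "\<phi> \<in> H" and \<psi>: "\<psi> \<in> H" and eq: "coords \<phi> = coords \<psi>"
  show "\<phi> = \<psi>"
  proof (rule Aut_affine_eqI[OF H_carrier[OF \<phi>] H_carrier[OF \<psi>]])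
    show "\<phi> x i = \<psi> x i" if "x \<in> S" for x i
      unfolding act_coords[OF \<phi> that, symmetric] act_coords[OF \<psi> that, symmetric] eq ..
  qed
qed

lemma act_polyfuns:
  assumes a: "\<And>k. k \<in> {1..m} \<Longrightarrow> (\<lambda>z. a z k) \<in> polyfuns L"
    and x: "\<And>i. i \<in> {1..n} \<Longrightarrow> (\<lambda>z. x z i) \<in> polyfuns L" and i: "i \<in> {1..n}"
  shows "(\<lambda>z. act (a z) (x z) i) \<in> polyfuns L"
proof -
  have "(\<lambda>z. \<Sum>p\<in>P. a z (entry i p) * e p (x z)) \<in> polyfuns L"
  proof (intro polyfuns_sum polyfuns.mult)
    fix p assume p: "p \<in> P"
    show "(\<lambda>z. a z (entry i p)) \<in> polyfuns L" by (rule a[OF entry(1)[OF i p]])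
    show "(\<lambda>z. e p (x z)) \<in> polyfuns L" by (rule polyfuns_comp[OF e[OF p] x])
  qed
  then show ?thesis using i by (simp add: act_def)
qed

lemma prod_polyfuns:
  assumes a: "\<And>k. k \<in> {1..m} \<Longrightarrow> (\<lambda>z. a z k) \<in> polyfuns L"
    and b: "\<And>k. k \<in> {1..m} \<Longrightarrow> (\<lambda>z. b z k) \<in> polyfuns L" and k: "k \<in> {1..m}"
  shows "(\<lambda>z. prod (a z) (b z) k) \<in> polyfuns L"
proof -
  have "(\<lambda>z. act (a z) (act (b z) (snd (node k))) (fst (node k))) \<in> polyfuns L"
  proof (rule act_polyfuns[where a = a and x = "\<lambda>z. act (b z) (snd (node k))", OF a _ node(1)[OF k]])
    fix i assume i: "i \<in> {1..n}"
    show "(\<lambda>z. act (b z) (snd (node k)) i) \<in> polyfuns L"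
      by (rule act_polyfuns[where a = b and x = "\<lambda>_. snd (node k)", OF b polyfuns.const i])
  qed
  then show ?thesis using k by (simp add: prod_def)
qed

text \<open>
  The value \<open>x\<close> at \<open>y\<close> of the inverse of \<open>\<phi>\<close> is found coordinate by coordinate, since
  \<open>y\<^sub>i - x\<^sub>i = \<phi> (x\<^sub>1, \<dots>, x\<^bsub>i-1\<^esub>, 0, \<dots>, 0)\<^sub>i\<close>.
\<close>

lemma inverse_polyfuns:
  assumes "i \<in> {1..n}"
  shows "\<exists>r\<in>polyfuns ({1..m} <+> {1..n}). \<forall>\<phi>\<in>H. \<forall>y\<in>S. (inv\<^bsub>A\<^esub> \<phi>) y i = r (case_sum (coords \<phi>) y)"
  using assms
proof (induction i rule: less_induct)
  case (less i)
  have "\<forall>j\<in>{1..<i}. \<exists>r. r \<in> polyfuns ({1..m} <+> {1..n}) \<and>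
      (\<forall>\<phi>\<in>H. \<forall>y\<in>S. (inv\<^bsub>A\<^esub> \<phi>) y j = r (case_sum (coords \<phi>) y))"
  proof
    fix j assume "j \<in> {1..<i}"
    then have "j < i" "j \<in> {1..n}" using less.prems by auto
    then show "\<exists>r. r \<in> polyfuns ({1..m} <+> {1..n}) \<and>
        (\<forall>\<phi>\<in>H. \<forall>y\<in>S. (inv\<^bsub>A\<^esub> \<phi>) y j = r (case_sum (coords \<phi>) y))"
      by (rule less.IH[unfolded Bex_def])
  qed
  from bchoice[OF this] obtain r where r: "\<forall>j\<in>{1..<i}. r j \<in> polyfuns ({1..m} <+> {1..n}) \<and>
      (\<forall>\<phi>\<in>H. \<forall>y\<in>S. (inv\<^bsub>A\<^esub> \<phi>) y j = r j (case_sum (coords \<phi>) y))" ..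
  \<comment> \<open>The coordinates of the inverse value that are already known, with 0 from
    position \<open>i\<close> on. As \<open>h\<close> reads only positions below \<open>i\<close>,
    it takes the same value here as at the inverse value.\<close>
  define x0 where "x0 z = (\<lambda>j\<in>{1..n}. if j < i then r j z else 0)" for z
  let ?r = "\<lambda>z. z (Inr i) - act (z \<circ> Inl) (x0 z) i"
  have x0: "(\<lambda>z. x0 z j) \<in> polyfuns ({1..m} <+> {1..n})" if "j \<in> {1..n}" for j
    using r that by (cases "j < i") (auto simp: x0_def intro!: polyfuns.const)
  have "?r \<in> polyfuns ({1..m} <+> {1..n})"
    by (intro polyfuns_diff polyfuns.var act_polyfuns[where a = "\<lambda>z. z \<circ> Inl" and x = x0])
      (use less.prems x0 in \<open>auto intro: polyfuns.var\<close>)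
  moreover have "(inv\<^bsub>A\<^esub> \<phi>) y i = ?r (case_sum (coords \<phi>) y)" if \<phi>: "\<phi> \<in> H" and y: "y \<in> S" for \<phi> y
  proof -
    let ?z = "case_sum (coords \<phi>) y" and ?x = "(inv\<^bsub>A\<^esub> \<phi>) y"
    have x: "?x \<in> S" using H_closed[OF H_inv[OF \<phi>] y] .
    have "\<phi> ?x = (\<phi> \<otimes>\<^bsub>A\<^esub> inv\<^bsub>A\<^esub> \<phi>) y" using H_mult_apply[OF \<phi> H_inv[OF \<phi>] y] by simp
    then have \<phi>x: "\<phi> ?x = y" using H_carrier[OF \<phi>] y by (simp add: Aut_affine_one)
    obtain h where h: "h \<in> polyfuns {1..<i}" "\<forall>x\<in>S. \<phi> x i = x i + h x"
      using unitri[OF \<phi> less.prems] by blast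
    have z0: "x0 ?z \<in> S" unfolding x0_def by (rule restrict_in_affine_space)
    have "h ?x = h (x0 ?z)"
      by (rule polyfuns_cong[OF h(1)]) (use r \<phi> y less.prems in \<open>auto simp: x0_def\<close>)
    moreover have "\<phi> (x0 ?z) i = h (x0 ?z)"
      using bspec[OF h(2) z0] less.prems by (simp add: x0_def)
    moreover have "y i = ?x i + h ?x" using bspec[OF h(2) x] by (simp add: \<phi>x)
    moreover have "?z \<circ> Inl = coords \<phi>" by (simp add: fun_eq_iff)
    ultimately show ?thesis using act_coords[OF \<phi> z0] by simp
  qed
  ultimately show ?case by (intro bexI[of _ ?r] ballI)
qed

definition inverse_polys :: "nat \<Rightarrow> (nat + nat \<Rightarrow> 'a) \<Rightarrow> 'a" where
  "inverse_polys = (SOME r. \<forall>i\<in>{1..n}. r i \<in> polyfuns ({1..m} <+> {1..n}) \<and>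
    (\<forall>\<phi>\<in>H. \<forall>y\<in>S. (inv\<^bsub>A\<^esub> \<phi>) y i = r i (case_sum (coords \<phi>) y)))"

lemma inverse_polys:
  assumes "i \<in> {1..n}"
  shows "inverse_polys i \<in> polyfuns ({1..m} <+> {1..n})"
    and "\<And>\<phi> y. \<phi> \<in> H \<Longrightarrow> y \<in> S \<Longrightarrow> (inv\<^bsub>A\<^esub> \<phi>) y i = inverse_polys i (case_sum (coords \<phi>) y)"
proof -
  have "\<forall>i\<in>{1..n}. \<exists>r. r \<in> polyfuns ({1..m} <+> {1..n}) \<and>
    (\<forall>\<phi>\<in>H. \<forall>y\<in>S. (inv\<^bsub>A\<^esub> \<phi>) y i = r (case_sum (coords \<phi>) y))"
    by (intro ballI inverse_polyfuns[unfolded Bex_def])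
  from someI_ex[OF bchoice[OF this], folded inverse_polys_def] assms
  have *: "inverse_polys i \<in> polyfuns ({1..m} <+> {1..n}) \<and>
    (\<forall>\<phi>\<in>H. \<forall>y\<in>S. (inv\<^bsub>A\<^esub> \<phi>) y i = inverse_polys i (case_sum (coords \<phi>) y))"
    by blast
  then show "inverse_polys i \<in> polyfuns ({1..m} <+> {1..n})" by blast
  show "(inv\<^bsub>A\<^esub> \<phi>) y i = inverse_polys i (case_sum (coords \<phi>) y)" if "\<phi> \<in> H" "y \<in> S" for \<phi> y
    using * that by blast
qed

definition inverse_coords :: "(nat \<Rightarrow> 'a) \<Rightarrow> nat \<Rightarrow> 'a" where
  "inverse_coords a = (\<lambda>k\<in>{1..m}. inverse_polys (fst (node k)) (case_sum a (snd (node k))))"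

lemma inverse_coords_affine: "inverse_coords a \<in> affine_space {1..m}"
  unfolding inverse_coords_def by (rule restrict_in_affine_space)

lemma coords_inv:
  assumes "\<phi> \<in> H"
  shows "coords (inv\<^bsub>A\<^esub> \<phi>) = inverse_coords (coords \<phi>)"
proof (rule affine_eqI[OF coords_affine inverse_coords_affine])
  fix k assume k: "k \<in> {1..m}"
  then show "coords (inv\<^bsub>A\<^esub> \<phi>) k = inverse_coords (coords \<phi>) k"
    using inverse_polys(2)[OF node(1)[OF k] assms node(3)[OF k]]
    by (simp add: coords_def[of "inv\<^bsub>A\<^esub> \<phi>"] inverse_coords_def)
qed

lemma inverse_coords_polyfuns:
  assumes a: "\<And>k. k \<in> {1..m} \<Longrightarrow> (\<lambda>z. a z k) \<in> polyfuns L" and k: "k \<in> {1..m}"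
  shows "(\<lambda>z. inverse_coords (a z) k) \<in> polyfuns L"
proof -
  have "(\<lambda>z. inverse_polys (fst (node k)) (case_sum (a z) (snd (node k)))) \<in> polyfuns L"
    by (rule polyfuns_comp[OF inverse_polys(1)[OF node(1)[OF k]],
          where g = "\<lambda>z. case_sum (a z) (snd (node k))"]) (use a in \<open>auto intro: polyfuns.const\<close>)
  then show ?thesis using k by (simp add: inverse_coords_def)
qed

text \<open>\<open>zariski_closure\<close> constrains only the coordinates in \<open>{1..m}\<close>;
  the intersection fixes the others to \<open>undefined\<close>, so that these coordinates determine
  a point.\<close>

abbreviation "C \<equiv> zariski_closure {1..m} (coords ` H) \<inter> affine_space {1..m}"

section \<open>Extension of polynomial identities to the closure\<close>

lemma C_vanish: "w \<in> C \<Longrightarrow> q \<in> polyfuns {1..m} \<Longrightarrow> (\<And>\<phi>. \<phi> \<in> H \<Longrightarrow> q (coords \<phi>) = 0) \<Longrightarrow> q w = 0"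
  by (rule zariski_closureD[of w "{1..m}" "coords ` H"]) auto

text \<open>If \<open>q\<close> vanishes on the coordinates of \<open>H\<close>, so does its
  pullback along \<open>T\<close>, and then the pullback vanishes at \<open>w\<close>. Thus
  polynomial maps that preserve the group send its closure into itself.\<close>

lemma C_image:
  assumes w: "w \<in> C" and T: "\<And>k. k \<in> {1..m} \<Longrightarrow> (\<lambda>a. T a k) \<in> polyfuns {1..m}"
    and T_affine: "T w \<in> affine_space {1..m}" and TH: "\<And>\<phi>. \<phi> \<in> H \<Longrightarrow> T (coords \<phi>) \<in> coords ` H"
  shows "T w \<in> C"
proof -
  have "q (T w) = 0" if q: "q \<in> polyfuns {1..m}" "\<forall>x\<in>coords ` H. q x = 0" for q
  proof (rule C_vanish[OF w, where q = "\<lambda>a. q (T a)"])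
    show "(\<lambda>a. q (T a)) \<in> polyfuns {1..m}" by (rule polyfuns_comp[OF q(1) T])
  qed (use q(2) TH in blast)
  then show ?thesis using T_affine by (auto simp: zariski_closure_def)
qed

text \<open>The closure is not shown to be a group beforehand. Instead each identity wanted there is
  verified on \<open>H\<close> and extended, since the difference of the two sides is
  polynomial.\<close>

lemma C_eqI:
  assumes w: "w \<in> C" and T: "\<And>k. k \<in> {1..m} \<Longrightarrow> (\<lambda>a. T a k) \<in> polyfuns {1..m}"
    and T': "\<And>k. k \<in> {1..m} \<Longrightarrow> (\<lambda>a. T' a k) \<in> polyfuns {1..m}"
    and affine: "T w \<in> affine_space {1..m}" "T' w \<in> affine_space {1..m}"
    and TH: "\<And>\<phi>. \<phi> \<in> H \<Longrightarrow> T (coords \<phi>) = T' (coords \<phi>)"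
  shows "T w = T' w"
proof (rule affine_eqI[OF affine])
  fix k assume k: "k \<in> {1..m}"
  have "T w k - T' w k = 0"
    by (rule C_vanish[OF w, where q = "\<lambda>a. T a k - T' a k"])
      (use TH T[OF k] T'[OF k] in \<open>auto intro: polyfuns_diff\<close>)
  then show "T w k = T' w k" by simp
qed

lemma coords_in_C: "\<phi> \<in> H \<Longrightarrow> coords \<phi> \<in> C"
  using coords_affine by (auto simp: zariski_closure_def)

text \<open>
  Two translates of a dense open subset of the closure meet.
\<close>

lemma closed_if_contains_open:
  assumes b: "b \<in> polyfuns {1..m}" "\<phi>0 \<in> H" "b (coords \<phi>0) \<noteq> 0"
    and open_sub: "\<And>z. z \<in> C \<Longrightarrow> b z \<noteq> 0 \<Longrightarrow> z \<in> coords ` H"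
  shows "C = coords ` H"
proof (intro equalityI subsetI)
  note pf = prod_polyfuns inverse_coords_polyfuns polyfuns.var polyfuns.const
  fix w assume w: "w \<in> C"
  have right: "prod u (coords \<phi>) \<in> C" if "u \<in> C" "\<phi> \<in> H" for u \<phi>
    by (rule C_image[OF that(1), where T = "\<lambda>a. prod a (coords \<phi>)"])
      (use that(2) in \<open>auto intro!: pf prod_affine imageI H_mult simp: coords_mult[symmetric]\<close>)
  have inv_w: "inverse_coords w \<in> C"
    by (rule C_image[OF w]) (auto intro!: pf inverse_coords_affine imageI H_inv simp: coords_inv[symmetric])
  \<comment> \<open>Formally \<open>u\<close> is the inverse of \<open>w\<close> times
    \<open>\<phi>0\<close>, so that \<open>w\<close> times \<open>u\<close> is the point where
    \<open>b\<close> is known to be nonzero.\<close>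
  define u where "u = prod (inverse_coords w) (coords \<phi>0)"
  have u: "u \<in> C" unfolding u_def by (rule right[OF inv_w b(2)])
  have "prod w u = coords \<phi>0"
    unfolding u_def
    by (rule C_eqI[OF w, where T = "\<lambda>a. prod a (prod (inverse_coords a) (coords \<phi>0))"
          and T' = "\<lambda>_. coords \<phi>0"])
      (use b(2) in \<open>auto intro!: pf prod_affine coords_affine
        simp: coords_inv[symmetric] coords_mult[symmetric] A.m_assoc[symmetric] H_mult H_inv H_carrier\<close>)
  then have "b (prod w u) \<noteq> 0" using b(3) by simp
  moreover have "(\<lambda>a. b (prod w a)) \<in> polyfuns {1..m}"
    by (rule polyfuns_comp[OF b(1), where g = "\<lambda>a. prod w a"]) (auto intro!: pf)
  \<comment> \<open>The function \<open>b (prod w a)\<close> of \<open>a\<close> is nonzero at the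
    point \<open>u\<close> of the closure, hence also at some element \<open>\<phi>\<close> of
    \<open>H\<close>. Then \<open>w\<close> times \<open>\<phi>\<close> lies in the open set of
    elements of \<open>H\<close>, and dividing by \<open>\<phi>\<close> puts \<open>w\<close> into
    \<open>H\<close>.\<close>
  ultimately obtain \<phi> where \<phi>: "\<phi> \<in> H" "b (prod w (coords \<phi>)) \<noteq> 0"
    using C_vanish[OF u, of "\<lambda>a. b (prod w a)"] by blast
  then obtain \<psi> where \<psi>: "\<psi> \<in> H" "prod w (coords \<phi>) = coords \<psi>"
    using open_sub[OF right[OF w \<phi>(1)] \<phi>(2)] by blast
  have "prod (prod w (coords \<phi>)) (coords (inv\<^bsub>A\<^esub> \<phi>)) = w"
    by (rule C_eqI[OF w, where T = "\<lambda>a. prod (prod a (coords \<phi>)) (coords (inv\<^bsub>A\<^esub> \<phi>))" and T' = "\<lambda>a. a"])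
      (use w \<phi>(1) in \<open>auto intro!: pf prod_affine
        simp: coords_mult[symmetric] A.m_assoc H_mult H_inv H_carrier\<close>)
  then have "w = coords (\<psi> \<otimes>\<^bsub>A\<^esub> inv\<^bsub>A\<^esub> \<phi>)"
    using \<psi> \<phi>(1) by (simp add: coords_mult H_inv)
  then show "w \<in> coords ` H" using \<psi>(1) \<phi>(1) by (auto intro!: imageI H_mult H_inv)
next
  show "\<And>w. w \<in> coords ` H \<Longrightarrow> w \<in> C" using coords_in_C by blast
qed

section \<open>The algebraic group on the coordinates and its unipotence\<close>

definition coord_group :: "(nat \<Rightarrow> 'a) monoid" where
  "coord_group = \<lparr>carrier = coords ` H, monoid.mult = prod, monoid.one = coords \<one>\<^bsub>A\<^esub>\<rparr>"

lemma coord_group_simps [simp]: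
  "carrier coord_group = coords ` H"
  "a \<otimes>\<^bsub>coord_group\<^esub> b = prod a b"
  "\<one>\<^bsub>coord_group\<^esub> = coords \<one>\<^bsub>A\<^esub>"
  by (simp_all add: coord_group_def)

lemma group_coord_group: "group coord_group"
proof (rule groupI)
  fix x assume "x \<in> carrier coord_group"
  then obtain \<phi> where \<phi>: "\<phi> \<in> H" "x = coords \<phi>" by auto
  then show "\<exists>y\<in>carrier coord_group. y \<otimes>\<^bsub>coord_group\<^esub> x = \<one>\<^bsub>coord_group\<^esub>"
    by (intro bexI[of _ "coords (inv\<^bsub>A\<^esub> \<phi>)"])
      (simp_all add: coords_mult[symmetric] H_inv H_carrier)
next
  show "x \<otimes>\<^bsub>coord_group\<^esub> y \<in> carrier coord_group"
    if "x \<in> carrier coord_group" "y \<in> carrier coord_group" for x y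
    using that by (auto simp: coords_mult[symmetric] H_mult)
  show "x \<otimes>\<^bsub>coord_group\<^esub> y \<otimes>\<^bsub>coord_group\<^esub> z = x \<otimes>\<^bsub>coord_group\<^esub> (y \<otimes>\<^bsub>coord_group\<^esub> z)"
    if xyz: "x \<in> carrier coord_group" "y \<in> carrier coord_group" "z \<in> carrier coord_group" for x y z
  proof -
    from xyz obtain \<phi> \<psi> \<chi> where "\<phi> \<in> H" "\<psi> \<in> H" "\<chi> \<in> H" "x = coords \<phi>" "y = coords \<psi>" "z = coords \<chi>"
      by auto
    then show ?thesis by (simp add: coords_mult[symmetric] H_mult A.m_assoc H_carrier)
  qed
  show "\<one>\<^bsub>coord_group\<^esub> \<otimes>\<^bsub>coord_group\<^esub> x = x" if x: "x \<in> carrier coord_group" for x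
  proof -
    from x obtain \<phi> where "\<phi> \<in> H" "x = coords \<phi>" by auto
    then show ?thesis by (simp add: coords_mult[symmetric] H_one H_carrier)
  qed
qed (simp add: H_one)

lemma inv_coord_group: "\<phi> \<in> H \<Longrightarrow> inv\<^bsub>coord_group\<^esub> (coords \<phi>) = coords (inv\<^bsub>A\<^esub> \<phi>)"
  by (rule group.inv_equality[OF group_coord_group])
    (simp_all add: coords_mult[symmetric] H_inv H_carrier)

lemma affine_algebraic_coord_group:
  assumes closed: "C = coords ` H"
  shows "affine_algebraic_group m coord_group"
  unfolding affine_algebraic_group_def
proof (intro conjI)
  show "group coord_group" by (rule group_coord_group)
  have "zariski_closed {1..m} C"
    by (rule zariski_closedI[where S = "{p \<in> polyfuns {1..m}. \<forall>x\<in>coords ` H. p x = 0}"])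
      (auto simp: zariski_closure_def)
  then show "zariski_closed {1..m} (carrier coord_group)" by (simp only: closed coord_group_simps)
  show "variety_morphism ({1..m} <+> {1..m})
     (variety_product (carrier coord_group) (carrier coord_group)) {1..m} (carrier coord_group)
     (\<lambda>z. (z \<circ> Inl) \<otimes>\<^bsub>coord_group\<^esub> (z \<circ> Inr))"
    unfolding variety_morphism_affine_iff
  proof (intro conjI ballI)
    fix k assume k: "k \<in> {1..m}"
    have "(\<lambda>z. prod (z \<circ> Inl) (z \<circ> Inr) k) \<in> polyfuns ({1..m} <+> {1..m})"
      by (rule prod_polyfuns[OF _ _ k, where a = "\<lambda>z. z \<circ> Inl" and b = "\<lambda>z. z \<circ> Inr"])
        (auto intro: polyfuns.var)
    then show "\<exists>p\<in>polyfuns ({1..m} <+> {1..m}).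
        \<forall>z\<in>variety_product (carrier coord_group) (carrier coord_group).
          ((z \<circ> Inl) \<otimes>\<^bsub>coord_group\<^esub> (z \<circ> Inr)) k = p z"
      by (rule bexI[rotated]) simp
  qed (auto simp: variety_product_def comp_def coords_mult[symmetric] H_mult)
  show "variety_morphism {1..m} (carrier coord_group) {1..m} (carrier coord_group)
     (\<lambda>x. inv\<^bsub>coord_group\<^esub> x)"
    unfolding variety_morphism_affine_iff
  proof (intro conjI ballI)
    fix k assume k: "k \<in> {1..m}"
    have "(\<lambda>z. inverse_coords z k) \<in> polyfuns {1..m}"
      by (rule inverse_coords_polyfuns[OF polyfuns.var k])
    then show "\<exists>p\<in>polyfuns {1..m}. \<forall>x\<in>carrier coord_group. (inv\<^bsub>coord_group\<^esub> x) k = p x"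
      by (rule bexI[rotated]) (auto simp: inv_coord_group coords_inv)
  qed (auto simp: inv_coord_group H_inv)
qed

lemma algebraic_structure_coord_group:
  assumes closed: "C = coords ` H"
  shows "algebraic_structure n H m coord_group (inv_into H coords)"
  unfolding algebraic_structure_def
proof (intro conjI)
  have inv: "inv_into H coords (coords \<phi>) = \<phi>" if "\<phi> \<in> H" for \<phi>
    using inj_coords that by simp
  show "subgroup H (Aut_affine n)" by (rule sub)
  show "affine_algebraic_group m coord_group" by (rule affine_algebraic_coord_group[OF closed])
  have "bij_betw (inv_into H coords) (coords ` H) H"
    by (rule bij_betw_inv_into) (simp add: inj_coords bij_betw_def)
  then show "inv_into H coords \<in> iso coord_group (Aut_affine n\<lparr>carrier := H\<rparr>)"
    by (auto simp: iso_def hom_def inv H_mult coords_mult[symmetric])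
  show "variety_morphism ({1..m} <+> {1..n}) (variety_product (carrier coord_group) S) {1..n} S
      (\<lambda>z. inv_into H coords (z \<circ> Inl) (z \<circ> Inr))"
    unfolding variety_morphism_affine_iff
  proof (intro conjI ballI)
    fix i assume i: "i \<in> {1..n}"
    have "(\<lambda>z. act (z \<circ> Inl) (z \<circ> Inr) i) \<in> polyfuns ({1..m} <+> {1..n})"
      by (rule act_polyfuns[OF _ _ i, where a = "\<lambda>z. z \<circ> Inl" and x = "\<lambda>z. z \<circ> Inr"])
        (auto intro: polyfuns.var)
    then show "\<exists>p\<in>polyfuns ({1..m} <+> {1..n}). \<forall>z\<in>variety_product (carrier coord_group) S.
        inv_into H coords (z \<circ> Inl) (z \<circ> Inr) i = p z"
      by (rule bexI[rotated]) (auto simp: variety_product_def comp_def inv act_coords)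
  qed (auto simp: variety_product_def comp_def inv H_closed)
qed

text \<open>Right translation by \<open>\<gamma>\<close> turns the entry \<open>\<phi>(p)_i\<close>
  into \<open>\<phi>(\<gamma>(p))_i\<close>, so differences on the group become differences along
  \<open>\<gamma>\<close> on affine space. The induction replaces \<open>\<phi>\<close> by its
  product with \<open>\<gamma>\<close> and so needs \<open>\<phi>\<close> arbitrary.\<close>

lemma difference_coords:
  assumes \<gamma>: "\<gamma> \<in> H" and k: "k \<in> {1..m}" and "\<phi> \<in> H"
  shows "(difference (\<lambda>x. prod x (coords \<gamma>)) ^^ l) (\<lambda>x. x k) (coords \<phi>) =
    (difference \<gamma> ^^ l) (\<lambda>y. \<phi> y (fst (node k))) (snd (node k))"
  using assms(3)
proof (induction l arbitrary: \<phi>)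
  case 0
  show ?case unfolding coords_def using k by simp
next
  case (Suc l)
  let ?i = "fst (node k)" and ?p = "snd (node k)"
  have \<gamma>S: "\<gamma> \<in> S \<rightarrow> S" by (intro funcsetI H_closed[OF \<gamma>])
  have "(difference (\<lambda>x. prod x (coords \<gamma>)) ^^ Suc l) (\<lambda>x. x k) (coords \<phi>) =
      (difference \<gamma> ^^ l) (\<lambda>y. (\<phi> \<otimes>\<^bsub>A\<^esub> \<gamma>) y ?i) ?p - (difference \<gamma> ^^ l) (\<lambda>y. \<phi> y ?i) ?p"
    unfolding difference_Suc coords_mult[OF Suc.prems \<gamma>, symmetric]
    unfolding Suc.IH[OF H_mult[OF Suc.prems \<gamma>]] Suc.IH[OF Suc.prems] ..
  also have "\<dots> = (difference \<gamma> ^^ l) (\<lambda>y. (\<phi> \<otimes>\<^bsub>A\<^esub> \<gamma>) y ?i - \<phi> y ?i) ?p"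
    by (rule difference_diff[symmetric])
  also have "\<dots> = (difference \<gamma> ^^ l) (difference \<gamma> (\<lambda>y. \<phi> y ?i)) ?p"
    by (rule difference_cong[OF \<gamma>S])
      (use H_mult_apply[OF Suc.prems \<gamma>] node(3)[OF k] in \<open>auto simp: difference_def\<close>)
  also have "\<dots> = (difference \<gamma> ^^ Suc l) (\<lambda>y. \<phi> y ?i) ?p"
    by (simp only: funpow_Suc_right comp_apply)
  finally show ?case .
qed

text \<open>The exponent must not depend on \<open>\<phi>\<close>. By interpolation every component
  of \<open>\<phi>\<close> is a combination of the finitely many functions \<open>e p\<close> with
  constant coefficients, so an exponent that kills all \<open>e p\<close> works for the whole
  group.\<close>

lemma coordinate_nilpotent:
  assumes \<gamma>: "\<gamma> \<in> H" and k: "k \<in> {1..m}"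
  shows "(\<lambda>x. x k) \<in> nilpotent_functions (\<lambda>x. prod x (coords \<gamma>)) (coords ` H)"
proof -
  have \<gamma>S: "\<gamma> \<in> S \<rightarrow> S" by (intro funcsetI H_closed[OF \<gamma>])
  have "\<forall>p\<in>P. \<exists>l. \<forall>x\<in>S. (difference \<gamma> ^^ l) (e p) x = 0"
    using nilpotent_functions_unitriangular[OF \<gamma>S unitri[OF \<gamma>] e]
    unfolding nilpotent_functions_def by blast
  from bchoice[OF this] obtain l where l: "\<forall>p\<in>P. \<forall>x\<in>S. (difference \<gamma> ^^ l p) (e p) x = 0" ..
  define L where "L = (\<Sum>p\<in>P. l p)"
  have e0: "(difference \<gamma> ^^ L) (e p) x = 0" if "p \<in> P" "x \<in> S" for p x
    by (rule difference_vanish_mono[OF \<gamma>S, of "l p"])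
      (use l that finite_nodes in \<open>auto simp: L_def intro: member_le_sum\<close>)
  have "(difference (\<lambda>x. prod x (coords \<gamma>)) ^^ L) (\<lambda>x. x k) (coords \<phi>) = 0" if \<phi>: "\<phi> \<in> H" for \<phi>
  proof -
    let ?i = "fst (node k)"
    have "(difference \<gamma> ^^ L) (\<lambda>y. \<phi> y ?i) (snd (node k)) =
        (difference \<gamma> ^^ L) (\<lambda>y. \<Sum>p\<in>P. \<phi> p ?i * e p y) (snd (node k))"
      by (rule difference_cong[OF \<gamma>S]) (use interp[OF \<phi>] node[OF k] in auto)
    also have "\<dots> = (\<Sum>p\<in>P. \<phi> p ?i * (difference \<gamma> ^^ L) (e p) (snd (node k)))"
      by (simp add: difference_sum difference_mult_const)
    also have "\<dots> = 0" using e0 node(3)[OF k] by simp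
    finally show ?thesis using difference_coords[OF \<gamma> k \<phi>] by simp
  qed
  then show ?thesis unfolding nilpotent_functions_def by blast
qed

text \<open>On the carrier, the operator in \<open>unipotent_element\<close> is the difference along
  right translation, applied to a polynomial \<open>p\<close> that represents \<open>f\<close>.
  Polynomials in nilpotent coordinate functions are nilpotent.\<close>

lemma unipotent_coord_group:
  assumes "g \<in> carrier coord_group"
  shows "unipotent_element m coord_group g"
  unfolding unipotent_element_def
proof
  fix f assume f: "f \<in> coordinate_ring {1..m} (carrier coord_group)"
  obtain \<gamma> where \<gamma>: "\<gamma> \<in> H" "g = coords \<gamma>" using assms by auto
  obtain p where p: "p \<in> polyfuns {1..m}" "\<forall>x\<in>coords ` H. f x = p x"
    using f by (auto simp: coordinate_ring_def regular_function_iff)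
  have ext: "f \<in> extensional (coords ` H)" using f by (simp add: coordinate_ring_def)
  let ?G = "coords ` H" and ?\<gamma> = "\<lambda>x. prod x g"
  let ?N = "\<lambda>h. \<lambda>x\<in>carrier coord_group. right_translation coord_group g h x - h x"
  have G: "?\<gamma> \<in> ?G \<rightarrow> ?G"
    using \<gamma> by (auto simp: coords_mult[symmetric] H_mult)
  have N: "(?N ^^ k) f x = (difference ?\<gamma> ^^ k) p x" if "x \<in> ?G" for k x
    using that
  proof (induction k arbitrary: x)
    case (Suc k)
    moreover have "?\<gamma> x \<in> ?G" using G Suc.prems by blast
    ultimately show ?case
      by (simp add: right_translation_def difference_def)
  qed (use p in auto)
  have "(\<lambda>x. p x) \<in> nilpotent_functions ?\<gamma> ?G"
    by (rule nilpotent_functions_polyfuns[OF G p(1), where c = "\<lambda>x. x"])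
      (use coordinate_nilpotent[OF \<gamma>(1)] \<gamma>(2) in simp)
  then obtain k where k: "\<forall>x\<in>?G. (difference ?\<gamma> ^^ k) p x = 0"
    unfolding nilpotent_functions_def by auto
  have "(?N ^^ k) f = (\<lambda>x\<in>?G. 0)"
  proof (rule extensionalityI[of _ ?G])
    show "(?N ^^ k) f \<in> extensional ?G"
      using ext by (cases k) auto
  qed (use k N in auto)
  then show "\<exists>k. (?N ^^ k) f = (\<lambda>x\<in>carrier coord_group. 0)" by auto
qed

lemma unipotent_algebraic_subgroup_if_contains_open:
  assumes "b \<in> polyfuns {1..m}" "\<phi>0 \<in> H" "b (coords \<phi>0) \<noteq> 0"
    and "\<And>z. z \<in> C \<Longrightarrow> b z \<noteq> 0 \<Longrightarrow> z \<in> coords ` H"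
  shows "unipotent_algebraic_subgroup n H"
proof -
  have closed: "C = coords ` H"
    by (rule closed_if_contains_open[where b = b and ?\<phi>0.0 = \<phi>0]) (fact assms)+
  have "unipotent_algebraic_group m coord_group"
    unfolding unipotent_algebraic_group_def
    using affine_algebraic_coord_group[OF closed] unipotent_coord_group by (intro conjI ballI)
  then show ?thesis
    unfolding unipotent_algebraic_subgroup_def
    using algebraic_structure_coord_group[OF closed]
    by (intro exI[of _ m] exI[of _ coord_group] exI[of _ "inv_into H coords"] conjI)
qed

end


section \<open>Subgroups generated by triangular additive groups\<close>

text \<open>Products along a fixed word will be images of single polynomial maps; the generated
  group is a union of such images.\<close>

primrec word_product :: "('g, 'b) monoid_scheme \<Rightarrow> ('k \<Rightarrow> 'g set) \<Rightarrow> 'k list \<Rightarrow> 'g set" where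
  "word_product G U [] = {\<one>\<^bsub>G\<^esub>}"
| "word_product G U (k # w) = U k <#>\<^bsub>G\<^esub> word_product G U w"

context group
begin

lemma word_product_carrier:
  assumes "\<And>k. k \<in> I \<Longrightarrow> subgroup (U k) G" "w \<in> lists I"
  shows "word_product G U w \<subseteq> carrier G"
  using assms(2)
proof (induction w)
  case (Cons k w)
  then show ?case
    using set_mult_closed[OF subgroup.subset[OF assms(1)]] by simp
qed simp

lemma word_product_append:
  assumes "\<And>k. k \<in> I \<Longrightarrow> subgroup (U k) G" "v \<in> lists I" "w \<in> lists I"
  shows "word_product G U (v @ w) = word_product G U v <#> word_product G U w"
  using assms(2)
proof (induction v)
  case Nil
  have "x \<in> carrier G" if "x \<in> word_product G U w" for x
    using word_product_carrier[of I U w] assms that by blast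
  then show ?case by (force simp: set_mult_def)
next
  case (Cons k v)
  then have "U k \<subseteq> carrier G"
    by (intro subgroup.subset[OF assms(1)]) auto
  moreover have "word_product G U v \<subseteq> carrier G" "word_product G U w \<subseteq> carrier G"
    using word_product_carrier[of I U] assms Cons.hyps by auto
  ultimately have "U k \<subseteq> carrier G" "word_product G U v \<subseteq> carrier G" "word_product G U w \<subseteq> carrier G"
    by auto
  with Cons show ?case by (simp add: set_mult_assoc)
qed

lemma one_in_word_product:
  assumes "\<And>k. k \<in> I \<Longrightarrow> subgroup (U k) G" "w \<in> lists I"
  shows "\<one> \<in> word_product G U w"
  using assms(2)
proof (induction w)
  case (Cons k w)
  then have "\<one> \<in> U k" using subgroup.one_closed[OF assms(1)] by simp
  then have "\<one> \<otimes> \<one> \<in> U k <#> word_product G U w"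
    unfolding set_mult_def using Cons.IH by blast
  then show ?case by simp
qed simp

text \<open>Each factor contains the identity, so either word can be completed by identities.
  Concatenation therefore makes the family of products directed.\<close>

lemma word_product_append_supset:
  assumes "\<And>k. k \<in> I \<Longrightarrow> subgroup (U k) G" "v \<in> lists I" "w \<in> lists I"
  shows "word_product G U v \<union> word_product G U w \<subseteq> word_product G U (v @ w)"
proof -
  have eq: "word_product G U (v @ w) = word_product G U v <#> word_product G U w"
    by (rule word_product_append[OF assms])
  have one: "\<one> \<in> word_product G U v" "\<one> \<in> word_product G U w"
    using one_in_word_product[of I U] assms by blast+
  have carrier: "word_product G U v \<subseteq> carrier G" "word_product G U w \<subseteq> carrier G"
    using word_product_carrier[of I U] assms by blast+
  have 1: "x \<in> word_product G U v <#> word_product G U w" if "x \<in> word_product G U v" for x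
  proof -
    have "x \<otimes> \<one> \<in> word_product G U v <#> word_product G U w"
      unfolding set_mult_def using that one by blast
    then show ?thesis using that carrier by (simp add: subset_iff)
  qed
  have 2: "x \<in> word_product G U v <#> word_product G U w" if "x \<in> word_product G U w" for x
  proof -
    have "\<one> \<otimes> x \<in> word_product G U v <#> word_product G U w"
      unfolding set_mult_def using that one by blast
    then show ?thesis using that carrier by (simp add: subset_iff)
  qed
  show ?thesis unfolding eq using 1 2 by (intro Un_least subsetI)
qed

text \<open>The letters stand for whole subgroups, so the inverse of a generator is covered by a
  word of length one, and products correspond to concatenation.\<close>

lemma generate_eq_word_products:
  assumes sub: "\<And>k. k \<in> I \<Longrightarrow> subgroup (U k) G"
  shows "generate G (\<Union>k\<in>I. U k) = (\<Union>w\<in>lists I. word_product G U w)"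
proof (intro equalityI subsetI)
  have singleton: "h \<in> (\<Union>w\<in>lists I. word_product G U w)" if k: "k \<in> I" "h \<in> U k" for h k
  proof (rule UN_I[of "[k]"])
    have "h \<otimes> \<one> \<in> word_product G U [k]"
      using k unfolding set_mult_def word_product.simps by blast
    then show "h \<in> word_product G U [k]"
      using subgroup.mem_carrier[OF sub[OF k(1)] k(2)] by simp
  qed (use k in auto)
  fix x assume "x \<in> generate G (\<Union>k\<in>I. U k)"
  then show "x \<in> (\<Union>w\<in>lists I. word_product G U w)"
  proof induction
    case one
    show ?case by (rule UN_I[of "[]"]) auto
  next
    case (incl h)
    then obtain k where k: "k \<in> I" "h \<in> U k" by blast
    then show ?case using singleton by blast
  next
    case (inv h)
    then obtain k where k: "k \<in> I" "h \<in> U k" by blast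
    then show ?case using singleton[OF k(1) subgroup.m_inv_closed[OF sub[OF k(1)] k(2)]] by blast
  next
    case (eng h1 h2)
    then obtain v w where vw: "v \<in> lists I" "w \<in> lists I"
      "h1 \<in> word_product G U v" "h2 \<in> word_product G U w" by blast
    have "word_product G U (v @ w) = word_product G U v <#> word_product G U w"
      by (rule word_product_append[OF sub vw(1,2)])
    then have "h1 \<otimes> h2 \<in> word_product G U (v @ w)"
      using vw(3,4) unfolding set_mult_def by blast
    then show ?case using vw by (intro UN_I[of "v @ w"]) auto
  qed
next
  fix x assume "x \<in> (\<Union>w\<in>lists I. word_product G U w)"
  then obtain w where "w \<in> lists I" "x \<in> word_product G U w" by blast
  then show "x \<in> generate G (\<Union>k\<in>I. U k)"
  proof (induction w arbitrary: x)
    case Nil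
    then show ?case by (auto intro: generate.one)
  next
    case (Cons k w)
    then obtain u v where uv: "u \<in> U k" "v \<in> word_product G U w" "x = u \<otimes> v"
      by (auto simp: set_mult_def)
    have "u \<in> generate G (\<Union>k\<in>I. U k)"
      using uv(1) Cons.hyps by (intro generate.incl) blast
    then show ?case unfolding uv(3) using Cons.IH[OF uv(2)] by (rule generate.eng)
  qed
qed

end

text \<open>What the remaining argument keeps of a triangular action of the additive group: a family
  of unitriangular maps, polynomial in the parameter, whose members are exactly the elements of
  \<open>U\<close>.\<close>

definition Ga_chart :: "nat \<Rightarrow> ('a::field \<Rightarrow> (nat \<Rightarrow> 'a) \<Rightarrow> (nat \<Rightarrow> 'a)) \<Rightarrow>
    (nat \<Rightarrow> (unit + nat \<Rightarrow> 'a) \<Rightarrow> 'a) \<Rightarrow> ((nat \<Rightarrow> 'a) \<Rightarrow> (nat \<Rightarrow> 'a)) set \<Rightarrow> bool" where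
  "Ga_chart n \<theta> Q U \<longleftrightarrow> range \<theta> = U \<and> (\<forall>i\<in>{1..n}. Q i \<in> polyfuns ({()} <+> {1..<i}) \<and>
    (\<forall>t. \<forall>x\<in>affine_nspace n. \<theta> t x i = x i + Q i (case_sum (\<lambda>_. t) x)))"

text \<open>A new letter in front of \<open>w\<close> receives the next free parameter
  \<open>t (length w)\<close>. The clause that \<open>F t\<close> reads only the first
  \<open>length w\<close> parameters lets this parameter vary independently of the others, so the
  range is the full product set.\<close>

lemma word_product_parametrization:
  fixes U :: "'k \<Rightarrow> ((nat \<Rightarrow> 'a::field) \<Rightarrow> (nat \<Rightarrow> 'a)) set"
  assumes sub: "\<And>k. k \<in> I \<Longrightarrow> subgroup (U k) (Aut_affine n)"
    and chart: "\<And>k. k \<in> I \<Longrightarrow> Ga_chart n (\<theta> k) (Q k) (U k)"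
    and w: "w \<in> lists I"
  shows "\<exists>F :: (nat \<Rightarrow> 'a) \<Rightarrow> (nat \<Rightarrow> 'a) \<Rightarrow> (nat \<Rightarrow> 'a). range F = word_product (Aut_affine n) U w \<and>
    (\<forall>t t'. (\<forall>j<length w. t j = t' j) \<longrightarrow> F t = F t') \<and>
    (\<forall>i\<in>{1..n}. \<exists>R\<in>polyfuns ({..<length w} <+> {1..n}).
       \<forall>t. \<forall>x\<in>affine_nspace n. F t x i = R (case_sum t x))"
  using w
proof (induction w)
  case Nil
  have "\<exists>R\<in>polyfuns ({..<length []} <+> {1..n}). \<forall>t :: nat \<Rightarrow> 'a. \<forall>x\<in>affine_nspace n.
      \<one>\<^bsub>Aut_affine n\<^esub> x i = R (case_sum t x)" if "i \<in> {1..n}" for i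
    using that by (intro bexI[of _ "\<lambda>z. z (Inr i)"]) (auto simp: Aut_affine_one intro: polyfuns.var)
  then show ?case by (intro exI[of _ "\<lambda>_. \<one>\<^bsub>Aut_affine n\<^esub>"]) auto
next
  case (Cons k w)
  let ?A = "Aut_affine n :: ((nat \<Rightarrow> 'a) \<Rightarrow> nat \<Rightarrow> 'a) monoid" and ?l = "length w"
  let ?S = "affine_nspace n :: (nat \<Rightarrow> 'a) set"
  interpret A: group ?A by (rule group_Aut_affine)
  from Cons.IH obtain F :: "(nat \<Rightarrow> 'a) \<Rightarrow> (nat \<Rightarrow> 'a) \<Rightarrow> (nat \<Rightarrow> 'a)"
    where F: "range F = word_product ?A U w"
      "\<forall>t t'. (\<forall>j<?l. t j = t' j) \<longrightarrow> F t = F t'"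
      "\<forall>i\<in>{1..n}. \<exists>R\<in>polyfuns ({..<?l} <+> {1..n}). \<forall>t. \<forall>x\<in>?S. F t x i = R (case_sum t x)"
    by (elim exE conjE)
  from bchoice[OF F(3)[unfolded Bex_def]] obtain R where
    R: "\<forall>i\<in>{1..n}. R i \<in> polyfuns ({..<?l} <+> {1..n}) \<and>
      (\<forall>t. \<forall>x\<in>?S. F t x i = R i (case_sum t x))" ..
  have F_R: "F t x j = R j (case_sum t x)" if "j \<in> {1..n}" "x \<in> ?S" for j t x
    using bspec[OF R that(1)] that(2) by simp
  have F_carrier: "F t \<in> carrier ?A" for t
  proof -
    have "F t \<in> word_product ?A U w" using F(1) by blast
    then show ?thesis using A.word_product_carrier[of I U w] sub Cons.hyps by blast
  qed
  have \<theta>: "range (\<theta> k) = U k" and Q: "\<And>i. i \<in> {1..n} \<Longrightarrow> Q k i \<in> polyfuns ({()} <+> {1..<i})"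
    and \<theta>_Q: "\<And>t x i. i \<in> {1..n} \<Longrightarrow> x \<in> ?S \<Longrightarrow> \<theta> k t x i = x i + Q k i (case_sum (\<lambda>_. t) x)"
    using chart[of k] Cons.hyps unfolding Ga_chart_def by simp_all
  have \<theta>_carrier: "\<theta> k t \<in> carrier ?A" for t
    using subgroup.mem_carrier[OF sub[of k]] \<theta> Cons.hyps by auto
  define F' where "F' t = \<theta> k (t ?l) \<otimes>\<^bsub>?A\<^esub> F t" for t
  have "range F' = U k <#>\<^bsub>?A\<^esub> range F"
  proof (intro equalityI subsetI)
    fix x assume "x \<in> U k <#>\<^bsub>?A\<^esub> range F"
    then obtain a t where x: "x = \<theta> k a \<otimes>\<^bsub>?A\<^esub> F t"
      unfolding set_mult_def \<theta>[symmetric] by blast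
    have "F (t(?l := a)) = F t" using F(2) by simp
    then have "x = F' (t(?l := a))" by (simp add: F'_def x)
    then show "x \<in> range F'" by blast
  qed (auto simp: F'_def set_mult_def \<theta>[symmetric])
  then have range: "range F' = word_product ?A U (k # w)" using F(1) by simp
  have local: "F' t = F' t'" if "\<forall>j<length (k # w). t j = t' j" for t t'
  proof -
    have "F t = F t'" using F(2) that by simp
    then show ?thesis using that by (simp add: F'_def)
  qed
  have poly: "\<exists>R'\<in>polyfuns ({..<length (k # w)} <+> {1..n}).
      \<forall>t. \<forall>x\<in>?S. F' t x i = R' (case_sum t x)" if i: "i \<in> {1..n}" for i
  proof -
    have Rj: "R j \<in> polyfuns ({..<length (k # w)} <+> {1..n})" if "j \<in> {1..n}" for j
    proof (rule polyfuns_mono)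
      show "R j \<in> polyfuns ({..<?l} <+> {1..n})" using bspec[OF R that] by (rule conjunct1)
    qed auto
    let ?g = "\<lambda>z. case_sum (\<lambda>_::unit. z (Inl ?l)) (\<lambda>j. R j z)"
    let ?R = "\<lambda>z. R i z + Q k i (?g z)"
    have "(\<lambda>z. Q k i (?g z)) \<in> polyfuns ({..<length (k # w)} <+> {1..n})"
    proof (rule polyfuns_comp[OF Q[OF i], where g = ?g])
      fix v :: "unit + nat" assume v: "v \<in> {()} <+> {1..<i}"
      show "(\<lambda>z. ?g z v) \<in> polyfuns ({..<length (k # w)} <+> {1..n})"
      proof (cases v)
        case (Inr j)
        then have "j \<in> {1..n}" using v i by auto
        then show ?thesis using Rj[of j] Inr by simp
      qed (auto intro: polyfuns.var)
    qed
    from polyfuns.add[OF Rj[OF i] this]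
    have "?R \<in> polyfuns ({..<length (k # w)} <+> {1..n})" .
    moreover have "F' t x i = ?R (case_sum t x)" if x: "x \<in> ?S" for t x
    proof -
      have Fx: "F t x \<in> ?S" using Aut_affine_closed[OF F_carrier x] .
      have "F' t x i = F t x i + Q k i (case_sum (\<lambda>_. t ?l) (F t x))"
        unfolding F'_def Aut_affine_mult_apply[OF \<theta>_carrier F_carrier x] by (rule \<theta>_Q[OF i Fx])
      also have "Q k i (case_sum (\<lambda>_. t ?l) (F t x)) = Q k i (?g (case_sum t x))"
      proof (rule polyfuns_cong[OF Q[OF i]])
        fix v :: "unit + nat" assume v: "v \<in> {()} <+> {1..<i}"
        show "case_sum (\<lambda>_. t ?l) (F t x) v = ?g (case_sum t x) v"
          using v i F_R[OF _ x] by (cases v) auto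
      qed
      also have "F t x i = R i (case_sum t x)" by (rule F_R[OF i x])
      finally show ?thesis .
    qed
    ultimately show ?thesis by (intro bexI[of _ ?R] allI ballI)
  qed
  show ?case
    by (intro exI[of _ F'] conjI allI ballI impI range poly) (rule local)
qed

text \<open>For \<open>j < i\<close> the weights \<open>M ^ j\<close> are at most
  \<open>M ^ (i - 1)\<close>, so \<open>Q k i\<close> has weight at most
  \<open>N * M ^ (i - 1)\<close>. This is at most \<open>M ^ i\<close> once \<open>M\<close>
  dominates all of the finitely many bounds \<open>N\<close>.\<close>

lemma uniform_weights:
  fixes Q :: "'k \<Rightarrow> nat \<Rightarrow> (unit + nat \<Rightarrow> 'a::comm_semiring_1) \<Rightarrow> 'a"
  assumes "finite I" and Q: "\<And>k i. k \<in> I \<Longrightarrow> i \<in> {1..n} \<Longrightarrow> Q k i \<in> polyfuns ({()} <+> {1..<i})"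
  shows "\<exists>M\<ge>1. \<forall>k\<in>I. \<forall>i\<in>{1..n}. \<forall>t.
    weight_le (\<lambda>j. M ^ j) {1..<i} (M ^ i) (\<lambda>x. Q k i (case_sum (\<lambda>_. t) x))"
proof -
  have "\<forall>p\<in>I \<times> {1..n}. \<exists>N. \<forall>M d t. (\<forall>j\<in>{1..<snd p}. d j \<le> M) \<longrightarrow>
    weight_le d {1..<snd p} (N * M) (\<lambda>x. Q (fst p) (snd p) (case_sum (\<lambda>_. t) x))"
    by (intro ballI weight_le_uniform Q) auto
  from bchoice[OF this] obtain N where N: "\<forall>p\<in>I \<times> {1..n}. \<forall>M d t. (\<forall>j\<in>{1..<snd p}. d j \<le> M) \<longrightarrow>
    weight_le d {1..<snd p} (N p * M) (\<lambda>x. Q (fst p) (snd p) (case_sum (\<lambda>_. t) x))" ..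
  \<comment> \<open>The sum dominates every \<open>N p\<close>; the summand 1 keeps \<open>M\<close>
    positive, so that its powers do not decrease and all weights are at least 1.\<close>
  define M where "M = 1 + (\<Sum>p\<in>I \<times> {1..n}. N p)"
  have "weight_le (\<lambda>j. M ^ j) {1..<i} (M ^ i) (\<lambda>x. Q k i (case_sum (\<lambda>_. t) x))"
    if k: "k \<in> I" and i: "i \<in> {1..n}" for k i t
  proof -
    have "M ^ j \<le> M ^ (i - 1)" if "j \<in> {1..<i}" for j
      using that by (intro power_increasing) (auto simp: M_def)
    then have "weight_le (\<lambda>j. M ^ j) {1..<i} (N (k, i) * M ^ (i - 1)) (\<lambda>x. Q k i (case_sum (\<lambda>_. t) x))"
      using N[rule_format, of "(k, i)" "\<lambda>j. M ^ j" "M ^ (i - 1)" t] k i by simp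
    moreover have "N (k, i) \<le> (\<Sum>p\<in>I \<times> {1..n}. N p)"
      by (rule member_le_sum) (use k i assms(1) in auto)
    then have "N (k, i) * M ^ (i - 1) \<le> M * M ^ (i - 1)"
      by (intro mult_right_mono) (auto simp: M_def)
    then have "N (k, i) * M ^ (i - 1) \<le> M ^ i"
      using i by (cases i) auto
    ultimately show ?thesis by (rule weight_le_mono) simp
  qed
  then show ?thesis by (intro exI[of _ M]) (auto simp: M_def)
qed

text \<open>The correction to \<open>x_i\<close> is allowed the weight of \<open>x_i\<close> itself
  and no more; this is the condition that survives composition without loss.\<close>

definition weight_bounded :: "nat \<Rightarrow> (nat \<Rightarrow> nat) \<Rightarrow> ((nat \<Rightarrow> 'a::field) \<Rightarrow> (nat \<Rightarrow> 'a)) \<Rightarrow> bool" where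
  "weight_bounded n d \<phi> \<longleftrightarrow> (\<forall>i\<in>{1..n}. \<exists>h. weight_le d {1..<i} (d i) h \<and>
     (\<forall>x\<in>affine_nspace n. \<phi> x i = x i + h x))"

text \<open>The \<open>i\<close>-th component of the composite is
  \<open>x_i + g_i + h (x + g)\<close>, and substituting \<open>x_j + g_j\<close> for
  \<open>x_j\<close> does not raise the weight of \<open>h\<close>. Factors and product obey the
  same \<open>d\<close>, so arbitrarily long words do too.\<close>

lemma weight_bounded_mult:
  assumes "\<phi> \<in> carrier (Aut_affine n)" "\<psi> \<in> carrier (Aut_affine n)"
    and "weight_bounded n d \<phi>" "weight_bounded n d \<psi>"
  shows "weight_bounded n d (\<phi> \<otimes>\<^bsub>Aut_affine n\<^esub> \<psi>)"
proof -
  have "\<forall>i\<in>{1..n}. \<exists>g. weight_le d {1..<i} (d i) g \<and> (\<forall>x\<in>affine_nspace n. \<psi> x i = x i + g x)"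
    using assms(4) unfolding weight_bounded_def .
  from bchoice[OF this] obtain g where g: "\<forall>i\<in>{1..n}. weight_le d {1..<i} (d i) (g i) \<and>
    (\<forall>x\<in>affine_nspace n. \<psi> x i = x i + g i x)" ..
  show ?thesis
    unfolding weight_bounded_def
  proof
    fix i assume i: "i \<in> {1..n}"
    then obtain h where h: "weight_le d {1..<i} (d i) h" "\<forall>x\<in>affine_nspace n. \<phi> x i = x i + h x"
      using assms(3) unfolding weight_bounded_def by blast
    have gj: "weight_le d {1..<i} (d j) (\<lambda>x. x j + g j x)" if "j \<in> {1..<i}" for j
    proof (intro weight_le.add weight_le.var)
      show "weight_le d {1..<i} (d j) (g j)"
        by (rule weight_le_mono[of d "{1..<j}" "d j"]) (use g that i in auto)
    qed (use that in auto)
    have "weight_le d {1..<i} (d i) (\<lambda>x. g i x + h (\<lambda>j. x j + g j x))"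
      using g i by (intro weight_le.add weight_le_comp[OF h(1) gj]) auto
    moreover have "(\<phi> \<otimes>\<^bsub>Aut_affine n\<^esub> \<psi>) x i = x i + (g i x + h (\<lambda>j. x j + g j x))"
      if x: "x \<in> affine_nspace n" for x
    proof -
      have "(\<phi> \<otimes>\<^bsub>Aut_affine n\<^esub> \<psi>) x i = \<psi> x i + h (\<psi> x)"
        unfolding Aut_affine_mult_apply[OF assms(1,2) x]
        using h(2) Aut_affine_closed[OF assms(2) x] by blast
      moreover have "h (\<psi> x) = h (\<lambda>j. x j + g j x)"
        by (rule polyfuns_cong[OF weight_le_imp_polyfuns[OF h(1)]]) (use g x i in auto)
      ultimately show ?thesis using g i x by simp
    qed
    ultimately show "\<exists>h. weight_le d {1..<i} (d i) h \<and>
        (\<forall>x\<in>affine_nspace n. (\<phi> \<otimes>\<^bsub>Aut_affine n\<^esub> \<psi>) x i = x i + h x)"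
      by (intro exI[of _ "\<lambda>x. g i x + h (\<lambda>j. x j + g j x)"] conjI ballI)
  qed
qed

lemma weight_bounded_one: "weight_bounded n d \<one>\<^bsub>Aut_affine n\<^esub>"
  unfolding weight_bounded_def Aut_affine_one
  by (intro ballI exI[of _ "\<lambda>_. 0"]) (auto intro: weight_le.const)

lemma word_product_weight_bounded:
  assumes sub: "\<And>k. k \<in> I \<Longrightarrow> subgroup (U k) (Aut_affine n)"
    and U: "\<And>k \<phi>. k \<in> I \<Longrightarrow> \<phi> \<in> U k \<Longrightarrow> weight_bounded n d \<phi>"
    and "w \<in> lists I" "\<phi> \<in> word_product (Aut_affine n) U w"
  shows "weight_bounded n d (\<phi> :: (nat \<Rightarrow> 'a::field) \<Rightarrow> nat \<Rightarrow> 'a)"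
  using assms(3,4)
proof (induction w arbitrary: \<phi>)
  case Nil
  then show ?case using weight_bounded_one by auto
next
  case (Cons k w)
  interpret A: group "Aut_affine n :: ((nat \<Rightarrow> 'a) \<Rightarrow> nat \<Rightarrow> 'a) monoid"
    by (rule group_Aut_affine)
  obtain u v where uv: "u \<in> U k" "v \<in> word_product (Aut_affine n) U w" "\<phi> = u \<otimes>\<^bsub>Aut_affine n\<^esub> v"
    using Cons.prems by (auto simp: set_mult_def)
  have "u \<in> carrier (Aut_affine n)"
    using subgroup.mem_carrier[OF sub[OF Cons.hyps(1)] uv(1)] .
  moreover have "v \<in> carrier (Aut_affine n)"
    using A.word_product_carrier[of I U w] sub Cons.hyps(2) uv(2) by blast
  ultimately show ?case
    unfolding uv(3) by (rule weight_bounded_mult[OF _ _ U[OF Cons.hyps(1) uv(1)] Cons.IH[OF uv(2)]])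
qed

text \<open>All components of all such maps lie in the span of the monomials with exponents at most
  \<open>D\<close>, a finite set that does not depend on the map. Interpolation on this span yields
  nodes that serve all of them at once.\<close>

lemma weight_bounded_interpolation:
  assumes d: "\<And>i. i \<in> {1..n} \<Longrightarrow> 1 \<le> d i \<and> d i \<le> D"
  shows "\<exists>P e. finite P \<and> P \<subseteq> affine_nspace n \<and> (\<forall>p\<in>P. e p \<in> polyfuns {1..n}) \<and>
    (\<forall>\<phi> :: (nat \<Rightarrow> 'a::field) \<Rightarrow> nat \<Rightarrow> 'a. weight_bounded n d \<phi> \<longrightarrow>
      (\<forall>x\<in>affine_nspace n. \<forall>i\<in>{1..n}. \<phi> x i = (\<Sum>p\<in>P. \<phi> p i * e p x)))"
proof -
  define mon :: "(nat \<Rightarrow> nat) \<Rightarrow> (nat \<Rightarrow> 'a) \<Rightarrow> 'a" where "mon m x = (\<Prod>i\<in>{1..n}. x i ^ m i)" for m x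
  let ?M = "{1..n} \<rightarrow>\<^sub>E {..D}" and ?S = "affine_nspace n :: (nat \<Rightarrow> 'a) set"
  have fin: "finite (mon ` ?M)" by (intro finite_imageI finite_PiE) auto
  have "mon m \<in> polyfuns {1..n}" for m
    unfolding mon_def[abs_def] by (intro polyfuns_prod polyfuns_power polyfuns.var)
  then have "mon ` ?M \<subseteq> polyfuns {1..n}" by blast
  from interpolation[OF fin this, of ?S] obtain P e where P: "finite P" "P \<subseteq> ?S" "\<forall>p\<in>P. e p \<in> polyfuns {1..n}"
    and mon: "\<forall>f\<in>mon ` ?M. \<forall>x\<in>?S. f x = (\<Sum>p\<in>P. f p * e p x)"
    by (elim exE conjE) (rule that)
  have "\<phi> x i = (\<Sum>p\<in>P. \<phi> p i * e p x)"
    if \<phi>: "weight_bounded n d \<phi>" and x: "x \<in> ?S" and i: "i \<in> {1..n}" for \<phi> x i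
  proof -
    obtain h where h: "weight_le d {1..<i} (d i) h" "\<forall>x\<in>?S. \<phi> x i = x i + h x"
      using \<phi> i unfolding weight_bounded_def by blast
    have "weight_le d {1..n} D (\<lambda>x. x i + h x)"
    proof (intro weight_le.add weight_le.var)
      show "weight_le d {1..n} D h"
        by (rule weight_le_mono[OF h(1)]) (use d[OF i] i in auto)
    qed (use d[OF i] i in auto)
    then obtain c where "(\<lambda>x. x i + h x) = (\<lambda>x. \<Sum>m\<in>?M. c m * mon m x)"
      using weight_le_span[of "{1..n}" d D "\<lambda>x. x i + h x"] d unfolding mon_def by auto
    then have \<phi>_eq: "\<phi> y i = (\<Sum>m\<in>?M. c m * mon m y)" if "y \<in> ?S" for y
      using h(2) that by (simp add: fun_eq_iff)
    have "\<phi> x i = (\<Sum>m\<in>?M. \<Sum>p\<in>P. c m * mon m p * e p x)"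
      unfolding \<phi>_eq[OF x] using mon x by (intro sum.cong refl) (simp add: sum_distrib_left mult.assoc)
    also have "\<dots> = (\<Sum>p\<in>P. \<Sum>m\<in>?M. c m * mon m p * e p x)" by (rule sum.swap)
    also have "\<dots> = (\<Sum>p\<in>P. \<phi> p i * e p x)"
    proof (rule sum.cong[OF refl])
      fix p assume "p \<in> P"
      then have "p \<in> ?S" using P(2) by blast
      then show "(\<Sum>m\<in>?M. c m * mon m p * e p x) = \<phi> p i * e p x"
        by (simp add: \<phi>_eq sum_distrib_right)
    qed
    finally show ?thesis .
  qed
  then show ?thesis using P by (intro exI[of _ P] exI[of _ e] conjI allI impI ballI) simp_all
qed

text \<open>Finiteness of \<open>I\<close> gives common weights for all generators and with them the
  interpolation nodes. In the resulting coordinates the products along words form a directed family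
  of polynomial images, so one of them contains a nonempty open part of the closure of
  \<open>H\<close>.\<close>

lemma unipotent_algebraic_generate:
  fixes U :: "'k \<Rightarrow> ((nat \<Rightarrow> 'a::alg_closed_field) \<Rightarrow> (nat \<Rightarrow> 'a)) set"
  assumes "finite I" and subU: "\<And>k. k \<in> I \<Longrightarrow> subgroup (U k) (Aut_affine n)"
    and chart: "\<And>k. k \<in> I \<Longrightarrow> Ga_chart n (\<theta> k) (Q k) (U k)"
  shows "unipotent_algebraic_subgroup n (generate (Aut_affine n) (\<Union>k\<in>I. U k))"
proof -
  let ?A = "Aut_affine n :: ((nat \<Rightarrow> 'a) \<Rightarrow> nat \<Rightarrow> 'a) monoid"
  let ?S = "affine_nspace n :: (nat \<Rightarrow> 'a) set"
  interpret A: group ?A by (rule group_Aut_affine)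
  let ?W = "word_product ?A U"
  define H where "H = generate ?A (\<Union>k\<in>I. U k)"
  have H: "H = (\<Union>w\<in>lists I. ?W w)"
    unfolding H_def by (rule A.generate_eq_word_products[OF subU])
  have "(\<Union>k\<in>I. U k) \<subseteq> carrier ?A"
    using subgroup.subset[OF subU] by (rule UN_least)
  then have subH: "subgroup H ?A"
    unfolding H_def by (rule A.generate_is_subgroup)
  have Q: "Q k i \<in> polyfuns ({()} <+> {1..<i})" if "k \<in> I" "i \<in> {1..n}" for k i
    using chart[OF that(1)] that(2) unfolding Ga_chart_def by simp
  have "\<exists>M\<ge>1. \<forall>k\<in>I. \<forall>i\<in>{1..n}. \<forall>t.
      weight_le (\<lambda>j. M ^ j) {1..<i} (M ^ i) (\<lambda>x. Q k i (case_sum (\<lambda>_. t) x))"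
    by (rule uniform_weights[OF assms(1) Q])
  then obtain M where M: "M \<ge> 1" and M_Q: "\<forall>k\<in>I. \<forall>i\<in>{1..n}. \<forall>t.
    weight_le (\<lambda>j. M ^ j) {1..<i} (M ^ i) (\<lambda>x. Q k i (case_sum (\<lambda>_. t) x))"
    by (elim exE conjE) (rule that)
  define d where "d j = M ^ j" for j
  have U_bounded: "weight_bounded n d \<phi>" if k: "k \<in> I" and \<phi>U: "\<phi> \<in> U k" for k \<phi>
  proof -
    obtain t where \<phi>: "\<phi> = \<theta> k t"
      using chart[OF k] \<phi>U unfolding Ga_chart_def by blast
    show ?thesis
      unfolding weight_bounded_def
    proof
      fix i assume i: "i \<in> {1..n}"
      show "\<exists>h. weight_le d {1..<i} (d i) h \<and> (\<forall>x\<in>?S. \<phi> x i = x i + h x)"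
        using M_Q k i chart[OF k] unfolding Ga_chart_def \<phi> d_def
        by (intro exI[of _ "\<lambda>x. Q k i (case_sum (\<lambda>_. t) x)"]) simp
    qed
  qed
  have H_bounded: "weight_bounded n d \<phi>" if "\<phi> \<in> H" for \<phi>
  proof -
    obtain w where w: "w \<in> lists I" "\<phi> \<in> ?W w" using \<open>\<phi> \<in> H\<close> unfolding H by blast
    show ?thesis by (rule word_product_weight_bounded[OF subU U_bounded w])
  qed
  have d: "1 \<le> d i \<and> d i \<le> M ^ n" if "i \<in> {1..n}" for i
    using that M unfolding d_def by (auto intro: power_increasing)
  have "\<exists>P e. finite P \<and> P \<subseteq> ?S \<and> (\<forall>p\<in>P. e p \<in> polyfuns {1..n}) \<and>
    (\<forall>\<phi> :: (nat \<Rightarrow> 'a) \<Rightarrow> nat \<Rightarrow> 'a. weight_bounded n d \<phi> \<longrightarrow>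
      (\<forall>x\<in>?S. \<forall>i\<in>{1..n}. \<phi> x i = (\<Sum>p\<in>P. \<phi> p i * e p x)))"
    by (rule weight_bounded_interpolation[OF d])
  then obtain P e where P: "finite P" "P \<subseteq> ?S" "\<forall>p\<in>P. e p \<in> polyfuns {1..n}"
    and interp: "\<forall>\<phi> :: (nat \<Rightarrow> 'a) \<Rightarrow> nat \<Rightarrow> 'a. weight_bounded n d \<phi> \<longrightarrow>
      (\<forall>x\<in>?S. \<forall>i\<in>{1..n}. \<phi> x i = (\<Sum>p\<in>P. \<phi> p i * e p x))"
    by (elim exE conjE) (rule that)
  interpret interpolated_group n H P e
  proof (rule interpolated_group.intro)
    show "\<phi> x i = (\<Sum>p\<in>P. \<phi> p i * e p x)" if "\<phi> \<in> H" "x \<in> ?S" "i \<in> {1..n}" for \<phi> x i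
      using interp[rule_format, OF H_bounded[OF that(1)] that(2,3)] .
    show "\<exists>h\<in>polyfuns {1..<i}. \<forall>x\<in>?S. \<phi> x i = x i + h x" if "\<phi> \<in> H" "i \<in> {1..n}" for \<phi> i
    proof -
      obtain h where h: "weight_le d {1..<i} (d i) h" "\<forall>x\<in>?S. \<phi> x i = x i + h x"
        using H_bounded[OF \<open>\<phi> \<in> H\<close>] \<open>i \<in> {1..n}\<close> unfolding weight_bounded_def by blast
      show ?thesis by (rule bexI[of _ h]) (rule h(2), rule weight_le_imp_polyfuns[OF h(1)])
    qed
  qed (use subH P in auto)
  let ?F = "(\<lambda>w. coords ` ?W w) ` lists I"
  have Un: "\<Union>?F = coords ` H" by (simp only: H image_UN)
  have image: "polynomial_image {1..m} (coords ` ?W w)" if w: "w \<in> lists I" for w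
  proof -
    have "\<exists>F :: (nat \<Rightarrow> 'a) \<Rightarrow> (nat \<Rightarrow> 'a) \<Rightarrow> (nat \<Rightarrow> 'a). range F = ?W w \<and>
        (\<forall>t t'. (\<forall>j<length w. t j = t' j) \<longrightarrow> F t = F t') \<and>
        (\<forall>i\<in>{1..n}. \<exists>R\<in>polyfuns ({..<length w} <+> {1..n}). \<forall>t. \<forall>x\<in>?S. F t x i = R (case_sum t x))"
      by (rule word_product_parametrization[OF subU chart w])
    then obtain F :: "(nat \<Rightarrow> 'a) \<Rightarrow> (nat \<Rightarrow> 'a) \<Rightarrow> (nat \<Rightarrow> 'a)"
      where F: "range F = ?W w" "\<forall>i\<in>{1..n}. \<exists>R\<in>polyfuns ({..<length w} <+> {1..n}).
        \<forall>t. \<forall>x\<in>?S. F t x i = R (case_sum t x)"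
      by (elim exE conjE) (rule that)
    \<comment> \<open>A coordinate of \<open>F t\<close> is a component of its value at a fixed
      node, so only the parameters remain as variables.\<close>
    have "(\<lambda>t. coords (F t) k) \<in> polyfuns {..<length w}" if k: "k \<in> {1..m}" for k
    proof -
      obtain R where R: "R \<in> polyfuns ({..<length w} <+> {1..n})"
        "\<forall>t. \<forall>x\<in>?S. F t x (fst (node k)) = R (case_sum t x)"
        using bspec[OF F(2) node(1)[OF k]] by (elim bexE) (rule that)
      have "(\<lambda>t. R (case_sum t (snd (node k)))) \<in> polyfuns {..<length w}"
        by (rule polyfuns_comp[OF R(1), where g = "\<lambda>t. case_sum t (snd (node k))"])
          (auto intro: polyfuns.var polyfuns.const)
      moreover have "coords (F t) k = R (case_sum t (snd (node k)))" for t
        using R(2) node(3)[OF k] k by (simp add: coords_def)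
      ultimately show ?thesis by (simp only:)
    qed
    moreover have "coords ` ?W w = range (\<lambda>t. coords (F t))" by (simp only: F(1)[symmetric] image_image)
    ultimately show ?thesis
      unfolding polynomial_image_def
      by (intro exI[of _ "{..<length w}"] exI[of _ "\<lambda>t. coords (F t)"] conjI ballI) simp_all
  qed
  have dir: "\<exists>Z\<in>?F. X \<subseteq> Z \<and> Y \<subseteq> Z" if XY: "X \<in> ?F" "Y \<in> ?F" for X Y
  proof -
    from XY obtain v w where vw: "v \<in> lists I" "w \<in> lists I" "X = coords ` ?W v" "Y = coords ` ?W w"
      by blast
    have "?W v \<union> ?W w \<subseteq> ?W (v @ w)"
      by (rule A.word_product_append_supset[OF subU vw(1,2)])
    then show ?thesis using vw by (intro bexI[of _ "coords ` ?W (v @ w)"]) auto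
  qed
  have "\<exists>X\<in>?F. \<exists>b\<in>polyfuns {1..m}. (\<exists>y\<in>X. b y \<noteq> 0) \<and>
      (\<forall>z\<in>zariski_closure {1..m} (\<Union>?F). b z \<noteq> 0 \<longrightarrow> (\<exists>x\<in>X. \<forall>j\<in>{1..m}. z j = x j))"
  proof (rule directed_union_contains_open[OF _ _ _ dir])
    show "polynomial_image {1..m} X" if "X \<in> ?F" for X using that image by blast
  qed auto
  from this[unfolded Un] obtain X b where X: "X \<in> ?F" and b: "b \<in> polyfuns {1..m}" "\<exists>y\<in>X. b y \<noteq> 0"
    "\<forall>z\<in>zariski_closure {1..m} (coords ` H). b z \<noteq> 0 \<longrightarrow> (\<exists>x\<in>X. \<forall>j\<in>{1..m}. z j = x j)"
    by (elim bexE conjE) (rule that, assumption, assumption, rule bexI[rotated], assumption+)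
  have X_H: "X \<subseteq> coords ` H" using X Un by blast
  from b(2) obtain y where y: "y \<in> X" "b y \<noteq> 0" by blast
  with X_H obtain \<phi>0 where "\<phi>0 \<in> H" "y = coords \<phi>0" by blast
  with y have \<phi>0: "\<phi>0 \<in> H" "b (coords \<phi>0) \<noteq> 0" by simp_all
  have "unipotent_algebraic_subgroup n H"
  proof (rule unipotent_algebraic_subgroup_if_contains_open[where b = b and ?\<phi>0.0 = \<phi>0])
    fix z assume z: "z \<in> C" "b z \<noteq> 0"
    then have "\<exists>x\<in>X. \<forall>j\<in>{1..m}. z j = x j" using b(3) by simp
    then obtain x where x: "x \<in> X" "\<forall>j\<in>{1..m}. z j = x j" by blast
    then have "x \<in> affine_space {1..m}" using X_H coords_affine by blast
    \<comment> \<open>Both points are \<open>undefined\<close> outside \<open>{1..m}\<close>, so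
      agreement on these coordinates is equality.\<close>
    then have "z = x" using z x(2) by (intro affine_eqI[of z "{1..m}" x]) auto
    then show "z \<in> coords ` H" using x(1) X_H by blast
  qed (use b \<phi>0 in auto)
  then show ?thesis unfolding H_def .
qed

theorem corollary1:
  fixes n s :: nat
    and U :: "nat \<Rightarrow> ((nat \<Rightarrow> 'a::alg_closed_field) \<Rightarrow> (nat \<Rightarrow> 'a)) set"
  assumes "n \<ge> 1"
    and "\<And>i. i \<in> {1..s} \<Longrightarrow> triangular_subgroup n (U i)"
    and "\<And>i. i \<in> {1..s} \<Longrightarrow> Ga_subgroup n (U i)"
  shows "unipotent_algebraic_subgroup n (generate (Aut_affine n) (\<Union>i\<in>{1..s}. U i))"
proof -
  have "\<forall>i\<in>{1..s}. \<exists>\<theta> Q. Ga_chart n \<theta> Q (U i)"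
    unfolding Ga_chart_def by (intro ballI triangular_Ga_parametrization assms)
  from bchoice[OF this] obtain \<theta> where "\<forall>i\<in>{1..s}. \<exists>Q. Ga_chart n (\<theta> i) Q (U i)" ..
  from bchoice[OF this] obtain Q where "\<forall>i\<in>{1..s}. Ga_chart n (\<theta> i) (Q i) (U i)" ..
  then show ?thesis
    using assms(2) by (intro unipotent_algebraic_generate[where \<theta> = \<theta> and Q = Q])
      (auto simp: triangular_subgroup_def)
qed

end
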